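(* Let $G$ and $G'$ be finite abelian groups and let $k,k'\in\mathbb N$ be maximal such that $G$ has a subgroup isomorphic to $C_{\exp(G)}^{k}$ and $G'$ has a subgroup isomorphic to $C_{\exp(G')}^{k'}$. Suppose that $\mathsf r(G)+k\le\exp(G)-2$, that $G\not\cong C_{2\mathsf r(G)+2}^{\mathsf r(G)}$, and that $\mathcal L(G)=\mathcal L(G')$. Then $\exp(G)=\exp(G')$ and $k=k'$. In particular: (1) If $\mathsf r(G)\ge\left\lfloor\frac{\exp(G)}{2}\right\rfloor+1$, then $\mathsf r(G)=\mathsf r(G')$. (2) If $G\cong C_{\exp(G)}^{\mathsf r(G)}$, then $G\cong G'$.
   Context: $\mathbb N$ is the set of positive integers and $C_m$ is the cyclic group of order $m$. A finite abelian group $G$ is isomorphic to $C_{n_1}\oplus\dots\oplus C_{n_r}$ with $1<n_1\mid\dots\mid n_r$; then $\mathsf r(G)=r$ is its rank and $\exp(G)=n_r$ its exponent. For a finite abelian group $G$ (written additively), $\mathcal F(G)$ is the (multiplicatively written) free abelian monoid with basis $G$; its elements are called sequences over $G$. $\mathcal B(G)=\{g_1\cdot\ldots\cdot g_l\in\mathcal F(G)\mid g_1+\dots+g_l=0\}$ is the monoid of zero-sum sequences over $G$. Its only unit is the empty sequence, and its atoms are the minimal zero-sum sequences (nonempty zero-sum sequences that are not a product of two nonempty zero-sum sequences). For $B\in\mathcal B(G)$, the set of lengths $\mathsf L(B)$ is the set of all $\ell$ such that $B$ is a product of $\ell$ atoms of $\mathcal B(G)$ (with $\mathsf L(B)=\{0\}$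 for the empty sequence). The system of sets of lengths is $\mathcal L(G)=\{\mathsf L(B)\mid B\in\mathcal B(G)\}$. *)

theory Defs
  imports "HOL-Algebra.Algebra" "HOL-Library.Multiset"
begin

text \<open>
  Groups are those of HOL-Algebra, so the operation of an abelian group is written
  multiplicatively: the sum of group elements is \<open>\<Otimes>\<close> and the zero element is \<open>\<one>\<close>.
\<close>

section \<open>Rank and exponent\<close>

text \<open>\<open>C(n_1) \<oplus> \<dots> \<oplus> C(n_r)\<close> for the list \<open>[n_1, \<dots>, n_r]\<close>\<close>
definition cyclic_sum :: "nat list \<Rightarrow> (nat \<Rightarrow> int) monoid" where
  "cyclic_sum ns = product_group {..<length ns} (\<lambda>i. integer_mod_group (ns ! i))"

definition cyclic_power :: "nat \<Rightarrow> nat \<Rightarrow> (nat \<Rightarrow> int) monoid" where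
  "cyclic_power n k = cyclic_sum (replicate k n)"

text \<open>
  For a finite abelian group there is exactly one list as below, by the structure theorem.
\<close>
definition invariant_factors :: "('a, 'b) monoid_scheme \<Rightarrow> nat list" where
  "invariant_factors G =
     (THE ns. (\<forall>n\<in>set ns. 1 < n) \<and> sorted_wrt (dvd) ns \<and> G \<cong> cyclic_sum ns)"

definition group_rank :: "('a, 'b) monoid_scheme \<Rightarrow> nat" where
  "group_rank G = length (invariant_factors G)"

text \<open>
  The largest invariant factor; the leading \<open>1\<close> matters only for the trivial group, which has
  no invariant factors and exponent 1.
\<close>
definition group_exponent :: "('a, 'b) monoid_scheme \<Rightarrow> nat" where
  "group_exponent G = last (1 # invariant_factors G)"

definition has_subgroup_iso :: "('a, 'b) monoid_scheme \<Rightarrow> ('c, 'd) monoid_scheme \<Rightarrow> bool" where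
  "has_subgroup_iso G K \<longleftrightarrow> (\<exists>H. subgroup H G \<and> G\<lparr>carrier := H\<rparr> \<cong> K)"

text \<open>
  No \<open>k\<close> satisfies this for the trivial group, in which \<open>C(1)^j\<close> embeds for every \<open>j\<close>.
\<close>
definition max_exponent_power :: "('a, 'b) monoid_scheme \<Rightarrow> nat \<Rightarrow> bool" where
  "max_exponent_power G k \<longleftrightarrow>
     1 \<le> k \<and>
     has_subgroup_iso G (cyclic_power (group_exponent G) k) \<and>
     (\<forall>j\<ge>1. has_subgroup_iso G (cyclic_power (group_exponent G) j) \<longrightarrow> j \<le> k)"

section \<open>Zero-sum sequences and sets of lengths\<close>

text \<open>
  The free abelian monoid with basis \<open>G\<close> consists of the multisets over \<open>carrier G\<close>, with
  multiset addition as the product of sequences and \<open>{#}\<close> as the empty sequence.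
\<close>
definition sequences :: "('a, 'b) monoid_scheme \<Rightarrow> 'a multiset set" where
  "sequences G = {S. set_mset S \<subseteq> carrier G}"

definition seq_sum :: "('a, 'b) monoid_scheme \<Rightarrow> 'a multiset \<Rightarrow> 'a" where
  "seq_sum G S = (\<Otimes>\<^bsub>G\<^esub>g\<in>set_mset S. g [^]\<^bsub>G\<^esub> count S g)"

definition zero_sum_seqs :: "('a, 'b) monoid_scheme \<Rightarrow> 'a multiset set" where
  "zero_sum_seqs G = {S \<in> sequences G. seq_sum G S = \<one>\<^bsub>G\<^esub>}"

definition minimal_zero_sum_seqs :: "('a, 'b) monoid_scheme \<Rightarrow> 'a multiset set" where
  "minimal_zero_sum_seqs G =
     {A \<in> zero_sum_seqs G. A \<noteq> {#} \<and>
        \<not> (\<exists>U\<in>zero_sum_seqs G. \<exists>V\<in>zero_sum_seqs G. U \<noteq> {#} \<and> V \<noteq> {#} \<and> A = U + V)}"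

text \<open>A factorization of \<open>B\<close> is a multiset of atoms whose product is \<open>B\<close>.\<close>
definition set_of_lengths :: "('a, 'b) monoid_scheme \<Rightarrow> 'a multiset \<Rightarrow> nat set" where
  "set_of_lengths G B =
     {size Z | Z. set_mset Z \<subseteq> minimal_zero_sum_seqs G \<and> \<Sum>\<^sub># Z = B}"

definition system_of_sets_of_lengths :: "('a, 'b) monoid_scheme \<Rightarrow> nat set set" where
  "system_of_sets_of_lengths G = set_of_lengths G ` zero_sum_seqs G"

end

theory Submission
  imports Defs
begin

text \<open>
  Let \<open>D(G)\<close> be the set of all \<open>M \<ge> 1\<close> such that the system of sets of lengths of \<open>G\<close> contains arbitrarily long arithmetic
  progressions \<open>{y + M * i | i \<le> m}\<close>. With \<open>r\<close> the rank, \<open>n\<close> the exponent and \<open>k\<close> as in the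
  theorem, \<open>D(G)\<close> contains \<open>[1, r - 1]\<close> (take \<open>M + 1\<close> independent elements of equal order
  and their sum) and \<open>[n - k - 1, n - 2]\<close> (take \<open>n - M - 1\<close> independent elements of order \<open>n\<close>
  and minus their sum). Conversely, if \<open>M \<in> D(G)\<close>, \<open>M \<ge> r\<close> and \<open>n \<le> 2 * M + 1\<close>, then
  \<open>n - k - 1 \<le> M \<le> n - 2\<close>: the elements of unbounded multiplicity form a set over which all
  lengths of a sequence agree modulo \<open>M\<close>, but some atom has cross number \<open>\<noteq> 1\<close>; under the
  hypotheses on \<open>M\<close> there is even an atom of cross number \<open>< 1\<close>, and a shortest one consists
  of \<open>n - M\<close> distinct elements of order \<open>n\<close>, all but one of which are independent.
  So \<open>n - 2\<close> is the maximum of \<open>D(G)\<close>, the number \<open>n - k - 2\<close> is missing from it, and this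
  determines \<open>n\<close>, \<open>k\<close> and a large rank. If \<open>G\<close> is homocyclic, it embeds into \<open>G'\<close>, and the
  embedding is onto because the Davenport constant is strictly monotone.
\<close>

text \<open>The crux is why cross numbers that are all at least 1 over a set must all equal 1. Over
  the integers localized at a prime, \<open>r\<close> of the elements span all others, so relations
  of support at most \<open>r + 1\<close> generate all relations; the bound \<open>r \<le> M\<close>
  forces cross number 1 on atoms of such small support. The spanning elements depend on the prime,
  so the local statements are glued through the ideal of good multipliers. This describes an atom
  only modulo full powers \<open>g ^ ord g\<close>, and dividing these powers out again could
  shorten factorizations too much; the bound \<open>n \<le> 2 * M + 1\<close> ensures that each
  power costs at most one factor. The excluded group is the only one, among those satisfying the
  other hypotheses, with \<open>n = 2 * k + 2\<close>: there the missing number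
  \<open>M = n - k - 2\<close> violates \<open>n \<le> 2 * M + 1\<close>, so the converse does not
  reach it.\<close>

section \<open>Zero-sum sequences in coordinates\<close>

text \<open>Gaussian elimination over the integers localized at \<open>p\<close>: among the nonzero
  entries of the last coordinate, one of least \<open>p\<close>-adic valuation divides all others up
  to factors prime to \<open>p\<close>, so it serves as pivot. Denominators prime to
  \<open>p\<close> are collected in \<open>b\<close>, which keeps everything integral. Each
  coordinate costs at most one pivot, hence \<open>card I \<le> r\<close>.\<close>

lemma p_local_span:
  fixes f :: "'a \<Rightarrow> nat \<Rightarrow> int" and p :: int
  assumes "finite F" "Factorial_Ring.prime p"
  shows "\<exists>I\<subseteq>F. card I \<le> r \<and>
    (\<forall>g\<in>F. \<exists>b c. \<not> p dvd b \<and> (\<forall>i<r. b * f g i = (\<Sum>j\<in>I. c j * f j i)))"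
proof (induction r arbitrary: f)
  case 0
  have "\<not> p dvd 1" using assms(2) by auto
  then show ?case by (intro exI[of _ "{}"]) (auto intro!: exI[of _ 1])
next
  case (Suc r)
  show ?case
  proof (cases "\<forall>g\<in>F. f g r = 0")
    case True
    obtain I where I: "I \<subseteq> F" "card I \<le> r"
      "\<forall>g\<in>F. \<exists>b c. \<not> p dvd b \<and> (\<forall>i<r. b * f g i = (\<Sum>j\<in>I. c j * f j i))"
      using Suc.IH by blast
    have "\<exists>b c. \<not> p dvd b \<and> (\<forall>i<Suc r. b * f g i = (\<Sum>j\<in>I. c j * f j i))" if "g \<in> F" for g
    proof -
      obtain b c where bc: "\<not> p dvd b" "\<forall>i<r. b * f g i = (\<Sum>j\<in>I. c j * f j i)"
        using I(3) \<open>g \<in> F\<close> by blast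
      have "b * f g r = (\<Sum>j\<in>I. c j * f j r)"
        using True \<open>g \<in> F\<close> I(1) by (simp add: subset_iff)
      then have "\<forall>i<Suc r. b * f g i = (\<Sum>j\<in>I. c j * f j i)" using bc(2) less_Suc_eq by auto
      then show ?thesis using bc(1) by blast
    qed
    then show ?thesis using I(1) le_SucI[OF I(2)] by blast
  next
    case False
    define a where "a = Min ((\<lambda>g. multiplicity p (f g r)) ` {g\<in>F. f g r \<noteq> 0})"
    have ne: "(\<lambda>g. multiplicity p (f g r)) ` {g\<in>F. f g r \<noteq> 0} \<noteq> {}" using False by auto
    have fin: "finite ((\<lambda>g. multiplicity p (f g r)) ` {g\<in>F. f g r \<noteq> 0})" using assms(1) by auto
    obtain g0 where g0: "g0 \<in> F" "f g0 r \<noteq> 0" "a = multiplicity p (f g0 r)"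
      using Min_in[OF fin ne] unfolding a_def by auto
    have adv: "p ^ a dvd f h r" if "h \<in> F" for h
    proof (cases "f h r = 0")
      case False
      then have "a \<le> multiplicity p (f h r)" unfolding a_def using that fin by (intro Min_le) auto
      then show ?thesis by (meson multiplicity_dvd')
    qed auto
    obtain u where u: "f g0 r = p ^ a * u" "\<not> p dvd u"
    proof -
      have "\<not> is_unit p" using assms(2) by auto
      then obtain u where "f g0 r = p ^ multiplicity p (f g0 r) * u" "\<not> p dvd u"
        using multiplicity_decompose'[OF g0(2)] by metis
      then show ?thesis using that g0(3) by auto
    qed
    have "\<forall>h\<in>F. \<exists>w. f h r = p ^ a * w" using adv by (auto simp: dvd_def)
    then obtain w where w: "\<And>h. h \<in> F \<Longrightarrow> f h r = p ^ a * w h" by metis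
    \<comment> \<open>Cross-multiplied elimination: \<open>f g0 r = p ^ a * u\<close> and
      \<open>f h r = p ^ a * w h\<close>, so the last coordinate of \<open>f'\<close> vanishes
      without any division.\<close>
    define f' where "f' h i = u * f h i - w h * f g0 i" for h i
    obtain I where I: "I \<subseteq> F" "card I \<le> r"
      "\<forall>g\<in>F. \<exists>b c. \<not> p dvd b \<and> (\<forall>i<r. b * f' g i = (\<Sum>j\<in>I. c j * f' j i))"
      using Suc.IH[of f'] by blast
    have finI: "finite I" using I(1) assms(1) finite_subset by auto
    have z: "f' h r = 0" if "h \<in> F" for h using w[OF that] u by (simp add: f'_def)
    have "\<exists>b c. \<not> p dvd b \<and> (\<forall>i<Suc r. b * f g i = (\<Sum>j\<in>insert g0 I. c j * f j i))" if "g \<in> F" for g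
    proof -
      obtain b c where bc: "\<not> p dvd b" "\<forall>i<r. b * f' g i = (\<Sum>j\<in>I. c j * f' j i)"
        using I(3) \<open>g \<in> F\<close> by blast
      have bc': "b * f' g i = (\<Sum>j\<in>I. c j * f' j i)" if "i < Suc r" for i
      proof (cases "i = r")
        case True
        then show ?thesis using z \<open>g \<in> F\<close> I(1) by (simp add: subset_iff)
      qed (use bc that in auto)
      \<comment> \<open>Back substitution of \<open>f' j = u * f j - w j * f g0\<close>. The two
        summands are kept apart because \<open>g0\<close> may itself belong to
        \<open>I\<close>.\<close>
      define C where "C j = (if j \<in> I then c j * u else 0) +
        (if j = g0 then b * w g - (\<Sum>j\<in>I. c j * w j) else 0)" for j
      have "(b * u) * f g i = (\<Sum>j\<in>insert g0 I. C j * f j i)" if i: "i < Suc r" for i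
      proof -
        have 1: "(\<Sum>j\<in>insert g0 I. (if j \<in> I then c j * u else 0) * f j i) = (\<Sum>j\<in>I. c j * u * f j i)"
          using finI by (intro sum.mono_neutral_cong_right) auto
        have 2: "(\<Sum>j\<in>insert g0 I. (if j = g0 then b * w g - (\<Sum>j\<in>I. c j * w j) else 0) * f j i)
          = (\<Sum>j\<in>{g0}. (b * w g - (\<Sum>j\<in>I. c j * w j)) * f g0 i)"
          using finI by (intro sum.mono_neutral_cong_right) auto
        have "(\<Sum>j\<in>insert g0 I. C j * f j i) =
          (\<Sum>j\<in>I. c j * u * f j i) + (b * w g - (\<Sum>j\<in>I. c j * w j)) * f g0 i"
          unfolding C_def distrib_right sum.distrib 1 2 by simp
        also have "(\<Sum>j\<in>I. c j * u * f j i) = (\<Sum>j\<in>I. c j * f' j i) + (\<Sum>j\<in>I. c j * w j) * f g0 i"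
          unfolding f'_def sum_distrib_right sum.distrib[symmetric] by (intro sum.cong) (auto simp: algebra_simps)
        also have "(\<Sum>j\<in>I. c j * f' j i) + (\<Sum>j\<in>I. c j * w j) * f g0 i +
            (b * w g - (\<Sum>j\<in>I. c j * w j)) * f g0 i = (\<Sum>j\<in>I. c j * f' j i) + b * w g * f g0 i"
          by (simp add: algebra_simps)
        also have "\<dots> = b * f' g i + b * w g * f g0 i" using bc'[OF i] by simp
        also have "\<dots> = (b * u) * f g i" by (simp add: f'_def algebra_simps)
        finally show ?thesis by simp
      qed
      moreover have "\<not> p dvd b * u" using bc(1) u(2) assms(2) by (simp add: prime_dvd_mult_iff)
      ultimately show ?thesis by blast
    qed
    moreover have "card (insert g0 I) \<le> Suc r" using I(2) finI by (simp add: card_insert_if)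
    moreover have "insert g0 I \<subseteq> F" using I(1) g0(1) by auto
    ultimately show ?thesis by blast
  qed
qed

text \<open>Invariant factor coordinates: \<open>g\<close> is the tuple of residues \<open>f g i mod m i\<close>.\<close>
locale congruence_seqs =
  fixes V :: "'a set" and r n :: nat and m :: "nat \<Rightarrow> nat" and f :: "'a \<Rightarrow> nat \<Rightarrow> int"
  assumes finV: "finite V" and n_pos: "n > 0" and m_dvd: "\<And>i. i < r \<Longrightarrow> m i dvd n"
begin

definition zero_sum :: "'a multiset \<Rightarrow> bool" where
  "zero_sum S \<longleftrightarrow> set_mset S \<subseteq> V \<and> (\<forall>i<r. int (m i) dvd (\<Sum>g\<in>#S. f g i))"

definition atom :: "'a multiset \<Rightarrow> bool" where
  "atom A \<longleftrightarrow> zero_sum A \<and> A \<noteq> {#} \<and> (\<forall>U. zero_sum U \<longrightarrow> U \<subseteq># A \<longrightarrow> U = {#} \<or> U = A)"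

definition factors :: "'a multiset multiset \<Rightarrow> 'a multiset \<Rightarrow> bool" where
  "factors Z S \<longleftrightarrow> (\<forall>A\<in>#Z. atom A) \<and> \<Sum>\<^sub># Z = S"

definition elt_order :: "'a \<Rightarrow> nat" where
  "elt_order g = (LEAST c. c > 0 \<and> zero_sum (replicate_mset c g))"

definition ord_power :: "'a \<Rightarrow> 'a multiset" where
  "ord_power g = replicate_mset (elt_order g) g"

definition cross_number :: "'a multiset \<Rightarrow> real" where
  "cross_number S = (\<Sum>g\<in>#S. 1 / real (elt_order g))"

lemma zero_sum_empty [simp]: "zero_sum {#}" by (simp add: zero_sum_def)

lemma zero_sum_add: "zero_sum S \<Longrightarrow> zero_sum T \<Longrightarrow> zero_sum (S + T)" by (auto simp: zero_sum_def)

lemma zero_sum_cancel: "zero_sum (S + T) \<Longrightarrow> zero_sum S \<Longrightarrow> zero_sum T"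
  unfolding zero_sum_def using dvd_add_right_iff by (metis (no_types, lifting) image_mset_union le_sup_iff set_mset_union sum_mset.union)

lemma zero_sum_diff: "zero_sum S \<Longrightarrow> zero_sum T \<Longrightarrow> T \<subseteq># S \<Longrightarrow> zero_sum (S - T)"
  using zero_sum_cancel[of T "S - T"] by simp

lemma zero_sum_sum_mset: "(\<And>A. A \<in># Z \<Longrightarrow> zero_sum A) \<Longrightarrow> zero_sum (\<Sum>\<^sub># Z)"
  by (induction Z) (auto intro: zero_sum_add)

lemma atom_zero_sum: "atom A \<Longrightarrow> zero_sum A" by (simp add: atom_def)

lemma factors_zero_sum: "factors Z S \<Longrightarrow> zero_sum S" unfolding factors_def using zero_sum_sum_mset atom_zero_sum by blast

lemma factors_add: "factors Z S \<Longrightarrow> factors Z' S' \<Longrightarrow> factors (Z + Z') (S + S')"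
  by (auto simp: factors_def)

lemma factors_atom: "atom A \<Longrightarrow> factors {#A#} A" by (auto simp: factors_def)

lemma factors_empty [simp]: "factors {#} {#}" by (auto simp: factors_def)

lemma mem_sum_mset_subset: assumes "A \<in># Z" shows "A \<subseteq># \<Sum>\<^sub># Z"
proof -
  obtain Z' where "Z = add_mset A Z'" using assms by (meson multi_member_split)
  then show ?thesis by simp
qed

lemma factors_of_empty: assumes "factors Z {#}" shows "Z = {#}"
proof (rule ccontr)
  assume "Z \<noteq> {#}"
  then obtain A where A: "A \<in># Z" by (metis multiset_nonemptyE)
  then have "A = {#}" using mem_sum_mset_subset[OF A] assms by (auto simp: factors_def)
  then show False using A assms by (auto simp: factors_def atom_def)
qed

lemma factors_exists: "zero_sum S \<Longrightarrow> \<exists>Z. factors Z S"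
proof (induction "size S" arbitrary: S rule: less_induct)
  case less
  show ?case
  proof (cases "S = {#} \<or> atom S")
    case True then show ?thesis using factors_empty factors_atom by blast
  next
    case False
    then obtain U where U: "zero_sum U" "U \<subseteq># S" "U \<noteq> {#}" "U \<noteq> S"
      using less.prems unfolding atom_def by blast
    have S: "S = U + (S - U)" using U(2) by simp
    have "zero_sum (S - U)" using zero_sum_diff less.prems U by blast
    moreover have "size U < size S" using U mset_subset_size[of U S] by auto
    moreover have "size (S - U) < size S"
      using U(3) \<open>size U < size S\<close> by (simp add: size_Diff_submset[OF U(2)] nonempty_has_size)
    ultimately obtain Z1 Z2 where "factors Z1 U" "factors Z2 (S - U)" using less.hyps U(1) by blast
    then have "factors (Z1 + Z2) (U + (S - U))" by (rule factors_add)
    then show ?thesis using S by auto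
  qed
qed

lemma sum_mset_mult_replicate: "(\<Sum>g\<in>#replicate_mset c h. F g) = of_nat c * (F h :: 'b :: comm_semiring_1)"
  by (induction c) (simp_all add: distrib_right)

lemma zero_sum_replicate: "zero_sum (replicate_mset c g) \<longleftrightarrow> (c = 0 \<or> g \<in> V) \<and> (\<forall>i<r. int (m i) dvd int c * f g i)"
  unfolding zero_sum_def sum_mset_mult_replicate by (cases "c = 0") simp_all

lemma zero_sum_replicate_dvd: assumes "zero_sum (replicate_mset c g)" "c dvd c'" "g \<in> V" shows "zero_sum (replicate_mset c' g)"
proof -
  have "int (m i) dvd int c' * f g i" if "i < r" for i
  proof -
    have "int c * f g i dvd int c' * f g i" using assms(2) by (intro mult_dvd_mono) auto
    then show ?thesis using assms(1) that dvd_trans unfolding zero_sum_replicate by blast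
  qed
  then show ?thesis using assms(3) unfolding zero_sum_replicate by blast
qed

lemma zero_sum_n: "g \<in> V \<Longrightarrow> zero_sum (replicate_mset n g)"
  unfolding zero_sum_replicate using m_dvd by auto

lemma ord_props: assumes "g \<in> V" shows "elt_order g > 0" "zero_sum (ord_power g)" "elt_order g \<le> n"
proof -
  have ex: "n > 0 \<and> zero_sum (replicate_mset n g)" using zero_sum_n assms n_pos by auto
  have "elt_order g > 0 \<and> zero_sum (replicate_mset (elt_order g) g)" unfolding elt_order_def using LeastI[of "\<lambda>c. c > 0 \<and> zero_sum (replicate_mset c g)", OF ex] .
  then show "elt_order g > 0" "zero_sum (ord_power g)" by (auto simp: ord_power_def)
  show "elt_order g \<le> n" unfolding elt_order_def using Least_le[of "\<lambda>c. c > 0 \<and> zero_sum (replicate_mset c g)", OF ex] .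
qed

lemma zero_sum_replicate_iff: assumes "g \<in> V" shows "zero_sum (replicate_mset c g) \<longleftrightarrow> elt_order g dvd c"
proof
  assume c: "zero_sum (replicate_mset c g)"
  have q: "zero_sum (replicate_mset (elt_order g * q) g)" for q
    using zero_sum_replicate_dvd ord_props(2)[OF assms] assms unfolding ord_power_def by simp
  have "replicate_mset c g = replicate_mset (elt_order g * (c div elt_order g)) g + replicate_mset (c mod elt_order g) g"
    by (rule multiset_eqI) simp
  then have "zero_sum (replicate_mset (c mod elt_order g) g)" using c q zero_sum_cancel by metis
  moreover have "c mod elt_order g < elt_order g" using ord_props(1)[OF assms] by simp
  ultimately have "c mod elt_order g = 0" using not_less_Least[of "c mod elt_order g" "\<lambda>c. c > 0 \<and> zero_sum (replicate_mset c g)"]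
    unfolding elt_order_def by auto
  then show "elt_order g dvd c" by auto
next
  assume "elt_order g dvd c"
  then show "zero_sum (replicate_mset c g)"
    using zero_sum_replicate_dvd ord_props(2)[OF assms] assms unfolding ord_power_def by simp
qed

lemma ord_dvd_n: "g \<in> V \<Longrightarrow> elt_order g dvd n" using zero_sum_n zero_sum_replicate_iff by auto

lemma atom_ord_power: assumes "g \<in> V" shows "atom (ord_power g)"
proof -
  have "U = {#} \<or> U = ord_power g" if U: "zero_sum U" "U \<subseteq># ord_power g" for U
  proof -
    obtain c where c: "c \<le> elt_order g" "U = replicate_mset c g"
      using msubseteq_replicate_msetE[OF U(2)[unfolded ord_power_def]] by blast
    then have "elt_order g dvd c" using U(1) zero_sum_replicate_iff assms by auto
    then show ?thesis using c ord_props(1)[OF assms] by (metis dvd_imp_le le_antisym neq0_conv ord_power_def replicate_mset_0)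
  qed
  then show ?thesis using ord_props[OF assms] unfolding atom_def ord_power_def by auto
qed

lemma set_ord_power: "g \<in> V \<Longrightarrow> set_mset (ord_power g) = {g}" using ord_props(1) by (auto simp: ord_power_def)

lemma ord_power_subset_iff: "ord_power g \<subseteq># S \<longleftrightarrow> elt_order g \<le> count S g" unfolding ord_power_def by (simp add: count_le_replicate_mset_subset_eq)

lemma atom_count: assumes "atom A" "g \<in> V" "A \<noteq> ord_power g" shows "count A g < elt_order g"
proof (rule ccontr)
  assume "\<not> ?thesis"
  then have "ord_power g \<subseteq># A" using ord_power_subset_iff by auto
  then have "ord_power g = {#} \<or> ord_power g = A" using assms ord_props[OF assms(2)] unfolding atom_def by blast
  then show False using assms ord_props(1)[OF assms(2)] by (auto simp: ord_power_def)
qed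

lemma atom_count_le: assumes "atom A" "g \<in> V" shows "count A g \<le> elt_order g"
  using atom_count[OF assms] by (cases "A = ord_power g") (auto simp: ord_power_def)

lemma zero_sum_set: "zero_sum S \<Longrightarrow> set_mset S \<subseteq> V" by (simp add: zero_sum_def)

lemma cross_number_add [simp]: "cross_number (S + T) = cross_number S + cross_number T" by (simp add: cross_number_def)
lemma cross_number_empty [simp]: "cross_number {#} = 0" by (simp add: cross_number_def)
lemma cross_number_diff: "T \<subseteq># S \<Longrightarrow> cross_number (S - T) = cross_number S - cross_number T"
  by (metis add_diff_cancel_left' cross_number_add subset_mset.add_diff_inverse)
lemma cross_number_ord_power: "g \<in> V \<Longrightarrow> cross_number (ord_power g) = 1"
  using ord_props(1) by (simp add: cross_number_def ord_power_def sum_mset_mult_replicate)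
lemma cross_number_nonneg: "cross_number S \<ge> 0" unfolding cross_number_def by (induction S) auto

lemma cross_number_sum_mset: "cross_number (\<Sum>\<^sub># Z) = (\<Sum>A\<in>#Z. cross_number A)" by (induction Z) auto

lemma cross_number_eq: assumes "finite Y" "set_mset S \<subseteq> Y" shows "cross_number S = (\<Sum>g\<in>Y. real (count S g) / real (elt_order g))"
  using assms(2)
proof (induction S)
  case (add x S)
  have "(\<Sum>g\<in>Y. real (count (add_mset x S) g) / real (elt_order g)) =
    (\<Sum>g\<in>Y. real (count S g) / real (elt_order g) + (if g = x then 1 / real (elt_order g) else 0))"
    by (intro sum.cong) (auto simp: add_divide_distrib)
  also have "\<dots> = (\<Sum>g\<in>Y. real (count S g) / real (elt_order g)) + 1 / real (elt_order x)"
    using add.prems assms(1) by (simp add: sum.distrib)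
  finally show ?case using add by (simp add: cross_number_def)
qed auto

lemma factors_sub: assumes "factors Z S" "Z' \<subseteq># Z" shows "factors Z' (\<Sum>\<^sub># Z')" "factors (Z - Z') (S - \<Sum>\<^sub># Z')" "\<Sum>\<^sub># Z' \<subseteq># S"
proof -
  obtain W where Z: "Z = Z' + W" using assms(2) by (metis subset_mset.add_diff_inverse)
  have S: "S = \<Sum>\<^sub># Z' + \<Sum>\<^sub># W" using assms(1) unfolding Z factors_def by simp
  show "factors Z' (\<Sum>\<^sub># Z')" "factors (Z - Z') (S - \<Sum>\<^sub># Z')" using assms(1) unfolding factors_def Z S by auto
  show "\<Sum>\<^sub># Z' \<subseteq># S" unfolding S by simp
qed

lemma factors_mem_set: "factors Z S \<Longrightarrow> A \<in># Z \<Longrightarrow> set_mset A \<subseteq> set_mset S"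
  unfolding factors_def using mem_sum_mset_subset set_mset_mono by blast

text \<open>Half-factorial sets satisfy this for every \<open>M\<close>, so it says something about
  \<open>M\<close> only together with the failure of \<open>half_factorial\<close>.\<close>

definition one_length_class :: "nat \<Rightarrow> 'a set \<Rightarrow> bool" where
  "one_length_class M Y \<longleftrightarrow> (\<forall>S Z Z'. set_mset S \<subseteq> Y \<longrightarrow> factors Z S \<longrightarrow> factors Z' S \<longrightarrow> int M dvd int (size Z) - int (size Z'))"

text \<open>Only atoms are mentioned; that all lengths of a sequence agree follows because the cross
  number is additive and hence equals the number of atoms in any factorization.\<close>

definition half_factorial :: "'a set \<Rightarrow> bool" where
  "half_factorial Y \<longleftrightarrow> (\<forall>A. atom A \<longrightarrow> set_mset A \<subseteq> Y \<longrightarrow> cross_number A = 1)"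

definition cross_ge_one :: "'a set \<Rightarrow> bool" where
  "cross_ge_one Y \<longleftrightarrow> (\<forall>A. atom A \<longrightarrow> set_mset A \<subseteq> Y \<longrightarrow> cross_number A \<ge> 1)"

lemma half_factorial_size: assumes "half_factorial Y" "set_mset S \<subseteq> Y" "factors Z S" shows "real (size Z) = cross_number S"
proof -
  have "\<forall>A\<in>#Z. cross_number A = 1" using assms factors_mem_set[OF assms(3)] unfolding half_factorial_def factors_def by blast
  then have "image_mset cross_number Z = image_mset (\<lambda>_. 1) Z" by (intro image_mset_cong) auto
  then have "cross_number (\<Sum>\<^sub># Z) = real (size Z)" unfolding cross_number_sum_mset by simp
  then show ?thesis using assms(3) unfolding factors_def by simp
qed

text \<open>The constant \<open>c\<close> is 1 over sets with \<open>cross_ge_one\<close>, and the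
  least cross number of an atom in \<open>short_atom\<close>.\<close>

lemma size_le_cross_number: assumes "\<And>A. atom A \<Longrightarrow> set_mset A \<subseteq> Y \<Longrightarrow> cross_number A \<ge> c" "set_mset S \<subseteq> Y" "factors Z S"
  shows "c * real (size Z) \<le> cross_number S"
proof -
  have "\<forall>A\<in>#Z. cross_number A \<ge> c" using assms factors_mem_set[OF assms(3)] unfolding factors_def by blast
  then have "(\<Sum>A\<in>#Z. c) \<le> (\<Sum>A\<in>#Z. cross_number A)" by (intro sum_mset_mono) auto
  then have "c * real (size Z) \<le> cross_number (\<Sum>\<^sub># Z)" unfolding cross_number_sum_mset by (simp add: mult.commute)
  then show ?thesis using assms(3) unfolding factors_def by simp
qed

end

section \<open>Sets of large cross number\<close>

context congruence_seqs begin

lemma factors_of_atom: assumes "factors Z A" "atom A" shows "Z = {#A#}"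
proof -
  have "A \<noteq> {#}" using assms(2) by (simp add: atom_def)
  then have "Z \<noteq> {#}" using assms(1) by (auto simp: factors_def)
  then obtain B where B: "B \<in># Z" by (meson multiset_nonemptyE)
  then obtain W where Z: "Z = add_mset B W" by (meson multi_member_split)
  have "atom B" using B assms(1) by (simp add: factors_def)
  then have "zero_sum B" "B \<noteq> {#}" by (simp_all add: atom_def)
  moreover have "B \<subseteq># A" using mem_sum_mset_subset[OF B] assms(1) by (simp add: factors_def)
  ultimately have "B = A" using assms(2) unfolding atom_def by blast
  then have "\<Sum>\<^sub># W = {#}" using assms(1) unfolding Z factors_def by simp
  then have "factors W {#}" using assms(1) unfolding Z factors_def by auto
  from factors_of_empty[OF this] show ?thesis using Z \<open>B = A\<close> by simp
qed

section \<open>Multiplicity functions, integer relations and products of full powers\<close>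

definition mset_of :: "'a set \<Rightarrow> ('a \<Rightarrow> nat) \<Rightarrow> 'a multiset" where
  "mset_of Y c = (\<Sum>g\<in>Y. replicate_mset (c g) g)"

lemma count_mset_of: assumes "finite Y" shows "count (mset_of Y c) g = (if g \<in> Y then c g else 0)"
proof -
  have "count (mset_of Y c) g = (\<Sum>h\<in>Y. if g = h then c h else 0)"
    unfolding mset_of_def count_sum by (intro sum.cong) auto
  then show ?thesis using assms by simp
qed

lemma set_mset_of: assumes "finite Y" shows "set_mset (mset_of Y c) \<subseteq> Y"
proof
  fix g assume "g \<in># mset_of Y c"
  then have "count (mset_of Y c) g \<noteq> 0" by (simp only: count_eq_zero_iff not_not)
  then show "g \<in> Y" unfolding count_mset_of[OF assms] by (simp split: if_splits)
qed

lemma sum_mset_count: assumes "finite Y" "set_mset S \<subseteq> Y"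
  shows "(\<Sum>g\<in>#S. F g) = (\<Sum>g\<in>Y. int (count S g) * F g)"
  using assms(2)
proof (induction S)
  case (add x S)
  have "(\<Sum>g\<in>Y. int (count (add_mset x S) g) * F g) =
    (\<Sum>g\<in>Y. int (count S g) * F g + (if g = x then F g else 0))"
    by (intro sum.cong) (auto simp: algebra_simps)
  also have "\<dots> = (\<Sum>g\<in>Y. int (count S g) * F g) + F x"
    using add.prems assms(1) by (simp add: sum.distrib)
  finally show ?case using add by simp
qed auto

text \<open>With arbitrary integer coefficients these form a lattice, of which the zero-sum
  sequences over \<open>Y\<close> are the nonnegative vectors.\<close>

definition relation :: "'a set \<Rightarrow> ('a \<Rightarrow> int) \<Rightarrow> bool" where
  "relation Y x \<longleftrightarrow> (\<forall>i<r. int (m i) dvd (\<Sum>g\<in>Y. x g * f g i))"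

lemma zero_sum_relation: assumes "Y \<subseteq> V" "set_mset S \<subseteq> Y" shows "zero_sum S \<longleftrightarrow> relation Y (\<lambda>g. int (count S g))"
proof -
  have "finite Y" using assms(1) finV finite_subset by auto
  then show ?thesis unfolding zero_sum_def relation_def using sum_mset_count[of Y S] assms by auto
qed

lemma factors_ord_powers: "set_mset D \<subseteq> V \<Longrightarrow> factors (image_mset ord_power D) (\<Sum>\<^sub># (image_mset ord_power D))"
  unfolding factors_def using atom_ord_power by auto

lemma count_ord_powers: "count (\<Sum>\<^sub># (image_mset ord_power D)) g = count D g * elt_order g"
  by (induction D) (auto simp: ord_power_def algebra_simps)

lemma cross_number_ord_powers: "set_mset D \<subseteq> V \<Longrightarrow> cross_number (\<Sum>\<^sub># (image_mset ord_power D)) = size D"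
  by (induction D) (auto simp: cross_number_ord_power)

lemma set_ord_powers: "set_mset D \<subseteq> V \<Longrightarrow> set_mset (\<Sum>\<^sub># (image_mset ord_power D)) = set_mset D"
  using set_ord_power by (induction D) auto

text \<open>If \<open>cross_number A > 1\<close>, then the product of \<open>A\<close> with its inverse has factorizations of two lengths
  that differ by less than \<open>|supp A|\<close>.\<close>
lemma small_support:
  assumes "one_length_class M Y" "cross_ge_one Y" "Y \<subseteq> V" "r \<le> M" "atom A" "set_mset A \<subseteq> Y" "card (set_mset A) \<le> r + 1"
  shows "cross_number A = 1"
proof (rule ccontr)
  assume "cross_number A \<noteq> 1"
  then have gt: "cross_number A > 1" using assms(2,5,6) unfolding cross_ge_one_def by force
  have AV: "set_mset A \<subseteq> V" using assms by auto
  have lt: "count A g < elt_order g" if "g \<in># A" for g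
    using atom_count[OF assms(5), of g] cross_number_ord_power \<open>cross_number A \<noteq> 1\<close> that AV by auto
  define D where "D = mset_set (set_mset A)"
  \<comment> \<open>\<open>P - A\<close> stands for the inverse of \<open>A\<close>: its
    multiplicities are \<open>elt_order g - count A g\<close> on the support.\<close>
  define P where "P = \<Sum>\<^sub># (image_mset ord_power D)"
  have D: "set_mset D = set_mset A" "size D = card (set_mset A)" by (auto simp: D_def)
  have cD: "count D g = (if g \<in># A then 1 else 0)" for g by (simp add: D_def count_mset_set')
  have AP: "A \<subseteq># P" unfolding P_def
    by (rule mset_subset_eqI) (use lt in \<open>auto simp: count_ord_powers cD less_imp_le not_in_iff\<close>)
  have fP: "factors (image_mset ord_power D) P" using factors_ord_powers AV D unfolding P_def by auto
  have zA': "zero_sum (P - A)" using zero_sum_diff AP fP factors_zero_sum assms(5) atom_zero_sum by blast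
  obtain Z where Z: "factors Z (P - A)" using factors_exists zA' by blast
  have PY: "set_mset P \<subseteq> Y" using set_ord_powers[of D] D AV assms(6) unfolding P_def by auto
  have "P - A \<noteq> {#}"
  proof
    assume "P - A = {#}"
    then have "P \<subseteq># A" by (simp add: Diff_eq_empty_iff_mset)
    moreover obtain g where "g \<in># A" using assms(5) unfolding atom_def by fastforce
    ultimately have "elt_order g \<le> count A g" using mset_subset_eq_count[of P A g] cD by (simp add: P_def count_ord_powers)
    then show False using lt \<open>g \<in># A\<close> by force
  qed
  then have Z0: "size Z \<noteq> 0" using Z unfolding factors_def by auto
  have "set_mset (P - A) \<subseteq> Y" using PY by (meson in_diffD subsetD subsetI)
  then have "1 * real (size Z) \<le> cross_number (P - A)" using size_le_cross_number[of Y 1 "P - A" Z] assms(2) Z unfolding cross_ge_one_def by blast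
  \<comment> \<open>The cross number of \<open>P\<close> is \<open>size D\<close>, so a cross number
    of \<open>A\<close> above 1 leaves less than \<open>size D - 1\<close> for \<open>P - A\<close>,
    and this bounds \<open>size Z\<close>.\<close>
  then have le: "1 + size Z < size D" using cross_number_diff[OF AP] cross_number_ord_powers[of D] D AV gt unfolding P_def by auto
  have "factors ({#A#} + Z) P" using factors_add[OF factors_atom[OF assms(5)] Z] AP by simp
  then have "int M dvd int (size (image_mset ord_power D)) - int (size ({#A#} + Z))"
    using assms(1) fP PY unfolding one_length_class_def by blast
  then have "int M dvd int (size D) - 1 - int (size Z)" by (simp add: algebra_simps)
  \<comment> \<open>The right side is at most \<open>r - 1\<close>, because \<open>size Z\<close> is
    positive and the support has at most \<open>r + 1\<close> elements; this contradicts
    \<open>r \<le> M\<close>.\<close>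
  then have "int M \<le> int (size D) - 1 - int (size Z)" using le by (intro zdvd_imp_le) auto
  then show False using assms(4,7) Z0 D by auto
qed

text \<open>Such an \<open>x\<close> has integral cross number \<open>\<Sum>g\<in>Y. x g / elt_order g\<close>, since changing
  multiplicities by multiples of the orders changes it by integers.\<close>
definition unit_generated :: "'a set \<Rightarrow> ('a \<Rightarrow> int) \<Rightarrow> bool" where
  "unit_generated Y x \<longleftrightarrow> (\<exists>d Z. (\<forall>A\<in>#Z. atom A \<and> cross_number A = 1 \<and> set_mset A \<subseteq> Y) \<and>
     (\<forall>g\<in>Y. x g + int (elt_order g) * d g = int (count (\<Sum>\<^sub># Z) g)))"

lemma unit_generated_shift: assumes "unit_generated Y x" "\<And>g. g \<in> Y \<Longrightarrow> y g = x g + int (elt_order g) * e g" shows "unit_generated Y y"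
proof -
  obtain d Z where "\<forall>A\<in>#Z. atom A \<and> cross_number A = 1 \<and> set_mset A \<subseteq> Y"
     "\<forall>g\<in>Y. x g + int (elt_order g) * d g = int (count (\<Sum>\<^sub># Z) g)" using assms(1) unfolding unit_generated_def by blast
  then show ?thesis unfolding unit_generated_def using assms(2)
    by (intro exI[of _ "\<lambda>g. d g - e g"] exI[of _ Z]) (auto simp: algebra_simps)
qed

lemma unit_generated_add: assumes "unit_generated Y x" "unit_generated Y y" shows "unit_generated Y (\<lambda>g. x g + y g)"
proof -
  obtain d Z where 1: "\<forall>A\<in>#Z. atom A \<and> cross_number A = 1 \<and> set_mset A \<subseteq> Y"
     "\<forall>g\<in>Y. x g + int (elt_order g) * d g = int (count (\<Sum>\<^sub># Z) g)" using assms(1) unfolding unit_generated_def by blast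
  obtain d' Z' where 2: "\<forall>A\<in>#Z'. atom A \<and> cross_number A = 1 \<and> set_mset A \<subseteq> Y"
     "\<forall>g\<in>Y. y g + int (elt_order g) * d' g = int (count (\<Sum>\<^sub># Z') g)" using assms(2) unfolding unit_generated_def by blast
  show ?thesis unfolding unit_generated_def
  proof (intro exI[of _ "\<lambda>g. d g + d' g"] exI[of _ "Z + Z'"] conjI ballI)
    fix g assume "g \<in> Y"
    then show "x g + y g + int (elt_order g) * (d g + d' g) = int (count (\<Sum>\<^sub># (Z + Z')) g)"
      using 1(2) 2(2) by (force simp: algebra_simps)
  qed (use 1(1) 2(1) in auto)
qed

lemma unit_generated_0: "unit_generated Y (\<lambda>g. 0)" unfolding unit_generated_def by (intro exI[of _ "\<lambda>_. 0"] exI[of _ "{#}"]) auto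

lemma unit_generated_mult_nat: "unit_generated Y x \<Longrightarrow> unit_generated Y (\<lambda>g. int k * x g)"
proof (induction k)
  case (Suc k)
  then show ?case using unit_generated_add[of Y "\<lambda>g. int k * x g" x] by (simp add: algebra_simps)
qed (simp add: unit_generated_0)

text \<open>Modulo the orders, \<open>- x\<close> is the positive multiple
  \<open>(n - 1) * x\<close>, as every order divides \<open>n\<close>.\<close>

lemma unit_generated_uminus: assumes "Y \<subseteq> V" "unit_generated Y x" shows "unit_generated Y (\<lambda>g. - x g)"
proof (rule unit_generated_shift[OF unit_generated_mult_nat[OF assms(2), of "n - 1"], where e = "\<lambda>g. - int (n div elt_order g) * x g"])
  fix g assume "g \<in> Y"
  then have "elt_order g * (n div elt_order g) = n" using ord_dvd_n assms(1) by auto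
  then have "int (elt_order g) * int (n div elt_order g) = int n" by (metis of_nat_mult)
  then have "int (elt_order g) * (- int (n div elt_order g) * x g) = - (int n * x g)"
    by (metis mult.assoc mult_minus_left mult_minus_right)
  then show "- x g = int (n - 1) * x g + int (elt_order g) * (- int (n div elt_order g) * x g)"
    using n_pos by (simp add: of_nat_diff algebra_simps)
qed

lemma unit_generated_mult: assumes "Y \<subseteq> V" "unit_generated Y x" shows "unit_generated Y (\<lambda>g. k * x g)"
proof (cases k)
  case (nonneg j) then show ?thesis using unit_generated_mult_nat assms by auto
next
  case (neg j)
  then have "k * x g = - (int (Suc j) * x g)" for g using neg by (simp only: mult_minus_left)
  then show ?thesis using unit_generated_uminus[OF assms(1) unit_generated_mult_nat[OF assms(2), of "Suc j"]] by simp
qed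

lemma unit_generated_sum: assumes "Y \<subseteq> V" "finite I" "\<And>i. i \<in> I \<Longrightarrow> unit_generated Y (x i)" shows "unit_generated Y (\<lambda>g. \<Sum>i\<in>I. x i g)"
  using assms(2,3) by (induction I) (auto intro: unit_generated_0 unit_generated_add)

text \<open>Reduced modulo the orders, \<open>x\<close> becomes the multiplicity function of a
  genuine zero-sum sequence on \<open>I\<close>. Its atoms have support in \<open>I\<close> as well,
  so the hypothesis on atoms of small support applies to each of them.\<close>

lemma unit_generated_small:
  assumes "Y \<subseteq> V" "relation Y x" "I \<subseteq> Y" "card I \<le> s" "\<And>g. g \<in> Y \<Longrightarrow> g \<notin> I \<Longrightarrow> x g = 0"
    "\<And>A. atom A \<Longrightarrow> set_mset A \<subseteq> Y \<Longrightarrow> card (set_mset A) \<le> s \<Longrightarrow> cross_number A = 1"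
  shows "unit_generated Y x"
proof -
  have finY: "finite Y" using assms(1) finV finite_subset by auto
  have finI: "finite I" using assms(3) finY finite_subset by auto
  define S where "S = mset_of I (\<lambda>g. nat (x g mod int (elt_order g)))"
  have o: "elt_order g > 0" if "g \<in> Y" for g using ord_props(1) assms(1) that by auto
  have cS: "int (count S g) = x g mod int (elt_order g)" if "g \<in> Y" for g
    unfolding S_def count_mset_of[OF finI] using o[OF that] assms(5) that by auto
  have SI: "set_mset S \<subseteq> I" unfolding S_def using set_mset_of finI by auto
  have "relation Y (\<lambda>g. int (count S g))" unfolding relation_def
  proof (intro allI impI)
    fix i assume i: "i < r"
    have "int (m i) dvd int (elt_order g) * (x g div int (elt_order g)) * f g i" if "g \<in> Y" for g
    proof -
      have "int (m i) dvd int (elt_order g) * f g i"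
        using ord_props(2)[of g] i that assms(1) unfolding ord_power_def zero_sum_replicate by auto
      then have "int (m i) dvd int (elt_order g) * f g i * (x g div int (elt_order g))" by (rule dvd_mult2)
      then show ?thesis by (simp only: ac_simps)
    qed
    then have "int (m i) dvd (\<Sum>g\<in>Y. int (elt_order g) * (x g div int (elt_order g)) * f g i)" by (rule dvd_sum)
    moreover have "int (m i) dvd (\<Sum>g\<in>Y. x g * f g i)" using assms(2) i unfolding relation_def by blast
    ultimately have "int (m i) dvd (\<Sum>g\<in>Y. x g * f g i) - (\<Sum>g\<in>Y. int (elt_order g) * (x g div int (elt_order g)) * f g i)"
      by (simp only: dvd_diff)
    also have "\<dots> = (\<Sum>g\<in>Y. int (count S g) * f g i)"
      unfolding sum_subtractf[symmetric]
      by (intro sum.cong) (auto simp: cS minus_mult_div_eq_mod[symmetric] left_diff_distrib)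
    finally show "int (m i) dvd (\<Sum>g\<in>Y. int (count S g) * f g i)" .
  qed
  then have "zero_sum S" using zero_sum_relation assms(1,3) SI by blast
  then obtain Z where Z: "factors Z S" using factors_exists by blast
  have "atom A \<and> cross_number A = 1 \<and> set_mset A \<subseteq> Y" if "A \<in># Z" for A
  proof -
    have 1: "atom A" using Z that by (simp add: factors_def)
    have 2: "set_mset A \<subseteq> I" using factors_mem_set[OF Z that] SI by auto
    then have "card (set_mset A) \<le> s" using card_mono[OF finI 2] assms(4) by auto
    then show ?thesis using 1 2 assms(3,6) by blast
  qed
  moreover have "x g + int (elt_order g) * (- (x g div int (elt_order g))) = int (count (\<Sum>\<^sub># Z) g)" if "g \<in> Y" for g
    using Z cS[OF that] unfolding factors_def by (simp add: minus_mult_div_eq_mod)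
  ultimately show ?thesis unfolding unit_generated_def
    by (intro exI[of _ "\<lambda>g. - (x g div int (elt_order g))"] exI[of _ Z]) auto
qed

lemma relation_lin: assumes "relation Y x" "relation Y y" shows "relation Y (\<lambda>g. a * x g - y g)"
proof -
  have "(\<Sum>g\<in>Y. (a * x g - y g) * f g i) = a * (\<Sum>g\<in>Y. x g * f g i) - (\<Sum>g\<in>Y. y g * f g i)" for i
    by (simp add: sum_subtractf left_diff_distrib sum_distrib_left mult.assoc)
  then show ?thesis using assms unfolding relation_def by (auto intro: dvd_diff)
qed

text \<open>Modulo \<open>p\<close>-units, each vector \<open>f g\<close> is a combination of \<open>f j\<close> for \<open>r\<close> elements \<open>j\<close>;
  this writes a multiple of \<open>x\<close> as a sum of relations of support at most \<open>r + 1\<close>.\<close>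
lemma unit_generated_local:
  fixes p :: int
  assumes "Y \<subseteq> V" "relation Y x" "Factorial_Ring.prime p"
    "\<And>A. atom A \<Longrightarrow> set_mset A \<subseteq> Y \<Longrightarrow> card (set_mset A) \<le> r + 1 \<Longrightarrow> cross_number A = 1"
  shows "\<exists>b. \<not> p dvd b \<and> unit_generated Y (\<lambda>g. b * x g)"
proof -
  have finY: "finite Y" using assms(1) finV finite_subset by auto
  obtain I where I: "I \<subseteq> Y" "card I \<le> r"
    "\<forall>g\<in>Y. \<exists>b c. \<not> p dvd b \<and> (\<forall>i<r. b * f g i = (\<Sum>j\<in>I. c j * f j i))"
    using p_local_span[OF finY assms(3), of r f] by blast
  from bchoice[OF I(3)] obtain b where "\<forall>g\<in>Y. \<exists>c. \<not> p dvd b g \<and> (\<forall>i<r. b g * f g i = (\<Sum>j\<in>I. c j * f j i))" by blast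
  from bchoice[OF this] obtain c where "\<forall>g\<in>Y. \<not> p dvd b g \<and> (\<forall>i<r. b g * f g i = (\<Sum>j\<in>I. c g j * f j i))" by blast
  then have bc: "\<And>g. g \<in> Y \<Longrightarrow> \<not> p dvd b g"
    "\<And>g i. g \<in> Y \<Longrightarrow> i < r \<Longrightarrow> b g * f g i = (\<Sum>j\<in>I. c g j * f j i)" by blast+
  have finI: "finite I" using I(1) finY finite_subset by auto
  define B where "B = (\<Prod>g\<in>Y. b g)"
  have B: "\<not> p dvd B" unfolding B_def using prime_dvd_prod_iff[OF finY assms(3)] bc(1) by blast
  have Bb: "\<exists>b'. B = b' * b g" if "g \<in> Y" for g
  proof -
    have "b g dvd B" unfolding B_def using finY that by (rule dvd_prodI)
    then show ?thesis by (auto simp: dvd_def mult.commute)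
  qed
  then obtain b' where b': "\<And>g. g \<in> Y \<Longrightarrow> B = b' g * b g" by metis
  \<comment> \<open>\<open>R g\<close> is the relation expressing \<open>b g\<close> times
    \<open>f g\<close> by the spanning set. Its support lies in \<open>insert g I\<close>, which has
    at most \<open>r + 1\<close> elements, and it holds exactly in the integers, not only modulo the
    \<open>m i\<close>.\<close>
  define R where "R g h = (if h = g then b g else 0) - (if h \<in> I then c g h else 0)" for g h
  have Rsum: "(\<Sum>h\<in>Y. R g h * f h i) = 0" if "g \<in> Y" "i < r" for g i
  proof -
    have "(\<Sum>h\<in>Y. R g h * f h i) = (\<Sum>h\<in>Y. (if h = g then b g * f h i else 0)) - (\<Sum>h\<in>Y. if h \<in> I then c g h * f h i else 0)"
      unfolding R_def sum_subtractf[symmetric] by (intro sum.cong) (auto simp: left_diff_distrib)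
    also have "(\<Sum>h\<in>Y. (if h = g then b g * f h i else 0)) = b g * f g i" using finY that by simp
    also have "(\<Sum>h\<in>Y. if h \<in> I then c g h * f h i else 0) = (\<Sum>h\<in>I. c g h * f h i)"
      using finY I(1) by (simp add: sum.If_cases Int_absorb1)
    finally show ?thesis using bc(2) that by simp
  qed
  have gR: "unit_generated Y (R g)" if "g \<in> Y" for g
  proof (rule unit_generated_small[where I = "insert g I" and s = "r + 1"])
    show "relation Y (R g)" unfolding relation_def using Rsum that by auto
    show "card (insert g I) \<le> r + 1" using I(2) finI by (simp add: card_insert_if)
    show "insert g I \<subseteq> Y" using that I(1) by auto
    show "\<And>h. h \<in> Y \<Longrightarrow> h \<notin> insert g I \<Longrightarrow> R g h = 0" by (auto simp: R_def)
  qed (fact assms(1) assms(4))+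
  \<comment> \<open>Subtracting \<open>T\<close> from \<open>B * x\<close> clears every coefficient
    outside \<open>I\<close>; what is left is again a relation of small support.\<close>
  define T where "T h = (\<Sum>g\<in>Y. x g * b' g * R g h)" for h
  have gT: "unit_generated Y T" unfolding T_def using unit_generated_sum[OF assms(1) finY] unit_generated_mult[OF assms(1) gR] by auto
  have relT: "relation Y T" unfolding relation_def
  proof (intro allI impI)
    fix i assume i: "i < r"
    have "(\<Sum>h\<in>Y. T h * f h i) = (\<Sum>h\<in>Y. \<Sum>g\<in>Y. x g * b' g * (R g h * f h i))"
      unfolding T_def by (simp add: sum_distrib_right mult.assoc)
    also have "\<dots> = (\<Sum>g\<in>Y. x g * b' g * (\<Sum>h\<in>Y. R g h * f h i))"
      by (subst sum.swap) (simp add: sum_distrib_left)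
    also have "\<dots> = 0" using Rsum i by simp
    finally show "int (m i) dvd (\<Sum>h\<in>Y. T h * f h i)" by simp
  qed
  have "unit_generated Y (\<lambda>h. B * x h - T h)"
  proof (rule unit_generated_small[where I = I and s = "r + 1"])
    show "relation Y (\<lambda>h. B * x h - T h)" using assms(2) relT by (rule relation_lin)
    fix h assume h: "h \<in> Y" "h \<notin> I"
    have "T h = (\<Sum>g\<in>Y. if g = h then x g * b' g * b g else 0)"
      unfolding T_def R_def using h by (intro sum.cong) auto
    also have "\<dots> = x h * (b' h * b h)" using h finY by simp
    also have "\<dots> = B * x h" using b'[OF h(1)] by simp
    finally show "B * x h - T h = 0" by simp
  next
    show "card I \<le> r + 1" using I(2) by simp
  qed (fact assms(1) assms(4) I(1))+
  from unit_generated_add[OF this gT] have "unit_generated Y (\<lambda>h. B * x h)" by simp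
  then show ?thesis using B by blast
qed

text \<open>The multipliers \<open>b\<close> for which \<open>b * x\<close> is generated form an
  ideal of the integers. By the local version no prime ideal contains it, so it contains 1: its
  least positive element \<open>b0\<close> generates it and can have no prime factor.\<close>

lemma unit_generated_all:
  assumes "Y \<subseteq> V" "relation Y x"
    "\<And>A. atom A \<Longrightarrow> set_mset A \<subseteq> Y \<Longrightarrow> card (set_mset A) \<le> r + 1 \<Longrightarrow> cross_number A = 1"
  shows "unit_generated Y x"
proof -
  define J where "J = {b::int. unit_generated Y (\<lambda>g. b * x g)}"
  have loc: "\<exists>b\<in>J. \<not> p dvd b" if "Factorial_Ring.prime p" for p
    using unit_generated_local[OF assms(1,2) that assms(3)] unfolding J_def by blast
  have Jmul: "k * b \<in> J" if "b \<in> J" for k b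
    using unit_generated_mult[OF assms(1), of "\<lambda>g. b * x g" k] that by (simp add: J_def mult.assoc)
  have Jadd: "a + b \<in> J" if "a \<in> J" "b \<in> J" for a b
    using unit_generated_add[of Y "\<lambda>g. a * x g" "\<lambda>g. b * x g"] that by (simp add: J_def distrib_right)
  have "\<exists>b::nat. b > 0 \<and> int b \<in> J"
  proof -
    \<comment> \<open>One prime suffices to see that the ideal is not zero: a member not divisible
      by 2 is nonzero.\<close>
    have "Factorial_Ring.prime (2::int)" by simp
    then obtain b where b: "b \<in> J" "\<not> 2 dvd b" using loc by blast
    then have "\<bar>b\<bar> \<in> J" using Jmul[OF b(1), of "sgn b"] by (simp add: abs_sgn mult.commute)
    moreover have "b \<noteq> 0" using b by auto
    ultimately show ?thesis by (intro exI[of _ "nat \<bar>b\<bar>"]) auto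
  qed
  then obtain b0 where b0: "b0 > 0 \<and> int b0 \<in> J" and min: "\<And>c. c < b0 \<Longrightarrow> \<not> (c > 0 \<and> int c \<in> J)"
    using exists_least_iff[of "\<lambda>b. b > 0 \<and> int b \<in> J"] by blast
  have dv: "int b0 dvd b" if "b \<in> J" for b
  proof -
    have "b mod int b0 = b + (- (b div int b0)) * int b0" by (simp add: minus_div_mult_eq_mod[symmetric])
    then have "b mod int b0 \<in> J" using Jadd[OF that Jmul] b0 by presburger
    moreover have "b mod int b0 \<ge> 0" "b mod int b0 < int b0" using b0 by auto
    ultimately have "b mod int b0 = 0" using min[of "nat (b mod int b0)"] by force
    then show ?thesis by auto
  qed
  have "b0 = 1"
  proof (rule ccontr)
    assume "b0 \<noteq> 1"
    then obtain q :: nat where q: "Factorial_Ring.prime q" "q dvd b0" using prime_factor_nat by blast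
    then have "Factorial_Ring.prime (int q)" by simp
    then obtain b where b: "b \<in> J" "\<not> int q dvd b" using loc by blast
    then show False using dv[OF b(1)] q(2) by (meson dvd_trans of_nat_dvd_iff)
  qed
  then show ?thesis using b0 by (simp add: J_def)
qed

section \<open>Lengths of factorizations after adding full powers\<close>

lemma size_mult_le_count:
  "(\<And>A. A \<in># J \<Longrightarrow> c \<le> count A g) \<Longrightarrow> size J * c \<le> count (\<Sum>\<^sub># J) g"
  by (induction J) (auto, fastforce)

text \<open>Choose a minimal part \<open>J\<close> of the factorization that covers \<open>ord_power g\<close>; if it is too long,
  then \<open>ord_power g\<close> exhausts all occurrences of \<open>g\<close> in it.\<close>
lemma max_length_add_ord_power:
  assumes "one_length_class M Y" "cross_ge_one Y" "Y \<subseteq> V" "n \<le> 2 * M + 1" "g \<in> Y" "half_factorial (Y - {g})"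
    "set_mset S \<subseteq> Y" "zero_sum S" "factors Z (S + ord_power g)"
  shows "\<exists>Z'. factors Z' S \<and> size Z \<le> size Z' + 1"
proof (rule ccontr)
  assume "\<not> ?thesis"
  then have no: "size Z' + 2 \<le> size Z" if "factors Z' S" for Z' using that by force
  have gV: "g \<in> V" using assms by auto
  have ex: "\<exists>J. J \<subseteq># Z \<and> elt_order g \<le> count (\<Sum>\<^sub># J) g"
    using assms(9) by (intro exI[of _ Z]) (auto simp: factors_def ord_power_def)
  define Q where "Q J \<longleftrightarrow> J \<subseteq># Z \<and> elt_order g \<le> count (\<Sum>\<^sub># J) g" for J
  obtain J where J: "Q J" "\<And>J'. Q J' \<Longrightarrow> size J \<le> size J'"
    using ex ex_has_least_nat[of Q _ size] unfolding Q_def by metis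
  have JZ: "J \<subseteq># Z" and Jg: "ord_power g \<subseteq># \<Sum>\<^sub># J" using J(1) by (auto simp: Q_def ord_power_subset_iff)
  note sub = factors_sub[OF assms(9) JZ]
  have setZ: "set_mset (S + ord_power g) \<subseteq> Y" using assms(5,7) set_ord_power[OF gV] by auto
  have setJ: "set_mset (\<Sum>\<^sub># J) \<subseteq> Y" using setZ set_mset_mono[OF sub(3)] by auto
  define S' where "S' = \<Sum>\<^sub># J - ord_power g"
  have SJ: "\<Sum>\<^sub># J = ord_power g + S'" using Jg by (simp add: S'_def)
  have "zero_sum S'" unfolding S'_def using zero_sum_diff Jg factors_zero_sum[OF sub(1)] ord_props(2)[OF gV] by blast
  then obtain W where W: "factors W S'" using factors_exists by blast
  have "S = S' + (S + ord_power g - \<Sum>\<^sub># J)"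
  proof -
    have "ord_power g + S = \<Sum>\<^sub># J + (S + ord_power g - \<Sum>\<^sub># J)" using sub(3) by (simp add: add.commute)
    also have "\<dots> = ord_power g + (S' + (S + ord_power g - \<Sum>\<^sub># J))" by (simp only: SJ add.assoc)
    finally show ?thesis by (rule add_left_imp_eq)
  qed
  then have "factors (W + (Z - J)) S" using factors_add[OF W sub(2)] by simp
  \<comment> \<open>Replacing the part \<open>J\<close> of \<open>Z\<close> by \<open>W\<close>
    gives a factorization of \<open>S\<close>, which turns the assumption into an inequality about
    \<open>J\<close> and \<open>W\<close> alone.\<close>
  from no[OF this] have WJ: "size W + 2 \<le> size J"
    using size_mset_mono[OF JZ] by (simp add: size_Diff_submset[OF JZ])
  have fJ: "factors ({#ord_power g#} + W) (\<Sum>\<^sub># J)" using factors_add[OF factors_atom[OF atom_ord_power[OF gV]] W] SJ by simp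
  have "int M dvd int (size J) - int (size ({#ord_power g#} + W))"
    using assms(1) setJ sub(1) fJ unfolding one_length_class_def by blast
  then have "int M \<le> int (size J) - int (size ({#ord_power g#} + W))" using WJ by (intro zdvd_imp_le) auto
  then have MJ: "M + 1 + size W \<le> size J" by auto
  have W0: "size W \<noteq> 0"
  proof
    assume "size W = 0"
    then have "S' = {#}" using W by (auto simp: factors_def)
    then have "J = {#ord_power g#}" using factors_of_atom[OF sub(1)] atom_ord_power[OF gV] SJ by auto
    then show False using WJ by auto
  qed
  define v where "v = count S' g"
  have cJ: "count (\<Sum>\<^sub># J) g = elt_order g + v" using SJ by (simp add: v_def ord_power_def)
  \<comment> \<open>By minimality of \<open>J\<close>, dropping any atom leaves fewer than
    \<open>elt_order g\<close> copies of \<open>g\<close>. As \<open>J\<close> has only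
    \<open>v\<close> copies to spare, each of its atoms contains more than \<open>v\<close>.\<close>
  have "v + 1 \<le> count A g" if "A \<in># J" for A
  proof -
    have "size (J - {#A#}) < size J" using that by (simp add: size_Diff1_less)
    then have "\<not> Q (J - {#A#})" using J(2) by force
    moreover have "J - {#A#} \<subseteq># Z" using diff_subset_eq_self JZ by (rule subset_mset.order_trans)
    ultimately have "count (\<Sum>\<^sub># (J - {#A#})) g < elt_order g" unfolding Q_def by auto
    moreover have "count (\<Sum>\<^sub># J) g = count A g + count (\<Sum>\<^sub># (J - {#A#})) g"
      using multi_member_split[OF that] by auto
    ultimately show ?thesis using cJ by auto
  qed
  then have "size J * (v + 1) \<le> elt_order g + v" using size_mult_le_count[of J "v + 1" g] cJ by auto
  moreover have "(M + 2) * (v + 1) \<le> size J * (v + 1)" proof (rule mult_right_mono)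
    show "M + 2 \<le> size J" using MJ W0 by linarith
  qed simp
  \<comment> \<open>The left side grows by \<open>M + 2\<close> with each unit of \<open>v\<close>,
    the right side by 1; the constant \<open>2 * M + 1\<close> is just small enough to leave only
    \<open>v = 0\<close>.\<close>
  ultimately have ineq: "(M + 2) * (v + 1) \<le> 2 * M + 1 + v" using ord_props(3)[OF gV] assms(4) by linarith
  have v0: "v = 0"
  proof (rule ccontr)
    assume "v \<noteq> 0"
    then have "(M + 1) * 1 \<le> (M + 1) * v" by (intro mult_left_mono) auto
    then show False using ineq by (simp add: algebra_simps)
  qed
  \<comment> \<open>Now \<open>W\<close> factors a sequence over the half-factorial set
    \<open>Y - {g}\<close>, so \<open>size W\<close> is the cross number of \<open>S'\<close>,
    whereas \<open>size J\<close> is at most this number plus 1. This contradicts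
    \<open>size W + 2 \<le> size J\<close>.\<close>
  have "g \<notin># S'" using v0 by (simp add: v_def not_in_iff)
  then have "set_mset S' \<subseteq> Y - {g}" using setJ SJ by auto
  then have "real (size W) = cross_number S'" using half_factorial_size assms(6) W by blast
  moreover have "1 * real (size J) \<le> cross_number (\<Sum>\<^sub># J)" using size_le_cross_number[of Y 1 _ J] assms(2) sub(1) setJ unfolding cross_ge_one_def by blast
  ultimately show False using SJ cross_number_ord_power[OF gV] WJ by auto
qed

lemma max_length_add_ord_powers:
  assumes "one_length_class M Y" "cross_ge_one Y" "Y \<subseteq> V" "n \<le> 2 * M + 1" "\<And>g. g \<in> Y \<Longrightarrow> half_factorial (Y - {g})"
    "set_mset S \<subseteq> Y" "zero_sum S" "set_mset D \<subseteq> Y" "factors Z (S + \<Sum>\<^sub># (image_mset ord_power D))"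
  shows "\<exists>Z'. factors Z' S \<and> size Z \<le> size Z' + size D"
  using assms(8,9)
proof (induction D arbitrary: Z)
  case (add g D)
  let ?S = "S + \<Sum>\<^sub># (image_mset ord_power D)"
  have DV: "set_mset D \<subseteq> V" using add.prems assms(3) by auto
  have "set_mset ?S \<subseteq> Y" using set_ord_powers[OF DV] add.prems assms(6) by auto
  moreover have "zero_sum ?S" using assms(7) zero_sum_add factors_zero_sum[OF factors_ord_powers[OF DV]] by auto
  moreover have "factors Z (?S + ord_power g)" using add.prems(2) by (simp add: algebra_simps)
  ultimately obtain Z' where "factors Z' ?S" "size Z \<le> size Z' + 1"
    using max_length_add_ord_power[OF assms(1-4) _ assms(5)] add.prems(1) by (metis insert_subset set_mset_add_mset_insert)
  then show ?case using add.IH[of Z'] add.prems(1) by force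
qed auto

text \<open>Modulo full powers, \<open>A\<close> is a product of atoms of cross number 1. So
  \<open>A\<close> times the full powers in \<open>D1\<close> has a factorization of length
  \<open>cross_number A + size D1\<close>, and removing these powers one by one leaves a
  factorization of \<open>A\<close> with at least \<open>cross_number A\<close> factors. As an atom
  has only the length 1, its cross number is at most 1.\<close>

lemma half_factorial_step:
  assumes "one_length_class M Y" "cross_ge_one Y" "Y \<subseteq> V" "r \<le> M" "n \<le> 2 * M + 1" "\<And>g. g \<in> Y \<Longrightarrow> half_factorial (Y - {g})"
  shows "half_factorial Y"
  unfolding half_factorial_def
proof (intro allI impI)
  fix A assume A: "atom A" "set_mset A \<subseteq> Y"
  have finY: "finite Y" using assms(3) finV finite_subset by auto
  have "relation Y (\<lambda>g. int (count A g))" using zero_sum_relation[OF assms(3) A(2)] A(1) atom_zero_sum by auto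
  then have "unit_generated Y (\<lambda>g. int (count A g))"
    using unit_generated_all[OF assms(3)] small_support[OF assms(1-4)] by auto
  then obtain d Z where dZ: "\<forall>A\<in>#Z. atom A \<and> cross_number A = 1 \<and> set_mset A \<subseteq> Y"
     "\<forall>g\<in>Y. int (count A g) + int (elt_order g) * d g = int (count (\<Sum>\<^sub># Z) g)" unfolding unit_generated_def by blast
  \<comment> \<open>The positive and the negative part of \<open>d\<close> go to opposite sides, so
    that both sides of \<open>eq\<close> are sequences.\<close>
  define D1 where "D1 = mset_of Y (\<lambda>g. nat (d g))"
  define D2 where "D2 = mset_of Y (\<lambda>g. nat (- d g))"
  have DY: "set_mset D1 \<subseteq> Y" "set_mset D2 \<subseteq> Y" unfolding D1_def D2_def using set_mset_of[OF finY] by auto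
  then have DV: "set_mset D1 \<subseteq> V" "set_mset D2 \<subseteq> V" using assms(3) by auto
  have ZY: "set_mset (\<Sum>\<^sub># Z) \<subseteq> Y" using dZ(1) by auto
  let ?P = "\<lambda>D. \<Sum>\<^sub># (image_mset ord_power D)"
  have eq: "A + ?P D1 = \<Sum>\<^sub># Z + ?P D2"
  proof (rule multiset_eqI)
    fix g
    show "count (A + ?P D1) g = count (\<Sum>\<^sub># Z + ?P D2) g"
    proof (cases "g \<in> Y")
      case True
      have "int (count A g) + int (elt_order g) * (int (nat (d g)) - int (nat (- d g))) = int (count (\<Sum>\<^sub># Z) g)"
        using dZ(2) True by (cases "d g \<ge> 0") auto
      then have "int (count A g + nat (d g) * elt_order g) = int (count (\<Sum>\<^sub># Z) g + nat (- d g) * elt_order g)"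
        by (simp add: algebra_simps)
      then show ?thesis using True finY
        by (simp only: count_union count_ord_powers) (simp add: D1_def D2_def count_mset_of del: of_nat_add of_nat_mult)
    next
      case False
      then have "count A g = 0" "count (\<Sum>\<^sub># Z) g = 0" using A(2) ZY by (meson not_in_iff subsetD)+
      then show ?thesis using False finY by (simp add: count_ord_powers D1_def D2_def count_mset_of)
    qed
  qed
  have f: "factors (Z + image_mset ord_power D2) (A + ?P D1)"
    using eq dZ(1) factors_ord_powers[OF DV(2)] by (auto simp: factors_def)
  have "\<forall>B\<in>#Z + image_mset ord_power D2. cross_number B = 1" using dZ(1) cross_number_ord_power DV(2) by auto
  then have "image_mset cross_number (Z + image_mset ord_power D2) = image_mset (\<lambda>_. 1) (Z + image_mset ord_power D2)"
    by (intro image_mset_cong) auto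
  then have "cross_number (\<Sum>\<^sub># (Z + image_mset ord_power D2)) = real (size (Z + image_mset ord_power D2))" unfolding cross_number_sum_mset by simp
  then have "cross_number (A + ?P D1) = real (size (Z + image_mset ord_power D2))" using f by (simp only: factors_def)
  then have 1: "cross_number A + real (size D1) = real (size (Z + image_mset ord_power D2))" using cross_number_ord_powers[OF DV(1)] by simp
  obtain Z' where Z': "factors Z' A" "size (Z + image_mset ord_power D2) \<le> size Z' + size D1"
    using max_length_add_ord_powers[OF assms(1-3,5,6) A(2) atom_zero_sum[OF A(1)] DY(1) f] by blast
  have "size Z' = 1" using factors_of_atom[OF Z'(1) A(1)] by simp
  then have "cross_number A \<le> 1" using 1 Z'(2) by auto
  moreover have "cross_number A \<ge> 1" using assms(2) A unfolding cross_ge_one_def by auto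
  ultimately show "cross_number A = 1" by auto
qed

lemma one_length_class_mono: "one_length_class M Y \<Longrightarrow> Y' \<subseteq> Y \<Longrightarrow> one_length_class M Y'"
  unfolding one_length_class_def by blast

lemma cross_ge_one_mono: "cross_ge_one Y \<Longrightarrow> Y' \<subseteq> Y \<Longrightarrow> cross_ge_one Y'"
  unfolding cross_ge_one_def by blast

text \<open>Both conditions on \<open>Y\<close> pass to subsets, so induction over proper subsets
  supplies the half-factorial sets \<open>Y - {g}\<close> that the step requires.\<close>

theorem cross_ge_one_half_factorial:
  assumes "one_length_class M Y" "cross_ge_one Y" "Y \<subseteq> V" "r \<le> M" "n \<le> 2 * M + 1"
  shows "half_factorial Y"
proof -
  have "finite Y" using assms(3) finV finite_subset by auto
  then show ?thesis using assms(1-3)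
  proof (induction Y rule: finite_psubset_induct)
    case (psubset Y)
    show ?case
    proof (rule half_factorial_step[OF psubset.prems assms(4,5)])
      fix g assume "g \<in> Y"
      then have "Y - {g} \<subset> Y" by auto
      then show "half_factorial (Y - {g})" using psubset.IH one_length_class_mono cross_ge_one_mono psubset.prems by (meson Diff_subset order_trans)
    qed
  qed
qed


section \<open>Atoms of cross number below 1 and independence\<close>

definition lengths :: "'a multiset \<Rightarrow> nat set" where
  "lengths S = {size Z |Z. factors Z S}"

text \<open>This is \<open>n\<close> times the cross number, as a natural number, so that an atom of
  least cross number exists by the least number principle.\<close>

definition scaled_cross_number :: "'a multiset \<Rightarrow> nat" where
  "scaled_cross_number S = (\<Sum>g\<in>#S. n div elt_order g)"

lemma cross_number_scaled: "set_mset S \<subseteq> V \<Longrightarrow> cross_number S = real (scaled_cross_number S) / real n"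
proof (induction S)
  case (add g S)
  have "elt_order g dvd n" "elt_order g > 0" using add.prems ord_dvd_n ord_props by auto
  then have "real (n div elt_order g) = real n / real (elt_order g)" by (simp add: real_of_nat_div)
  then have "1 / real (elt_order g) = real (n div elt_order g) / real n" using n_pos by simp
  then show ?case using add by (simp add: cross_number_def scaled_cross_number_def add_divide_distrib)
qed (simp add: scaled_cross_number_def)

lemma cross_number_pos: assumes "set_mset S \<subseteq> V" "S \<noteq> {#}" shows "cross_number S > 0"
proof -
  obtain g T where S: "S = add_mset g T" using assms(2) by (meson multiset_cases)
  then have "elt_order g > 0" using assms(1) ord_props(1) by auto
  then show ?thesis using cross_number_nonneg[of T] unfolding S cross_number_def by (simp add: add_pos_nonneg)
qed

lemma cross_number_repeat: "cross_number (repeat_mset t A) = real t * cross_number A"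
  by (induction t) (simp_all add: distrib_right)

lemma set_repeat: "set_mset (repeat_mset t A) \<subseteq> set_mset A"
  by (induction t) auto

lemma zero_sum_repeat: "zero_sum A \<Longrightarrow> zero_sum (repeat_mset t A)"
  by (induction t) (simp_all add: zero_sum_add)

lemma factors_repeat: assumes "atom A" shows "factors (replicate_mset t A) (repeat_mset t A)"
proof (induction t)
  case (Suc t)
  then show ?case using factors_add[OF factors_atom[OF assms]] by simp
qed simp

text \<open>Let \<open>A\<close> have least cross number. For \<open>g\<close> in \<open>A\<close>,
  let \<open>t\<close> be least such that the \<open>t\<close>-th power of \<open>A\<close> contains
  \<open>ord_power g\<close>. Splitting off this full power leaves a factorization with fewer than
  \<open>t\<close> factors in total, since no atom has smaller cross number than \<open>A\<close>
  and \<open>A\<close> has cross number below 1. The loss is then at least \<open>M\<close>, so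
  \<open>t\<close> is at least \<open>M + 2\<close>, and \<open>n \<le> 2 * M + 1\<close> permits
  this only for multiplicity 1 and order \<open>n\<close>.\<close>

lemma short_atom:
  assumes "one_length_class M Y" "Y \<subseteq> V" "M \<ge> 1" "n \<le> 2 * M + 1"
    "atom A0" "set_mset A0 \<subseteq> Y" "cross_number A0 < 1"
  shows "\<exists>A. atom A \<and> set_mset A \<subseteq> Y \<and> (\<forall>g\<in>#A. count A g = 1 \<and> elt_order g = n) \<and> M + size A = n \<and> size A \<ge> 2"
proof -
  obtain A where A: "atom A" "set_mset A \<subseteq> Y"
    and min: "\<And>B. atom B \<and> set_mset B \<subseteq> Y \<Longrightarrow> scaled_cross_number A \<le> scaled_cross_number B"
  proof -
    have "\<exists>A. (atom A \<and> set_mset A \<subseteq> Y) \<and> (\<forall>B. atom B \<and> set_mset B \<subseteq> Y \<longrightarrow> scaled_cross_number A \<le> scaled_cross_number B)"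
      using assms(5,6) by (intro ex_has_least_nat[of _ A0]) simp
    then show ?thesis using that by blast
  qed
  have AV: "set_mset A \<subseteq> V" using A(2) assms(2) by auto
  have kmin: "cross_number A \<le> cross_number B" if "atom B" "set_mset B \<subseteq> Y" for B
    using min[of B] that cross_number_scaled[OF AV] cross_number_scaled[of B] assms(2) by (simp add: divide_right_mono)
  have k1: "cross_number A < 1" using kmin[OF assms(5,6)] assms(7) by simp
  have A0: "A \<noteq> {#}" using A(1) by (simp add: atom_def)
  have kp: "cross_number A > 0" using cross_number_pos[OF AV A0] .
  have main: "count A g = 1 \<and> elt_order g = n" if g: "g \<in># A" for g
  proof -
    have gV: "g \<in> V" using g AV by auto
    have ne: "A \<noteq> ord_power g" using k1 cross_number_ord_power[OF gV] by auto
    have v: "count A g \<ge> 1" using g by (simp add: Suc_le_eq)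
    define t where "t = (LEAST t. elt_order g \<le> t * count A g)"
    have "elt_order g \<le> elt_order g * count A g" using v by simp
    then have t: "elt_order g \<le> t * count A g" unfolding t_def by (rule LeastI)
    have t0: "t > 0" using t ord_props(1)[OF gV] by (intro gr0I) auto
    then have t1: "(t - 1) * count A g < elt_order g"
      using not_less_Least[of "t - 1" "\<lambda>t. elt_order g \<le> t * count A g"] unfolding t_def by auto
    have sub: "ord_power g \<subseteq># repeat_mset t A" using t by (simp add: ord_power_subset_iff)
    define U where "U = repeat_mset t A - ord_power g"
    have RU: "repeat_mset t A = ord_power g + U" using sub by (simp add: U_def)
    have "zero_sum U" unfolding U_def using zero_sum_diff[OF zero_sum_repeat[OF atom_zero_sum[OF A(1)]] ord_props(2)[OF gV] sub] .
    then obtain W where W: "factors W U" using factors_exists by blast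
    have RY: "set_mset (repeat_mset t A) \<subseteq> Y" using A(2) set_repeat by (rule order_trans[rotated])
    then have UY: "set_mset U \<subseteq> Y" unfolding RU by simp
    have f2: "factors ({#ord_power g#} + W) (repeat_mset t A)" unfolding RU by (rule factors_add[OF factors_atom[OF atom_ord_power[OF gV]] W])
    have kU: "cross_number U = real t * cross_number A - 1" using cross_number_repeat[of t A] cross_number_ord_power[OF gV] unfolding RU by simp
    have "cross_number A * real (size W) \<le> cross_number U" by (rule size_le_cross_number[OF kmin UY W])
    then have "cross_number A * (real t - real (size W)) \<ge> 1" using kU by (simp add: algebra_simps)
    then have "cross_number A * (real t - real (size W)) > cross_number A * 1" using k1 by simp
    then have "real t - real (size W) > 1" using kp by (simp only: mult_less_cancel_left_pos)
    then have q: "size W + 1 < t" by linarith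
    have "int M dvd int (size (replicate_mset t A)) - int (size ({#ord_power g#} + W))"
      using assms(1) RY factors_repeat[OF A(1)] f2 unfolding one_length_class_def by blast
    then have "int M \<le> int (size (replicate_mset t A)) - int (size ({#ord_power g#} + W))" using q by (intro zdvd_imp_le) auto
    then have tM: "M + 1 + size W \<le> t" by auto
    have W0: "W \<noteq> {#}"
    proof
      assume "W = {#}"
      then have "U = {#}" using W by (simp add: factors_def)
      then have "repeat_mset t A = ord_power g" using RU by simp
      moreover have "A \<subseteq># repeat_mset t A" using t0 by (cases t) auto
      ultimately have "A \<subseteq># ord_power g" by simp
      then have "A = {#} \<or> A = ord_power g" using atom_ord_power[OF gV] atom_zero_sum[OF A(1)] by (simp add: atom_def)
      then have "A = ord_power g" using A0 by simp
      then show False using ne by simp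
    qed
    then have "size W \<ge> 1" by (simp add: Suc_le_eq nonempty_has_size)
    then have tM2: "M + 2 \<le> t" using tM by linarith
    have c1: "count A g = 1"
    proof (rule ccontr)
      assume "count A g \<noteq> 1"
      then have "2 \<le> count A g" using v by linarith
      then have "(t - 1) * 2 \<le> (t - 1) * count A g" by (rule mult_left_mono) simp
      then show False using t1 ord_props(3)[OF gV] assms(4) tM2 by linarith
    qed
    then have "t \<le> elt_order g" using t1 by simp
    \<comment> \<open>An order above half of \<open>n\<close> that divides \<open>n\<close> is
      \<open>n\<close> itself.\<close>
    then have o: "n < elt_order g * 2" using tM2 assms(4) by linarith
    obtain c where c: "n = elt_order g * c" using ord_dvd_n[OF gV] by auto
    have "c < 2" using o unfolding c by simp
    moreover have "c \<noteq> 0" using c n_pos by auto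
    ultimately have "c = 1" by linarith
    then show ?thesis using c1 c by simp
  qed
  have kA: "cross_number A = real (size A) / real n"
  proof -
    have "scaled_cross_number A = size A"
    proof -
      have "image_mset (\<lambda>g. n div elt_order g) A = image_mset (\<lambda>_. 1) A"
        using main n_pos by (intro image_mset_cong) auto
      then show ?thesis unfolding scaled_cross_number_def by simp
    qed
    then show ?thesis using cross_number_scaled[OF AV] by simp
  qed
  then have "real (size A) / real n < 1" using k1 by simp
  then have sn: "size A < n" using n_pos by simp
  have s2: "size A \<ge> 2"
  proof (rule ccontr)
    assume "\<not> size A \<ge> 2"
    then have "size A = 1" using A0 nonempty_has_size[of A] by linarith
    then obtain g where g: "A = {#g#}" using size_1_singleton_mset by blast
    then have "elt_order g = n" "g \<in> V" using main AV by auto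
    then have "n dvd 1" using zero_sum_replicate_iff[of g 1] atom_zero_sum[OF A(1)] g by simp
    then have "n = 1" by simp
    then show False using sn \<open>size A = 1\<close> by simp
  qed
  \<comment> \<open>All multiplicities are 1 and all orders are \<open>n\<close>, so the
    \<open>n\<close>-th power of \<open>A\<close> also factors into \<open>size A\<close> full
    powers. Comparing lengths shows that \<open>M\<close> divides \<open>n - size A\<close>, which
    lies strictly between 0 and \<open>2 * M\<close>.\<close>
  have eq: "repeat_mset n A = \<Sum>\<^sub># (image_mset ord_power A)"
  proof (rule multiset_eqI)
    fix g show "count (repeat_mset n A) g = count (\<Sum>\<^sub># (image_mset ord_power A)) g"
    proof (cases "g \<in># A")
      case True
      then show ?thesis using main[OF True] by (simp add: count_ord_powers)
    next
      case False
      then have "count A g = 0" by (simp only: not_in_iff)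
      then show ?thesis by (simp add: count_ord_powers)
    qed
  qed
  have "set_mset (repeat_mset n A) \<subseteq> Y" unfolding eq set_ord_powers[OF AV] by (rule A(2))
  then have "int M dvd int (size (replicate_mset n A)) - int (size (image_mset ord_power A))"
    using assms(1) factors_repeat[OF A(1), of n] factors_ord_powers[OF AV] unfolding one_length_class_def eq by blast
  then have d: "M dvd n - size A" 
  proof -
    have "int (size (replicate_mset n A)) - int (size (image_mset ord_power A)) = int (n - size A)" using sn by simp
    then show ?thesis using \<open>int M dvd _\<close> by (simp only: int_dvd_int_iff)
  qed
  then obtain c where c: "n - size A = M * c" by auto
  have "M * c < M * 2" using c s2 assms(4) sn by linarith
  then have "c < 2" by simp
  moreover have "c \<noteq> 0" using c sn by (cases c) auto
  ultimately have "c = 1" by linarith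
  then have "M + size A = n" using c sn by simp
  then show ?thesis using A main s2 by blast
qed

text \<open>Removing any \<open>g\<close> from the support \<open>E\<close> of the short atom
  \<open>A\<close> leaves a half-factorial set: an atom of cross number below 1 there would yield
  \<open>n - M = card E\<close> distinct elements of \<open>E - {g}\<close>. Now let
  \<open>Z\<close> be zero-sum over \<open>E - {g}\<close> with largest multiplicity
  \<open>t\<close>, attained at \<open>h\<close>. Its complement \<open>U\<close> in the
  \<open>t\<close>-th power of \<open>A\<close> avoids \<open>h\<close>, so the lengths of
  \<open>Z\<close> and \<open>U\<close> are both given by cross numbers. Comparison with the
  factorization into \<open>t\<close> copies of \<open>A\<close> shows that \<open>n\<close> divides
  \<open>t\<close>.\<close>

theorem independent_set_exists:
  assumes "one_length_class M Y" "Y \<subseteq> V" "\<not> half_factorial Y" "M \<ge> 1" "r \<le> M" "n \<le> 2 * M + 1"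
  shows "\<exists>E\<subseteq>V. M + card E = n \<and> card E \<ge> 2 \<and> (\<forall>g\<in>E. elt_order g = n) \<and>
    (\<forall>g\<in>E. \<forall>Z. zero_sum Z \<longrightarrow> set_mset Z \<subseteq> E - {g} \<longrightarrow> (\<forall>h. count Z h < n) \<longrightarrow> Z = {#})"
proof -
  have "\<not> cross_ge_one Y" using cross_ge_one_half_factorial[OF assms(1) _ assms(2,5,6)] assms(3) by blast
  then obtain A0 where A0: "atom A0" "set_mset A0 \<subseteq> Y" "cross_number A0 < 1" unfolding cross_ge_one_def by force
  obtain A where A: "atom A" "set_mset A \<subseteq> Y" and A1: "\<And>g. g \<in># A \<Longrightarrow> count A g = 1"
    and An: "\<And>g. g \<in># A \<Longrightarrow> elt_order g = n" and sA: "M + size A = n" "size A \<ge> 2"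
    using short_atom[OF assms(1,2,4,6) A0] by blast
  define E where "E = set_mset A"
  have EV: "E \<subseteq> V" using A(2) assms(2) by (auto simp: E_def)
  have cE: "card E = size A" unfolding E_def size_multiset_overloaded_eq using A1 by simp
  have hf: "half_factorial (E - {g})" if "g \<in> E" for g
  proof (rule cross_ge_one_half_factorial[where M = M])
    have sub: "E - {g} \<subseteq> Y" using A(2) by (auto simp: E_def)
    show oc: "one_length_class M (E - {g})" using one_length_class_mono[OF assms(1) sub] .
    show "E - {g} \<subseteq> V" using EV by auto
    show "cross_ge_one (E - {g})" unfolding cross_ge_one_def
    proof (intro allI impI, rule ccontr)
      fix B assume B: "atom B" "set_mset B \<subseteq> E - {g}" "\<not> 1 \<le> cross_number B"
      obtain C where C: "set_mset C \<subseteq> E - {g}" "\<forall>h\<in>#C. count C h = 1" "M + size C = n"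
        using short_atom[OF oc \<open>E - {g} \<subseteq> V\<close> assms(4,6) B(1,2)] B(3) by auto
      have "size C = card (set_mset C)" unfolding size_multiset_overloaded_eq using C(2) by simp
      also have "\<dots> \<le> card (E - {g})" using C(1) by (intro card_mono) (auto simp: E_def)
      also have "\<dots> < card E" using that by (intro psubset_card_mono) (auto simp: E_def)
      finally show False using C(3) sA cE by simp
    qed
  qed (use assms in auto)
  have "Z = {#}" if g: "g \<in> E" and Z: "zero_sum Z" "set_mset Z \<subseteq> E - {g}" "\<forall>h. count Z h < n" for g Z
  proof (rule ccontr)
    assume "Z \<noteq> {#}"
    then have ne: "count Z ` set_mset Z \<noteq> {}" by auto
    define t where "t = Max (count Z ` set_mset Z)"
    obtain h where h: "h \<in># Z" "count Z h = t"
      using Max_in[OF _ ne] unfolding t_def by auto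
    have tmax: "count Z x \<le> t" for x
      unfolding t_def by (cases "x \<in># Z") (auto intro: Max_ge simp: not_in_iff)
    have t0: "t > 0" and tn: "t < n" using h Z(3) by auto
    have cA: "count A x = (if x \<in> E then 1 else 0)" for x
      using A1[of x] by (auto simp: E_def not_in_iff)
    have ZE: "x \<in> E" if "x \<in># Z" for x using Z(2) that by auto
    have sub: "Z \<subseteq># repeat_mset t A"
    proof (rule mset_subset_eqI)
      fix x show "count Z x \<le> count (repeat_mset t A) x"
        using tmax[of x] ZE[of x] by (cases "x \<in># Z") (auto simp: cA not_in_iff)
    qed
    define U where "U = repeat_mset t A - Z"
    have RU: "repeat_mset t A = Z + U" using sub by (simp add: U_def)
    have zU: "zero_sum U" unfolding U_def using zero_sum_diff[OF zero_sum_repeat[OF atom_zero_sum[OF A(1)]] Z(1) sub] .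
    have hE: "h \<in> E" using ZE h by blast
    have "count U h = 0" unfolding U_def using h hE by (simp add: cA)
    moreover have "x \<in> E" if "x \<in># U" for x
    proof (rule ccontr)
      assume "x \<notin> E"
      then have "count U x = 0" by (simp add: U_def cA)
      then have "x \<notin># U" by (simp only: not_in_iff)
      then show False using that by blast
    qed
    moreover have "h \<notin># U" using \<open>count U h = 0\<close> by (simp only: not_in_iff)
    ultimately have UE: "set_mset U \<subseteq> E - {h}" by blast
    obtain W where W: "factors W Z" using factors_exists Z(1) by blast
    obtain W' where W': "factors W' U" using factors_exists zU by blast
    have "real (size W) = cross_number Z" "real (size W') = cross_number U"
      using half_factorial_size[OF hf[OF g] Z(2) W] half_factorial_size[OF hf[OF hE] UE W'] by auto
    then have "real (size W + size W') = real t * cross_number A" using cross_number_repeat[of t A] unfolding RU by simp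
    moreover have "cross_number A = real (size A) / real n"
    proof -
      have AV: "set_mset A \<subseteq> V" using EV by (simp add: E_def)
      have "image_mset (\<lambda>g. n div elt_order g) A = image_mset (\<lambda>_. 1) A"
        using An n_pos by (intro image_mset_cong) auto
      then have "scaled_cross_number A = size A" unfolding scaled_cross_number_def by simp
      then show ?thesis using cross_number_scaled[OF AV] by simp
    qed
    ultimately have "real n * real (size W + size W') = real t * real (size A)" using n_pos by simp
    then have "real (n * (size W + size W')) = real (t * size A)" by (simp only: of_nat_mult)
    then have "n * (size W + size W') = t * size A" by (simp only: of_nat_eq_iff)
    then have "int (n * (size W + size W')) = int (t * size A)" by (simp only:)
    then have "int n * int (size W + size W') = int t * int (size A)" by (simp only: of_nat_mult)
    moreover have "int (size A) = int n - int M" using sA by simp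
    \<comment> \<open>The lengths of \<open>Z\<close> and \<open>U\<close> add up to
      \<open>t * size A / n\<close>; with \<open>size A = n - M\<close>, the drop from
      \<open>t\<close> is \<open>t * M / n\<close>.\<close>
    ultimately have e: "int n * (int t - int (size W + size W')) = int t * int M"
      by (simp add: algebra_simps)
    have RY: "set_mset (repeat_mset t A) \<subseteq> Y"
      unfolding RU using UE Z(2) A(2) by (auto simp: E_def)
    have "factors (W + W') (repeat_mset t A)" unfolding RU using factors_add[OF W W'] .
    then have "int M dvd int (size (replicate_mset t A)) - int (size (W + W'))"
      using assms(1) RY factors_repeat[OF A(1)] unfolding one_length_class_def by blast
    then obtain c where c: "int t - int (size W + size W') = int M * c" by auto
    \<comment> \<open>The drop in length is a multiple of \<open>M\<close>, so \<open>M\<close>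
      cancels and \<open>n\<close> divides \<open>t\<close>, although
      \<open>0 < t < n\<close>.\<close>
    have "int n * c = int t" using e assms(4) unfolding c by simp
    then have "int n dvd int t" by (rule dvdI[OF sym])
    then show False using t0 tn by (auto dest: dvd_imp_le)
  qed
  then show ?thesis using EV cE sA An by (intro exI[of _ E]) (auto simp: E_def)
qed

section \<open>Elements of unbounded multiplicity in sequences with long progressions\<close>

lemma atom_cross_number_le: assumes "atom A" shows "cross_number A \<le> card V"
proof -
  have "cross_number A = (\<Sum>g\<in>V. real (count A g) / real (elt_order g))" using cross_number_eq[OF finV zero_sum_set[OF atom_zero_sum[OF assms]]] .
  also have "\<dots> \<le> (\<Sum>g\<in>V. 1)"
    using atom_count_le[OF assms] ord_props(1) by (intro sum_mono) (simp add: divide_le_eq_1)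
  finally show ?thesis by simp
qed

lemma size_le_outer_count:
  assumes "finite Y'" "\<And>A. A \<in># Z \<Longrightarrow> \<exists>g\<in>Y'. g \<in># A"
  shows "size Z \<le> (\<Sum>g\<in>Y'. count (\<Sum>\<^sub># Z) g)"
  using assms(2)
proof (induction Z)
  case (add A Z)
  obtain g where g: "g \<in> Y'" "g \<in># A" using add.prems[of A] by auto
  have "1 \<le> count A g" using g by (simp add: Suc_le_eq)
  also have "\<dots> \<le> (\<Sum>g\<in>Y'. count A g)" using member_le_sum[OF g(1) _ assms(1), of "count A"] by simp
  finally show ?case using add by (simp add: sum.distrib)
qed simp

text \<open>\<open>Y\<close> collects the elements whose multiplicity in the given sequences is unbounded.\<close>
theorem long_progressions:
  assumes "M \<ge> 1" "\<And>N. \<exists>S y k. zero_sum S \<and> N \<le> k \<and> lengths S = {y + M * i |i. i \<le> k}"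
  shows "\<exists>Y\<subseteq>V. one_length_class M Y \<and> \<not> half_factorial Y"
proof -
  have "\<forall>N. \<exists>p. zero_sum (fst p) \<and> N \<le> snd (snd p) \<and> lengths (fst p) = {fst (snd p) + M * i |i. i \<le> snd (snd p)}"
    using assms(2) by fastforce
  from choice[OF this] obtain p where p: "\<And>N. zero_sum (fst (p N)) \<and> N \<le> snd (snd (p N)) \<and>
    lengths (fst (p N)) = {fst (snd (p N)) + M * i |i. i \<le> snd (snd (p N))}" by blast
  define S y k where "S N = fst (p N)" and "y N = fst (snd (p N))" and "k N = snd (snd (p N))" for N
  have S: "zero_sum (S N)" "N \<le> k N" "lengths (S N) = {y N + M * i |i. i \<le> k N}" for N
    using p[of N] by (auto simp: S_def y_def k_def)
  \<comment> \<open>Multiplicities have to be large on all of \<open>Y\<close> at the same index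
    \<open>j\<close>. Maximality of \<open>Y\<close> then bounds the multiplicity of each outside
    element wherever those on \<open>Y\<close> are large.\<close>
  define Q where "Q Y \<longleftrightarrow> Y \<subseteq> V \<and> (\<forall>N. \<exists>j\<ge>N. \<forall>g\<in>Y. N \<le> count (S j) g)" for Y
  have "finite (Collect Q)" using finV by (rule finite_subset[rotated, OF finite_Pow_iff[THEN iffD2]]) (auto simp: Q_def)
  moreover have "Q {}" by (auto simp: Q_def)
  ultimately obtain Y where Y: "Q Y" and max: "\<And>Y'. Q Y' \<Longrightarrow> Y \<subseteq> Y' \<Longrightarrow> Y = Y'"
    using finite_has_maximal[of "Collect Q"] by blast
  have YV: "Y \<subseteq> V" using Y by (simp add: Q_def)
  have "\<forall>g\<in>V - Y. \<exists>N. \<forall>j\<ge>N. \<exists>h\<in>insert g Y. count (S j) h < N"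
  proof
    fix g assume "g \<in> V - Y"
    then have "\<not> Q (insert g Y)" "insert g Y \<subseteq> V" using max[of "insert g Y"] YV by auto
    then have "\<not> (\<forall>N. \<exists>j\<ge>N. \<forall>h\<in>insert g Y. N \<le> count (S j) h)" unfolding Q_def by blast
    then show "\<exists>N. \<forall>j\<ge>N. \<exists>h\<in>insert g Y. count (S j) h < N" unfolding not_le[symmetric] by blast
  qed
  from bchoice[OF this] obtain Ng where Ng: "\<And>g j. g \<in> V - Y \<Longrightarrow> j \<ge> Ng g \<Longrightarrow> \<exists>h\<in>insert g Y. count (S j) h < Ng g" by blast
  \<comment> \<open>A common bound for all \<open>Ng g\<close>; the sum serves as well as the
    maximum and makes sense for \<open>V - Y\<close> empty.\<close>
  define N0 where "N0 = (\<Sum>g\<in>V - Y. Ng g)"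
  have N0: "Ng g \<le> N0" if "g \<in> V - Y" for g
    unfolding N0_def using that finV by (intro member_le_sum) auto
  have ex: "\<exists>j\<ge>N. (\<forall>g\<in>Y. N \<le> count (S j) g) \<and> (\<forall>g\<in>V - Y. count (S j) g \<le> N0)" for N
  proof -
    obtain j where j: "j \<ge> max N N0" "\<forall>g\<in>Y. max N N0 \<le> count (S j) g" using Y unfolding Q_def by blast
    have "count (S j) g \<le> N0" if g: "g \<in> V - Y" for g
    proof -
      have "j \<ge> Ng g" using j(1) N0[OF g] by auto
      then obtain h where h: "h \<in> insert g Y" "count (S j) h < Ng g" using Ng[OF g] by blast
      then have "h = g" using j(2) N0[OF g] by force
      then show ?thesis using h N0[OF g] by auto
    qed
    then show ?thesis using j by (intro exI[of _ j]) auto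
  qed
  have "one_length_class M Y" unfolding one_length_class_def
  proof (intro allI impI)
    fix T Z Z' assume T: "set_mset T \<subseteq> Y" "factors Z T" "factors Z' T"
    obtain j where j: "\<forall>g\<in>Y. size T \<le> count (S j) g" using ex[of "size T"] by blast
    have sub: "T \<subseteq># S j"
    proof (rule mset_subset_eqI)
      fix g
      show "count T g \<le> count (S j) g"
      proof (cases "g \<in># T")
        case True
        then show ?thesis using T(1) j count_le_size[of T g] by (meson order_trans subsetD)
      qed (simp add: not_in_iff)
    qed
    \<comment> \<open>Every sequence over \<open>Y\<close> divides some \<open>S j\<close>;
      completing both factorizations by the same \<open>W\<close> puts both lengths into one
      progression of difference \<open>M\<close>.\<close>
    obtain W where W: "factors W (S j - T)" using factors_exists zero_sum_diff[OF S(1) factors_zero_sum[OF T(2)] sub] by blast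
    have "factors (Z + W) (S j)" "factors (Z' + W) (S j)" using factors_add[OF T(2) W] factors_add[OF T(3) W] sub by auto
    then have "size (Z + W) \<in> lengths (S j)" "size (Z' + W) \<in> lengths (S j)" unfolding lengths_def by blast+
    then obtain a b where "size (Z + W) = y j + M * a" "size (Z' + W) = y j + M * b" unfolding S(3) by blast
    then have "int (size Z) - int (size Z') = int M * (int a - int b)"
      by (simp add: right_diff_distrib flip: of_nat_mult)
    then show "int M dvd int (size Z) - int (size Z')" by simp
  qed
  moreover have "\<not> half_factorial Y"
  proof
    assume hf: "half_factorial Y"
    \<comment> \<open>At most \<open>card V * N0\<close> atoms of a factorization leave
      \<open>Y\<close>, since each uses up one of the bounded multiplicities. Each of them has cross
      number at most \<open>card V\<close>, the others have cross number 1, so every length lies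
      within \<open>C\<close> of \<open>cross_number (S j)\<close>. A progression with more than
      \<open>2 * C\<close> steps does not fit.\<close>
    define C where "C = card V * N0 * (card V + 1)"
    obtain j where j: "j \<ge> 2 * C + 1" "\<forall>g\<in>V - Y. count (S j) g \<le> N0" using ex[of "2 * C + 1"] by blast
    have bound: "\<bar>real (size Z) - cross_number (S j)\<bar> \<le> real C" if Z: "factors Z (S j)" for Z
    proof -
      define Z1 where "Z1 = filter_mset (\<lambda>A. set_mset A \<subseteq> Y) Z"
      define Z2 where "Z2 = filter_mset (\<lambda>A. \<not> set_mset A \<subseteq> Y) Z"
      have ZZ: "Z = Z1 + Z2" unfolding Z1_def Z2_def by (rule multiset_partition)
      have at: "atom A" if "A \<in># Z" for A using Z that by (simp add: factors_def)
      have Sj: "S j = \<Sum>\<^sub># Z1 + \<Sum>\<^sub># Z2" using Z unfolding ZZ factors_def by simp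
      have "image_mset cross_number Z1 = image_mset (\<lambda>_. 1) Z1"
        using hf at unfolding half_factorial_def Z1_def by (intro image_mset_cong) auto
      then have k1: "cross_number (\<Sum>\<^sub># Z1) = real (size Z1)" unfolding cross_number_sum_mset by simp
      have "size Z2 \<le> (\<Sum>g\<in>V - Y. count (\<Sum>\<^sub># Z2) g)"
      proof (rule size_le_outer_count)
        fix A assume "A \<in># Z2"
        then have "A \<in># Z" "\<not> set_mset A \<subseteq> Y" by (auto simp: Z2_def)
        then show "\<exists>g\<in>V - Y. g \<in># A" using zero_sum_set[OF atom_zero_sum[OF at]] by blast
      qed (use finV in auto)
      also have "\<dots> \<le> (\<Sum>g\<in>V - Y. N0)"
      proof (rule sum_mono)
        fix g assume "g \<in> V - Y"
        then have "count (S j) g \<le> N0" using j(2) by blast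
        then show "count (\<Sum>\<^sub># Z2) g \<le> N0" unfolding Sj by simp
      qed
      also have "\<dots> \<le> card V * N0" using finV by (simp add: card_mono)
      finally have s2: "size Z2 \<le> card V * N0" .
      have "cross_number (\<Sum>\<^sub># Z2) \<le> (\<Sum>A\<in>#Z2. real (card V))"
        unfolding cross_number_sum_mset using at atom_cross_number_le by (intro sum_mset_mono) (auto simp: Z2_def)
      also have "\<dots> = real (size Z2 * card V)" by simp
      also have "\<dots> \<le> real (card V * N0 * card V)" using s2 by (intro of_nat_mono mult_right_mono) auto
      finally have "cross_number (\<Sum>\<^sub># Z2) \<le> real (card V * N0 * card V)" .
      moreover have "real (size Z2) \<le> real (card V * N0)" using s2 by (rule of_nat_mono)
      moreover have "real C = real (card V * N0 * card V) + real (card V * N0)" unfolding C_def by (simp add: algebra_simps)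
      ultimately show ?thesis unfolding Sj ZZ using k1 cross_number_nonneg[of "\<Sum>\<^sub># Z2"] by simp
    qed
    have "y j + M * 0 \<in> lengths (S j)" "y j + M * k j \<in> lengths (S j)" unfolding S(3) by blast+
    then obtain Z Z' where Z: "factors Z (S j)" "size Z = y j" "factors Z' (S j)" "size Z' = y j + M * k j"
      unfolding lengths_def by auto
    have "k j \<le> M * k j" using assms(1) by simp
    then have "size Z + (2 * C + 1) \<le> size Z'" using Z j(1) S(2)[of j] by linarith
    then have "real (size Z + (2 * C + 1)) \<le> real (size Z')" by (simp only: of_nat_le_iff)
    then have "real (size Z) + (2 * real C + 1) \<le> real (size Z')" by simp
    then show False using bound[OF Z(1)] bound[OF Z(3)] by linarith
  qed
  ultimately show ?thesis using YV by blast
qed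

end

section \<open>Invariant factors\<close>

primrec lin :: "('a, 'b) monoid_scheme \<Rightarrow> (nat \<Rightarrow> 'a) \<Rightarrow> nat \<Rightarrow> (nat \<Rightarrow> int) \<Rightarrow> 'a" where
  "lin G e 0 x = \<one>\<^bsub>G\<^esub>"
| "lin G e (Suc r) x = lin G e r x \<otimes>\<^bsub>G\<^esub> (e r [^]\<^bsub>G\<^esub> x r)"

text \<open>Integer coefficients make \<open>lin\<close> a homomorphism on all integer vectors, and
  the condition describes its kernel: the \<open>e i\<close> have orders \<open>ns ! i\<close> and
  generate a direct sum.\<close>

definition independent :: "('a, 'b) monoid_scheme \<Rightarrow> (nat \<Rightarrow> 'a) \<Rightarrow> nat list \<Rightarrow> bool" where
  "independent G e ns \<longleftrightarrow> (\<forall>i<length ns. e i \<in> carrier G) \<and>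
     (\<forall>x. lin G e (length ns) x = \<one>\<^bsub>G\<^esub> \<longleftrightarrow> (\<forall>i<length ns. int (ns ! i) dvd x i))"

lemma lin_cong: "(\<And>i. i < r \<Longrightarrow> e i = e' i \<and> x i = x' i) \<Longrightarrow> lin G e r x = lin G e' r x'"
  by (induction r) auto

context comm_group begin

lemma lin_closed: "(\<And>i. i < r \<Longrightarrow> e i \<in> carrier G) \<Longrightarrow> lin G e r x \<in> carrier G"
  by (induction r) auto

lemma lin_add: "(\<And>i. i < r \<Longrightarrow> e i \<in> carrier G) \<Longrightarrow> lin G e r (\<lambda>i. x i + y i) = lin G e r x \<otimes> lin G e r y"
proof (induction r)
  case (Suc r)
  have c: "e r \<in> carrier G" "lin G e r x \<in> carrier G" "lin G e r y \<in> carrier G"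
    using Suc.prems lin_closed by auto
  have "lin G e (Suc r) (\<lambda>i. x i + y i) = (lin G e r x \<otimes> lin G e r y) \<otimes> (e r [^] x r \<otimes> e r [^] y r)"
    using Suc c by (simp add: int_pow_mult)
  also have "\<dots> = (lin G e r x \<otimes> e r [^] x r) \<otimes> (lin G e r y \<otimes> e r [^] y r)"
    using c by (simp add: m_ac)
  finally show ?case by simp
qed simp

lemma lin_zero: "(\<And>i. i < r \<Longrightarrow> x i = 0) \<Longrightarrow> lin G e r x = \<one>"
  by (induction r) auto

lemma lin_neg: assumes "\<And>i. i < r \<Longrightarrow> e i \<in> carrier G" shows "lin G e r (\<lambda>i. - x i) = inv (lin G e r x)"
proof -
  have "lin G e r (\<lambda>i. - x i) \<otimes> lin G e r x = lin G e r (\<lambda>i. - x i + x i)"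
    using lin_add[OF assms, where x = "\<lambda>i. - x i" and y = x] by simp
  also have "\<dots> = \<one>" by (rule lin_zero) simp
  finally show ?thesis using inv_equality lin_closed assms by metis
qed

lemma lin_delta: "(\<And>i. i < r \<Longrightarrow> e i \<in> carrier G) \<Longrightarrow> j < r \<Longrightarrow> lin G e r (\<lambda>i. if i = j then z else 0) = e j [^] z"
proof (induction r)
  case (Suc r)
  show ?case
  proof (cases "j = r")
    case True
    have "lin G e r (\<lambda>i. if i = j then z else 0) = \<one>" by (rule lin_zero) (use True in auto)
    then show ?thesis using True Suc.prems by simp
  next
    case False
    then have "j < r" using Suc.prems by simp
    then show ?thesis using Suc False by simp
  qed
qed simp

lemma lin_eq_iff:
  assumes "independent G e ns"
  shows "lin G e (length ns) x = lin G e (length ns) y \<longleftrightarrow> (\<forall>i<length ns. int (ns ! i) dvd x i - y i)"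
proof -
  have e: "\<And>i. i < length ns \<Longrightarrow> e i \<in> carrier G" using assms by (auto simp: independent_def)
  have 1: "lin G e (length ns) (\<lambda>i. x i - y i) = lin G e (length ns) x \<otimes> inv (lin G e (length ns) y)"
    using lin_add[OF e, where x = x and y = "\<lambda>i. - y i"] lin_neg[OF e, where x = y] by simp
  have "lin G e (length ns) x = lin G e (length ns) y \<longleftrightarrow> lin G e (length ns) (\<lambda>i. x i - y i) = \<one>"
  proof
    have c: "lin G e (length ns) x \<in> carrier G" "lin G e (length ns) y \<in> carrier G" using lin_closed[OF e] by auto
    show "lin G e (length ns) (\<lambda>i. x i - y i) = \<one>" if "lin G e (length ns) x = lin G e (length ns) y"
      unfolding 1 that using c by simp
    assume "lin G e (length ns) (\<lambda>i. x i - y i) = \<one>"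
    then show "lin G e (length ns) x = lin G e (length ns) y"
      unfolding 1 using inv_equality[of "lin G e (length ns) x" "inv lin G e (length ns) y"] c by simp
  qed
  then show ?thesis using assms by (simp add: independent_def)
qed

end

section \<open>Independent families and embeddings of sums of cyclic groups\<close>

lemma group_cyclic_sum: "group (cyclic_sum ns)"
  unfolding cyclic_sum_def by simp

lemma carrier_cyclic_sum:
  assumes "\<forall>n\<in>set ns. 0 < n"
  shows "carrier (cyclic_sum ns) = (\<Pi>\<^sub>E i\<in>{..<length ns}. {0..<int (ns ! i)})"
proof -
  have "ns ! i \<noteq> 0" if "i < length ns" for i using assms nth_mem[OF that] by force
  then have "carrier (integer_mod_group (ns ! i)) = {0..<int (ns ! i)}" if "i \<in> {..<length ns}" for i
    using that by (simp add: carrier_integer_mod_group)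
  then show ?thesis unfolding cyclic_sum_def carrier_product_group by (rule PiE_cong)
qed

lemma mult_cyclic_sum: "x \<otimes>\<^bsub>cyclic_sum ns\<^esub> y = (\<lambda>i\<in>{..<length ns}. (x i + y i) mod int (ns ! i))"
  unfolding cyclic_sum_def by simp

lemma one_cyclic_sum: "\<one>\<^bsub>cyclic_sum ns\<^esub> = (\<lambda>i\<in>{..<length ns}. 0)"
  unfolding cyclic_sum_def by simp

lemma (in comm_group) independent_imp_iso:
  assumes ind: "independent G e ns" and pos: "\<forall>n\<in>set ns. 0 < n"
  shows "subgroup (range (lin G e (length ns))) G"
    "lin G e (length ns) \<in> iso (cyclic_sum ns) (G\<lparr>carrier := range (lin G e (length ns))\<rparr>)"
proof -
  let ?L = "lin G e (length ns)"
  have e: "\<And>i. i < length ns \<Longrightarrow> e i \<in> carrier G" using ind by (auto simp: independent_def)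
  show "subgroup (range ?L) G"
  proof (rule subgroupI)
    show "range ?L \<subseteq> carrier G" using lin_closed e by auto
    show "inv a \<in> range ?L" if "a \<in> range ?L" for a
    proof -
      obtain x where "a = ?L x" using \<open>a \<in> range ?L\<close> by blast
      then have "inv a = ?L (\<lambda>i. - x i)" using lin_neg[OF e] by simp
      then show ?thesis by blast
    qed
    show "a \<otimes> b \<in> range ?L" if "a \<in> range ?L" "b \<in> range ?L" for a b
    proof -
      obtain x y where "a = ?L x" "b = ?L y" using \<open>a \<in> range ?L\<close> \<open>b \<in> range ?L\<close> by blast
      then have "a \<otimes> b = ?L (\<lambda>i. x i + y i)" using lin_add[OF e] by simp
      then show ?thesis by blast
    qed
  qed auto
  have nz: "ns ! i > 0" if "i < length ns" for i using pos that by auto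
  have md: "?L (\<lambda>i\<in>{..<length ns}. x i mod int (ns ! i)) = ?L x" for x
    unfolding lin_eq_iff[OF ind] by (auto simp: mod_eq_dvd_iff[symmetric])
  show "?L \<in> iso (cyclic_sum ns) (G\<lparr>carrier := range ?L\<rparr>)"
  proof (rule isoI)
    show "?L \<in> hom (cyclic_sum ns) (G\<lparr>carrier := range ?L\<rparr>)"
      by (rule homI) (auto simp: mult_cyclic_sum md lin_add[OF e])
    show "bij_betw ?L (carrier (cyclic_sum ns)) (carrier (G\<lparr>carrier := range ?L\<rparr>))"
      unfolding bij_betw_def
    proof
      show "inj_on ?L (carrier (cyclic_sum ns))"
      proof (rule inj_onI)
        fix x y assume x: "x \<in> carrier (cyclic_sum ns)" and y: "y \<in> carrier (cyclic_sum ns)" and "?L x = ?L y"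
        then have d: "int (ns ! i) dvd x i - y i" if "i < length ns" for i using lin_eq_iff[OF ind] that by blast
        show "x = y"
        proof (rule PiE_ext[OF x[unfolded carrier_cyclic_sum[OF pos]] y[unfolded carrier_cyclic_sum[OF pos]]])
          fix i assume "i \<in> {..<length ns}"
          then have "x i \<in> {0..<int (ns ! i)}" "y i \<in> {0..<int (ns ! i)}" "int (ns ! i) dvd x i - y i"
            using x y d carrier_cyclic_sum[OF pos] by auto
          then show "x i = y i" by (metis atLeastLessThan_iff mod_eq_dvd_iff mod_pos_pos_trivial)
        qed
      qed
      show "?L ` carrier (cyclic_sum ns) = carrier (G\<lparr>carrier := range ?L\<rparr>)"
      proof -
        have "?L x \<in> ?L ` carrier (cyclic_sum ns)" for x
        proof
          show "?L x = ?L (\<lambda>i\<in>{..<length ns}. x i mod int (ns ! i))" using md by simp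
          show "(\<lambda>i\<in>{..<length ns}. x i mod int (ns ! i)) \<in> carrier (cyclic_sum ns)"
            unfolding carrier_cyclic_sum[OF pos] using nz by auto
        qed
        then show ?thesis by auto
      qed
    qed
  qed
qed

text \<open>Composed with reduction modulo the \<open>ns ! i\<close>, \<open>\<psi>\<close> becomes
  a homomorphism on integer vectors, and \<open>e j\<close> is the image of the \<open>j\<close>-th
  unit vector.\<close>

lemma (in comm_group) iso_imp_independent:
  assumes sub: "subgroup H G" and psi: "\<psi> \<in> iso (cyclic_sum ns) (G\<lparr>carrier := H\<rparr>)"
    and pos: "\<forall>n\<in>set ns. 0 < n"
  shows "\<exists>e. independent G e ns \<and> range (lin G e (length ns)) = H"
proof -
  let ?r = "length ns"
  define red where "red x = (\<lambda>i\<in>{..<?r}. x i mod int (ns ! i))" for x :: "nat \<Rightarrow> int"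
  have nz: "ns ! i > 0" if "i < ?r" for i using pos that by auto
  have redc: "red x \<in> carrier (cyclic_sum ns)" for x
    unfolding carrier_cyclic_sum[OF pos] red_def using nz by auto
  have redid: "red x = x" if "x \<in> carrier (cyclic_sum ns)" for x
  proof (rule PiE_ext)
    show "red x \<in> (\<Pi>\<^sub>E i\<in>{..<?r}. {0..<int (ns ! i)})" using redc[of x] unfolding carrier_cyclic_sum[OF pos] .
    show x: "x \<in> (\<Pi>\<^sub>E i\<in>{..<?r}. {0..<int (ns ! i)})" using that unfolding carrier_cyclic_sum[OF pos] .
    show "red x i = x i" if "i \<in> {..<?r}" for i
    proof -
      have "x i \<in> {0..<int (ns ! i)}" using x that by blast
      then show ?thesis using that by (simp add: red_def)
    qed
  qed
  have hom: "\<psi> \<in> hom (cyclic_sum ns) (G\<lparr>carrier := H\<rparr>)" and bij: "bij_betw \<psi> (carrier (cyclic_sum ns)) H"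
    using psi by (auto simp: iso_def)
  define h where "h x = \<psi> (red x)" for x
  have HG: "H \<subseteq> carrier G" using sub subgroup.subset by blast
  have hH: "h x \<in> H" for x using hom redc unfolding h_def hom_def by auto
  then have hG: "h x \<in> carrier G" for x using HG by auto
  have hadd: "h (\<lambda>i. x i + y i) = h x \<otimes> h y" for x y
  proof -
    have "red (\<lambda>i. x i + y i) = red x \<otimes>\<^bsub>cyclic_sum ns\<^esub> red y"
      unfolding red_def mult_cyclic_sum by (auto simp: mod_add_eq)
    then show ?thesis using hom redc unfolding h_def hom_def by auto
  qed
  have h0: "h (\<lambda>i. 0) = \<one>"
  proof -
    have "h (\<lambda>i. 0) = h (\<lambda>i. 0) \<otimes> h (\<lambda>i. 0)" using hadd[of "\<lambda>i. 0" "\<lambda>i. 0"] by simp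
    then show ?thesis using r_cancel_one'[OF hG hG] by simp
  qed
  define e where "e j = h (\<lambda>i. if i = j then 1 else 0)" for j
  have eG: "e j \<in> carrier G" for j using hG by (simp add: e_def)
  have hdelta: "h (\<lambda>i. if i = j then z else 0) = e j [^] z" for j z
  proof -
    have "(\<lambda>z. h (\<lambda>i. if i = j then z else 0)) \<in> hom integer_group G"
    proof (rule homI)
      fix a b :: int
      have eq: "(\<lambda>i. if i = j then a + b else 0) = (\<lambda>i. (if i = j then a else 0) + (if i = j then b else 0))" by auto
      then show "h (\<lambda>i. if i = j then a \<otimes>\<^bsub>integer_group\<^esub> b else 0) =
        h (\<lambda>i. if i = j then a else 0) \<otimes> h (\<lambda>i. if i = j then b else 0)"
        by (simp only: mult_integer_group eq hadd)
    qed (use hG in auto)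
    from hom_int_pow[OF this, of 1 z] show ?thesis
      unfolding e_def group_int_pow_integer_group mult_1_right by simp
  qed
  have part: "h (\<lambda>i. if i < s then x i else 0) = lin G e s x" for s x
  proof (induction s)
    case 0 then show ?case using h0 by simp
  next
    case (Suc s)
    have "(\<lambda>i. if i < Suc s then x i else 0) = (\<lambda>i. (if i < s then x i else 0) + (if i = s then x s else 0))"
      by (auto simp: less_Suc_eq)
    then show ?case using hadd Suc hdelta by simp
  qed
  have hlin: "h x = lin G e ?r x" for x
  proof -
    have "red x = red (\<lambda>i. if i < ?r then x i else 0)" by (auto simp: red_def)
    then have "h x = h (\<lambda>i. if i < ?r then x i else 0)" by (simp add: h_def)
    then show ?thesis using part by simp
  qed
  have "h x = \<one> \<longleftrightarrow> (\<forall>i<?r. int (ns ! i) dvd x i)" for x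
  proof -
    have "h x = \<one> \<longleftrightarrow> \<psi> (red x) = \<psi> (red (\<lambda>i. 0))" using h0 by (simp add: h_def)
    also have "\<dots> \<longleftrightarrow> red x = red (\<lambda>i. 0)" using inj_on_eq_iff[OF bij_betw_imp_inj_on[OF bij] redc redc] by simp
    also have "\<dots> \<longleftrightarrow> (\<forall>i<?r. int (ns ! i) dvd x i)"
      unfolding red_def by (auto simp: fun_eq_iff restrict_def dvd_eq_mod_eq_0)
    finally show ?thesis .
  qed
  then have "independent G e ns" unfolding independent_def using eG hlin by auto
  moreover have "range (lin G e ?r) = H"
  proof
    show "range (lin G e ?r) \<subseteq> H" using hH hlin by auto
    show "H \<subseteq> range (lin G e ?r)"
    proof
      fix a assume "a \<in> H"
      then obtain x where "x \<in> carrier (cyclic_sum ns)" "a = \<psi> x" using bij unfolding bij_betw_def by auto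
      then have "a = h x" using redid by (simp add: h_def)
      then show "a \<in> range (lin G e ?r)" using hlin by auto
    qed
  qed
  ultimately show ?thesis by blast
qed

lemma (in comm_group) independent_of_has_subgroup_iso:
  assumes "has_subgroup_iso G (cyclic_sum ns)" "\<forall>n\<in>set ns. 0 < n"
  shows "\<exists>e. independent G e ns"
proof -
  obtain H where H: "subgroup H G" "G\<lparr>carrier := H\<rparr> \<cong> cyclic_sum ns" using assms(1) by (auto simp: has_subgroup_iso_def)
  have "group (G\<lparr>carrier := H\<rparr>)" using H(1) subgroup_imp_group by blast
  then have "cyclic_sum ns \<cong> G\<lparr>carrier := H\<rparr>" using H(2) group.iso_sym by blast
  then obtain \<psi> where "\<psi> \<in> iso (cyclic_sum ns) (G\<lparr>carrier := H\<rparr>)" by (auto simp: is_iso_def)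
  then show ?thesis using iso_imp_independent[OF H(1)] assms(2) by blast
qed

lemma (in comm_group) has_subgroup_iso_of_independent:
  assumes "independent G e ns" "\<forall>n\<in>set ns. 0 < n"
  shows "has_subgroup_iso G (cyclic_sum ns)"
  using independent_imp_iso(1)[OF assms] group.iso_sym[OF group_cyclic_sum is_isoI[OF independent_imp_iso(2)[OF assms]]]
  unfolding has_subgroup_iso_def by blast

section \<open>Existence of invariant factors\<close>

context comm_group begin

lemma subgroup_adjoin:
  assumes H: "subgroup H G" and x: "x \<in> carrier G"
  shows "subgroup {x [^] z \<otimes> h |z h. (z::int) \<in> UNIV \<and> h \<in> H} G"
proof (rule subgroupI)
  have HG: "h \<in> carrier G" if "h \<in> H" for h using subgroup.subset[OF H] that by auto
  show "{x [^] z \<otimes> h |z h. (z::int) \<in> UNIV \<and> h \<in> H} \<subseteq> carrier G" using x HG by auto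
  show "{x [^] z \<otimes> h |z h. (z::int) \<in> UNIV \<and> h \<in> H} \<noteq> {}" using subgroup.one_closed[OF H] by auto
  fix a assume "a \<in> {x [^] z \<otimes> h |z h. (z::int) \<in> UNIV \<and> h \<in> H}"
  then obtain z h where a: "a = x [^] (z::int) \<otimes> h" "h \<in> H" by auto
  have "inv a = x [^] (- z) \<otimes> inv h" using a x HG by (simp add: int_pow_neg inv_mult)
  then show "inv a \<in> {x [^] z \<otimes> h |z h. (z::int) \<in> UNIV \<and> h \<in> H}"
    using subgroup.m_inv_closed[OF H a(2)] by blast
  fix b assume "b \<in> {x [^] z \<otimes> h |z h. (z::int) \<in> UNIV \<and> h \<in> H}"
  then obtain z' h' where b: "b = x [^] (z'::int) \<otimes> h'" "h' \<in> H" by auto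
  have "a \<otimes> b = x [^] (z + z') \<otimes> (h \<otimes> h')"
    using a b x HG by (simp add: int_pow_mult m_ac)
  then show "a \<otimes> b \<in> {x [^] z \<otimes> h |z h. (z::int) \<in> UNIV \<and> h \<in> H}"
    using subgroup.m_closed[OF H a(2) b(2)] by blast
qed

lemma coprime_powers_mem:
  assumes K: "subgroup K G" and x: "x \<in> carrier G" and "x [^] (a::int) \<in> K" "x [^] (b::int) \<in> K" "coprime a b"
  shows "x \<in> K"
proof -
  obtain u v where uv: "u * a + v * b = 1" using bezout_int[of a b] assms(5) by (auto simp: coprime_iff_gcd_eq_1)
  have "x = x [^] (a * u + b * v)" using uv x by (simp add: mult.commute)
  also have "\<dots> = (x [^] a) [^] u \<otimes> (x [^] b) [^] v" using x by (simp add: int_pow_mult int_pow_pow)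
  also have "\<dots> \<in> K"
    using subgroup.m_closed[OF K subgroup_int_pow_closed[OF K assms(3)] subgroup_int_pow_closed[OF K assms(4)]] .
  finally show ?thesis .
qed

lemma ord_mult_coprime:
  assumes "x \<in> carrier G" "y \<in> carrier G" "coprime (ord x) (ord y)"
  shows "ord x * ord y dvd ord (x \<otimes> y)"
proof -
  have aux: "ord a dvd ord (a \<otimes> b)" if ab: "a \<in> carrier G" "b \<in> carrier G" "coprime (ord a) (ord b)" for a b
  proof -
    let ?o = "ord (a \<otimes> b) * ord b"
    have "(a \<otimes> b) [^] ?o = \<one>" using ab by (simp add: pow_eq_id)
    moreover have "(a \<otimes> b) [^] ?o = a [^] ?o \<otimes> b [^] ?o" using ab by (simp add: pow_mult_distrib m_comm)
    moreover have "b [^] ?o = \<one>" using ab by (simp add: pow_eq_id)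
    ultimately have "a [^] ?o = \<one>" using ab by simp
    then have "ord a dvd ord (a \<otimes> b) * ord b" using ab by (simp add: pow_eq_id)
    then show ?thesis using ab(3) by (simp add: coprime_dvd_mult_left_iff)
  qed
  have "ord x dvd ord (x \<otimes> y)" using aux assms by blast
  moreover have "ord y dvd ord (x \<otimes> y)" using aux[of y x] assms by (simp add: m_comm coprime_commute)
  ultimately show ?thesis using assms(3) by (simp add: divides_mult)
qed

text \<open>An element \<open>e\<close> of largest order works: if a prime \<open>p\<close> had a
  higher power in \<open>ord x\<close> than in \<open>ord e\<close>, then the product of the
  \<open>p\<close>-part of \<open>x\<close> and the prime-to-\<open>p\<close> part of
  \<open>e\<close> would have larger order.\<close>

lemma exists_exponent_element:
  assumes fin: "finite (carrier G)"
  shows "\<exists>e\<in>carrier G. \<forall>x\<in>carrier G. ord x dvd ord e"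
proof -
  have ne: "ord ` carrier G \<noteq> {}" by auto
  obtain e where e: "e \<in> carrier G" "ord e = Max (ord ` carrier G)"
    using Max_in[OF _ ne] fin by auto
  have mx: "ord x \<le> ord e" if "x \<in> carrier G" for x using e fin that by auto
  have o0: "ord x > 0" if "x \<in> carrier G" for x using ord_ge_1[OF fin that] by simp
  have "ord x dvd ord e" if x: "x \<in> carrier G" for x
  proof (rule multiplicity_le_imp_dvd)
    show "ord x \<noteq> 0" using o0[OF x] by simp
    fix p :: nat assume p: "Factorial_Ring.prime p"
    let ?a = "multiplicity p (ord x)" and ?b = "multiplicity p (ord e)"
    obtain u where u: "ord x = p ^ ?a * u" using multiplicity_dvd by blast
    obtain v where v: "ord e = p ^ ?b * v" "\<not> p dvd v"
      using multiplicity_decompose'[of "ord e" p] o0[OF e(1)] p by (metis not_prime_unit neq0_conv)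
    have u0: "u > 0" and v0: "v > 0" using u v o0[OF x] o0[OF e(1)] by (auto intro: gr0I)
    have p0: "p > 0" using p prime_gt_0_nat by blast
    have ox: "ord (x [^] u) = p ^ ?a"
      using ord_pow[OF x, of u] u u0 by (metis dvd_triv_right neq0_conv nonzero_mult_div_cancel_right)
    have oe: "ord (e [^] (p ^ ?b)) = v"
      using ord_pow[OF e(1), of "p ^ ?b"] v(1) p0 by (metis dvd_triv_left less_numeral_extra(3) nonzero_mult_div_cancel_left power_eq_0_iff)
    have "coprime (p ^ ?a) v" using p v(2) by (simp add: prime_imp_coprime_nat coprime_power_left_iff prime_imp_coprime)
    then have "p ^ ?a * v dvd ord (x [^] u \<otimes> e [^] (p ^ ?b))"
      using ord_mult_coprime[of "x [^] u" "e [^] (p ^ ?b)"] x e(1) ox oe by simp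
    then have "p ^ ?a * v \<le> ord (x [^] u \<otimes> e [^] (p ^ ?b))" using o0 x e(1) by (intro dvd_imp_le) auto
    also have "\<dots> \<le> p ^ ?b * v" using mx x e(1) v(1) by simp
    finally have "p ^ ?a \<le> p ^ ?b" using v0 by simp
    then show "?a \<le> ?b" using p prime_gt_1_nat power_le_imp_le_exp by blast
  qed
  then show ?thesis using e(1) by blast
qed

text \<open>Take \<open>H\<close> maximal among the subgroups that meet the powers of
  \<open>e\<close> trivially, and let \<open>K\<close> be generated by \<open>H\<close> and
  \<open>e\<close>. An element outside \<open>K\<close> yields \<open>x1\<close> outside
  \<open>K\<close> with a \<open>p\<close>-th power in \<open>K\<close>. Corrected by a power of
  \<open>e\<close>, it becomes \<open>x2\<close> outside \<open>K\<close> with \<open>p\<close>-th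
  power already in \<open>H\<close>, and adjoining \<open>x2\<close> to \<open>H\<close> contradicts
  maximality.\<close>

lemma exists_complement:
  assumes fin: "finite (carrier G)" and e: "e \<in> carrier G" and mx: "\<And>x. x \<in> carrier G \<Longrightarrow> ord x dvd ord e"
  shows "\<exists>H. subgroup H G \<and> (\<forall>z::int. e [^] z \<in> H \<longrightarrow> e [^] z = \<one>) \<and>
    (\<forall>x\<in>carrier G. \<exists>(z::int) h. h \<in> H \<and> x = e [^] z \<otimes> h)"
proof -
  define Q where "Q H \<longleftrightarrow> subgroup H G \<and> (\<forall>z::int. e [^] z \<in> H \<longrightarrow> e [^] z = \<one>)" for H
  have "finite (Collect Q)"
    by (rule finite_subset[of _ "Pow (carrier G)"]) (use fin in \<open>auto simp: Q_def dest: subgroup.subset[THEN subsetD]\<close>)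
  moreover have "Q {\<one>}" unfolding Q_def using triv_subgroup by auto
  ultimately obtain H where H: "Q H" and max: "\<And>H'. Q H' \<Longrightarrow> H \<subseteq> H' \<Longrightarrow> H = H'"
    using finite_has_maximal[of "Collect Q"] by blast
  have sH: "subgroup H G" and int: "\<And>z::int. e [^] z \<in> H \<Longrightarrow> e [^] z = \<one>" using H by (auto simp: Q_def)
  have HG: "h \<in> carrier G" if "h \<in> H" for h using subgroup.subset[OF sH] that by auto
  define K where "K = {e [^] z \<otimes> h |z h. (z::int) \<in> UNIV \<and> h \<in> H}"
  have sK: "subgroup K G" unfolding K_def by (rule subgroup_adjoin[OF sH e])
  have HK: "h \<in> K" if "h \<in> H" for h
    unfolding K_def using that HG[OF that] by (intro CollectI exI[of _ "0::int"] exI[of _ h]) simp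
  have eK: "e [^] (z::int) \<in> K" for z
    unfolding K_def using e subgroup.one_closed[OF sH] by (intro CollectI exI[of _ z] exI[of _ \<one>]) simp
  let ?n = "ord e"
  have xn: "x [^] int ?n = \<one>" if "x \<in> carrier G" for x using mx[OF that] that by (simp add: int_pow_eq_id)
  have "x \<in> K" if x: "x \<in> carrier G" for x
  proof (rule ccontr)
    assume "x \<notin> K"
    have "ord x > 0 \<and> x [^] int (ord x) \<in> K"
    proof -
      have "x [^] int (ord x) = \<one>" using int_pow_eq_id[OF x, of "int (ord x)"] by simp
      then show ?thesis using ord_ge_1[OF fin x] subgroup.one_closed[OF sK] by simp
    qed
    then obtain q where q: "q > 0 \<and> x [^] int q \<in> K" and qmin: "\<And>c. c < q \<Longrightarrow> \<not> (c > 0 \<and> x [^] int c \<in> K)"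
      using exists_least_iff[of "\<lambda>q. q > 0 \<and> x [^] int q \<in> K"] by blast
    have "q \<noteq> 1" using q \<open>x \<notin> K\<close> x by auto
    then obtain p where p: "Factorial_Ring.prime p" "p dvd q" using prime_factor_nat by blast
    obtain c where c: "q = p * c" using p(2) by auto
    have p1: "p > 1" using p(1) prime_gt_1_nat by blast
    have c0: "c > 0" using q c by (auto intro: gr0I)
    define x1 where "x1 = x [^] int c"
    have x1: "x1 \<in> carrier G" using x by (simp add: x1_def)
    have "c < q" using c c0 p1 by simp
    then have x1K: "x1 \<notin> K" using qmin c0 by (auto simp: x1_def)
    have x1p: "x1 [^] int p \<in> K" using q x unfolding x1_def c by (simp add: int_pow_pow mult.commute)
    have pp: "Factorial_Ring.prime (int p)" using p(1) by simp
    have pn: "int p dvd int ?n"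
    proof (rule ccontr)
      assume "\<not> ?thesis"
      then have "coprime (int p) (int ?n)" using pp by (simp add: prime_imp_coprime)
      moreover have "x1 [^] int ?n \<in> K" using xn[OF x1] subgroup.one_closed[OF sK] by simp
      ultimately show False using coprime_powers_mem[OF sK x1 x1p] x1K by blast
    qed
    then obtain d where d: "int ?n = int p * d" unfolding dvd_def by blast
    obtain a h where ah: "x1 [^] int p = e [^] (a::int) \<otimes> h" "h \<in> H" using x1p unfolding K_def by blast
    have "\<one> = (x1 [^] int p) [^] d" using xn[OF x1] x1 unfolding int_pow_pow[OF x1] d by simp
    also have "\<dots> = e [^] (a * d) \<otimes> h [^] d"
      unfolding ah(1) using e HG[OF ah(2)] by (simp add: int_pow_mult_distrib m_comm int_pow_pow)
    finally have "\<one> = e [^] (a * d) \<otimes> h [^] d" .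
    then have "e [^] (a * d) = inv (h [^] d)" using e HG[OF ah(2)] by (metis int_pow_closed inv_equality)
    then have "e [^] (a * d) \<in> H" using sH ah(2) by (metis subgroup.m_inv_closed subgroup_int_pow_closed)
    then have "e [^] (a * d) = \<one>" by (rule int)
    \<comment> \<open>This uses that every order divides \<open>ord e = p * d\<close>: the
      \<open>d\<close>-th power of \<open>x1 ^ p\<close> is trivial, so \<open>e ^ (a * d)\<close>
      lies in \<open>H\<close>. The result is that \<open>p\<close> divides \<open>a\<close>, and
      \<open>x1\<close> can be corrected by a \<open>p\<close>-th root of
      \<open>e ^ a\<close>.\<close>
    then have "int p * d dvd a * d" using e d by (simp add: int_pow_eq_id)
    moreover have "d \<noteq> 0" using d ord_ge_1[OF fin e] by auto
    ultimately obtain b where b: "a = int p * b" by auto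
    define x2 where "x2 = e [^] (- b) \<otimes> x1"
    have x2: "x2 \<in> carrier G" using e x1 by (simp add: x2_def)
    have "x2 [^] int p = e [^] (- b * int p) \<otimes> (e [^] a \<otimes> h)"
      unfolding x2_def ah(1)[symmetric] using e x1 by (simp add: int_pow_mult_distrib m_comm int_pow_pow)
    also have "\<dots> = e [^] (- b * int p + a) \<otimes> h" using e HG[OF ah(2)] by (simp only: int_pow_mult m_assoc int_pow_closed)
    also have "\<dots> = h" using b e HG[OF ah(2)] by (simp add: mult.commute)
    finally have x2p: "x2 [^] int p \<in> H" using ah(2) by simp
    have "x1 = e [^] b \<otimes> x2" using e x1 unfolding x2_def by (simp add: int_pow_neg m_assoc[symmetric])
    then have x2K: "x2 \<notin> K" using x1K eK subgroup.m_closed[OF sK] by metis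
    define H' where "H' = {x2 [^] z \<otimes> h |z h. (z::int) \<in> UNIV \<and> h \<in> H}"
    have "Q H'" unfolding Q_def
    proof (intro conjI allI impI)
      show "subgroup H' G" unfolding H'_def by (rule subgroup_adjoin[OF sH x2])
      fix z :: int assume "e [^] z \<in> H'"
      then obtain j h' where jh: "e [^] z = x2 [^] (j::int) \<otimes> h'" "h' \<in> H" unfolding H'_def by blast
      have "x2 [^] j = e [^] z \<otimes> inv h'" unfolding jh(1) using x2 HG[OF jh(2)] by (simp add: m_assoc)
      then have x2j: "x2 [^] j \<in> K"
        using eK HK[OF subgroup.m_inv_closed[OF sH jh(2)]] subgroup.m_closed[OF sK] by metis
      have "int p dvd j"
      proof (rule ccontr)
        assume "\<not> ?thesis"
        then have "coprime (int p) j" using pp by (simp add: prime_imp_coprime)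
        then show False using coprime_powers_mem[OF sK x2 HK[OF x2p] x2j] x2K by blast
      qed
      then obtain i where i: "j = int p * i" by auto
      have "x2 [^] j = (x2 [^] int p) [^] i" using x2 by (simp add: i int_pow_pow)
      then have "x2 [^] j \<in> H" using subgroup_int_pow_closed[OF sH x2p] by simp
      then have "e [^] z \<in> H" unfolding jh(1) using subgroup.m_closed[OF sH] jh(2) by blast
      then show "e [^] z = \<one>" by (rule int)
    qed
    moreover have "H \<subseteq> H'"
    proof
      fix h assume "h \<in> H"
      then show "h \<in> H'" unfolding H'_def using HG by (intro CollectI exI[of _ "0::int"] exI[of _ h]) simp
    qed
    ultimately have "H = H'" by (rule max)
    moreover have "x2 \<in> H'"
      unfolding H'_def using x2 subgroup.one_closed[OF sH] by (intro CollectI exI[of _ "1::int"] exI[of _ \<one>]) simp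
    ultimately show False using HK x2K by blast
  qed
  then show ?thesis using sH int unfolding K_def by blast
qed

end

text \<open>The element whose order is the exponent is split off, and its order is appended to the
  list of the complement. Every entry of that list is the order of an element and so divides the new
  last entry, which continues the chain.\<close>

lemma (in comm_group) invariant_factors_step:
  assumes fin: "finite (carrier G)"
    and IH: "\<And>H. subgroup H G \<Longrightarrow> card H < card (carrier G) \<Longrightarrow>
      \<exists>ns. (\<forall>n\<in>set ns. 1 < n) \<and> sorted_wrt (dvd) ns \<and> G\<lparr>carrier := H\<rparr> \<cong> cyclic_sum ns"
  shows "\<exists>ns. (\<forall>n\<in>set ns. 1 < n) \<and> sorted_wrt (dvd) ns \<and> G \<cong> cyclic_sum ns"
proof -
  obtain e0 where e0: "e0 \<in> carrier G" "\<And>x. x \<in> carrier G \<Longrightarrow> ord x dvd ord e0"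
    using exists_exponent_element[OF fin] by blast
  let ?n = "ord e0"
  have n0: "?n > 0" using ord_ge_1[OF fin e0(1)] by simp
  have iso_all: "G \<cong> cyclic_sum ns" if ns: "independent G e ns" "range (lin G e (length ns)) = carrier G" "\<forall>n\<in>set ns. 1 < n" for e ns
  proof -
    have pos: "\<forall>n\<in>set ns. 0 < n" using ns(3) by force
    have "lin G e (length ns) \<in> iso (cyclic_sum ns) (G\<lparr>carrier := carrier G\<rparr>)"
      using independent_imp_iso(2)[OF ns(1) pos] unfolding ns(2) .
    then have "lin G e (length ns) \<in> iso (cyclic_sum ns) G" by (simp add: iso_def hom_def)
    then show ?thesis by (rule group.iso_sym[OF group_cyclic_sum is_isoI])
  qed
  show ?thesis
  proof (cases "?n = 1")
    case True
    have "x = \<one>" if "x \<in> carrier G" for x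
    proof -
      have "ord x dvd 1" using e0(2)[OF that] True by simp
      then show ?thesis using ord_eq_1[OF that] by simp
    qed
    then have "carrier G = {\<one>}" by auto
    then have "independent G (\<lambda>_. \<one>) []" "range (lin G (\<lambda>_. \<one>) 0) = carrier G"
      unfolding independent_def by (simp_all add: image_constant_conv)
    then have "G \<cong> cyclic_sum []" using iso_all[of "\<lambda>_. \<one>" "[]"] by simp
    then show ?thesis by (intro exI[of _ "[]"]) simp
  next
    case False
    obtain H where H: "subgroup H G" "\<And>z::int. e0 [^] z \<in> H \<Longrightarrow> e0 [^] z = \<one>"
      "\<And>x. x \<in> carrier G \<Longrightarrow> \<exists>(z::int) h. h \<in> H \<and> x = e0 [^] z \<otimes> h"
      using exists_complement[OF fin e0] by blast
    have HG: "H \<subseteq> carrier G" using H(1) subgroup.subset by blast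
    have "e0 \<notin> H"
    proof
      assume "e0 \<in> H"
      then have "e0 = \<one>" using H(2)[of 1] e0(1) by simp
      then show False using False by simp
    qed
    then have "H \<subset> carrier G" using HG e0(1) by blast
    then have lt: "card H < card (carrier G)" using fin by (simp add: psubset_card_mono)
    from IH[OF H(1) lt] obtain ms where ms: "\<forall>n\<in>set ms. 1 < n" "sorted_wrt (dvd) ms" "G\<lparr>carrier := H\<rparr> \<cong> cyclic_sum ms"
      by blast
    have mpos: "\<forall>n\<in>set ms. 0 < n" using ms(1) by force
    have "group (G\<lparr>carrier := H\<rparr>)" using H(1) subgroup_imp_group by blast
    then have "cyclic_sum ms \<cong> G\<lparr>carrier := H\<rparr>" using ms(3) by (rule group.iso_sym)
    then obtain \<psi> where "\<psi> \<in> iso (cyclic_sum ms) (G\<lparr>carrier := H\<rparr>)" by (auto simp: is_iso_def)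
    from iso_imp_independent[OF H(1) this mpos]
    obtain e where e: "independent G e ms" "range (lin G e (length ms)) = H" by blast
    let ?r = "length ms" and ?ns = "ms @ [?n]"
    define e' where "e' = e(?r := e0)"
    have eG: "\<And>i. i < ?r \<Longrightarrow> e i \<in> carrier G" using e(1) by (simp add: independent_def)
    have lin': "lin G e' (length ?ns) x = lin G e ?r x \<otimes> e0 [^] x ?r" for x
    proof -
      have "lin G e' ?r x = lin G e ?r x" by (rule lin_cong) (simp add: e'_def)
      then show ?thesis by (simp add: e'_def)
    qed
    have linH: "lin G e ?r x \<in> H" for x unfolding e(2)[symmetric] by (rule rangeI)
    have one: "lin G e' (length ?ns) x = \<one> \<longleftrightarrow> (\<forall>i<?r. int (ms ! i) dvd x i) \<and> int ?n dvd x ?r" for x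
    proof -
      have "lin G e' (length ?ns) x = \<one> \<longleftrightarrow> lin G e ?r x = \<one> \<and> e0 [^] x ?r = \<one>"
      proof
        assume "lin G e' (length ?ns) x = \<one>"
        then have 1: "lin G e ?r x \<otimes> e0 [^] x ?r = \<one>" unfolding lin' .
        then have "e0 [^] x ?r \<otimes> lin G e ?r x = \<one>" using lin_closed[OF eG] e0(1) by (simp add: m_comm)
        then have "e0 [^] x ?r = inv (lin G e ?r x)"
          using inv_equality[OF _ lin_closed[OF eG] int_pow_closed[OF e0(1)]] by simp
        then have "e0 [^] x ?r \<in> H" using subgroup.m_inv_closed[OF H(1) linH] by simp
        then have 2: "e0 [^] x ?r = \<one>" by (rule H(2))
        then have "lin G e ?r x = \<one>" using 1 lin_closed[OF eG] by simp
        then show "lin G e ?r x = \<one> \<and> e0 [^] x ?r = \<one>" using 2 by simp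
      next
        assume "lin G e ?r x = \<one> \<and> e0 [^] x ?r = \<one>"
        then show "lin G e' (length ?ns) x = \<one>" unfolding lin' by simp
      qed
      then show ?thesis using e(1) e0(1) by (simp add: independent_def int_pow_eq_id)
    qed
    have ind: "independent G e' ?ns" unfolding independent_def
    proof (intro conjI allI impI)
      fix i assume "i < length ?ns"
      then show "e' i \<in> carrier G" using eG e0(1) by (cases "i = ?r") (auto simp: e'_def)
    next
      fix x
      have "(\<forall>i<length ?ns. int (?ns ! i) dvd x i) \<longleftrightarrow> (\<forall>i<?r. int (ms ! i) dvd x i) \<and> int ?n dvd x ?r"
        by (auto simp: less_Suc_eq nth_append)
      then show "(lin G e' (length ?ns) x = \<one>) = (\<forall>i<length ?ns. int (?ns ! i) dvd x i)" unfolding one by (rule sym)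
    qed
    have rng: "range (lin G e' (length ?ns)) = carrier G"
    proof
      have "lin G e' (length ?ns) x \<in> carrier G" for x
        by (rule lin_closed) (use ind in \<open>simp add: independent_def\<close>)
      then show "range (lin G e' (length ?ns)) \<subseteq> carrier G" by blast
      show "carrier G \<subseteq> range (lin G e' (length ?ns))"
      proof
        fix x assume "x \<in> carrier G"
        then obtain z h where zh: "h \<in> H" "x = e0 [^] (z::int) \<otimes> h" using H(3) by blast
        have "h \<in> range (lin G e ?r)" unfolding e(2) by (rule zh(1))
        then obtain y where y: "h = lin G e ?r y" by (rule imageE)
        have "lin G e ?r (y(?r := z)) = lin G e ?r y" by (rule lin_cong) simp
        then have "lin G e' (length ?ns) (y(?r := z)) = h \<otimes> e0 [^] z" unfolding lin' y by simp
        also have "\<dots> = x" using zh HG e0(1) by (auto simp: m_comm)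
        finally show "x \<in> range (lin G e' (length ?ns))" by blast
      qed
    qed
    have dv: "a dvd ?n" if a: "a \<in> set ms" for a
    proof -
      obtain i where i: "i < ?r" "ms ! i = a" using a by (auto simp: in_set_conv_nth)
      have "lin G e ?r (\<lambda>j. if j = i then int ?n else 0) = e i [^] int ?n" using lin_delta[OF eG i(1)] by simp
      also have "\<dots> = \<one>" using eG[OF i(1)] e0(2)[OF eG[OF i(1)]] by (simp add: int_pow_eq_id)
      finally have "\<forall>k<?r. int (ms ! k) dvd (if k = i then int ?n else 0)" 
        using e(1)[unfolded independent_def, THEN conjunct2, THEN spec, of "\<lambda>j. if j = i then int ?n else 0"] by (rule iffD1[rotated])
      then show ?thesis using i by auto
    qed
    have gt: "\<forall>n\<in>set ?ns. 1 < n" using ms(1) False n0 by auto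
    have "sorted_wrt (dvd) ?ns" using ms(2) dv by (simp add: sorted_wrt_append)
    then show ?thesis using iso_all[OF ind rng gt] gt by blast
  qed
qed

theorem invariant_factors_exist:
  fixes G :: "('a, 'b) monoid_scheme"
  assumes "comm_group G" "finite (carrier G)"
  shows "\<exists>ns. (\<forall>n\<in>set ns. 1 < n) \<and> sorted_wrt (dvd) ns \<and> G \<cong> cyclic_sum ns"
  using assms
proof (induction "card (carrier G)" arbitrary: G rule: less_induct)
  case (less G)
  interpret comm_group G by (rule less.prems)
  show ?case
  proof (rule invariant_factors_step[OF less.prems(2)])
    fix H assume H: "subgroup H G" "card H < card (carrier G)"
    have cg: "comm_group (G\<lparr>carrier := H\<rparr>)" 
    proof (rule group.group_comm_groupI)
      show "group (G\<lparr>carrier := H\<rparr>)" using H(1) subgroup_imp_group by blast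
      fix x y assume "x \<in> carrier (G\<lparr>carrier := H\<rparr>)" "y \<in> carrier (G\<lparr>carrier := H\<rparr>)"
      then have "x \<in> carrier G" "y \<in> carrier G" using subgroup.subset[OF H(1)] by auto
      then show "x \<otimes>\<^bsub>G\<lparr>carrier := H\<rparr>\<^esub> y = y \<otimes>\<^bsub>G\<lparr>carrier := H\<rparr>\<^esub> x" by (simp add: m_comm)
    qed
    have fin': "finite (carrier (G\<lparr>carrier := H\<rparr>))"
      using finite_subset[OF subgroup.subset[OF H(1)] less.prems(2)] by simp
    have "card (carrier (G\<lparr>carrier := H\<rparr>)) < card (carrier G)" using H(2) by simp
    from less.hyps[OF this cg fin']
    show "\<exists>ns. (\<forall>n\<in>set ns. 1 < n) \<and> sorted_wrt (dvd) ns \<and> G\<lparr>carrier := H\<rparr> \<cong> cyclic_sum ns" .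
  qed
qed

section \<open>Uniqueness of invariant factors\<close>

lemma pow_cyclic_sum:
  assumes "\<forall>n\<in>set ns. 0 < n" "x \<in> carrier (cyclic_sum ns)"
  shows "x [^]\<^bsub>cyclic_sum ns\<^esub> (d::nat) = (\<lambda>i\<in>{..<length ns}. (int d * x i) mod int (ns ! i))"
proof (induction d)
  case 0
  then show ?case by (simp add: one_cyclic_sum)
next
  case (Suc d)
  have "x [^]\<^bsub>cyclic_sum ns\<^esub> Suc d = (x [^]\<^bsub>cyclic_sum ns\<^esub> d) \<otimes>\<^bsub>cyclic_sum ns\<^esub> x" by simp
  also have "\<dots> = (\<lambda>i\<in>{..<length ns}. (int (Suc d) * x i) mod int (ns ! i))"
    unfolding Suc.IH mult_cyclic_sum
  proof (rule restrict_ext)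
    fix i assume i: "i \<in> {..<length ns}"
    have "(int d * x i mod int (ns ! i) + x i) mod int (ns ! i) = (int d * x i + x i) mod int (ns ! i)"
      by (rule mod_add_left_eq)
    also have "int d * x i + x i = int (Suc d) * x i" by (simp add: distrib_right)
    finally show "((\<lambda>i\<in>{..<length ns}. int d * x i mod int (ns ! i)) i + x i) mod int (ns ! i) = int (Suc d) * x i mod int (ns ! i)"
      using i by simp
  qed
  finally show ?case .
qed

text \<open>With \<open>g = gcd d n\<close> and \<open>n = g * n'\<close>, the solutions are the
  multiples of \<open>n'\<close> in the range.\<close>

lemma card_torsion_mod:
  assumes "n > 0"
  shows "card {a \<in> {0..<int n}. int n dvd int d * a} = gcd d n"
proof -
  define g where "g = gcd d n"
  have g0: "g > 0" using assms by (simp add: g_def)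
  obtain n' where n': "n = g * n'" unfolding g_def using gcd_dvd2[of d n] by (rule dvdE)
  obtain d' where d': "d = g * d'" unfolding g_def using gcd_dvd1[of d n] by (rule dvdE)
  have n'0: "n' > 0" using assms n' by (auto intro: gr0I)
  have "gcd d n = gcd (g * d') (g * n')" by (simp only: n'[symmetric] d'[symmetric])
  then have "g = gcd (g * d') (g * n')" by (simp only: g_def[symmetric])
  also have "\<dots> = g * gcd d' n'" by (simp add: gcd_mult_distrib_nat)
  finally have "gcd d' n' = 1" using g0 by simp
  then have cop: "coprime (int n') (int d')" by (simp add: coprime_iff_gcd_eq_1 gcd.commute)
  have iff: "int n dvd int d * a \<longleftrightarrow> int n' dvd a" for a
  proof -
    have "int n dvd int d * a \<longleftrightarrow> int g * int n' dvd int g * (int d' * a)" unfolding n' d' by (simp add: mult.assoc)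
    also have "\<dots> \<longleftrightarrow> int n' dvd int d' * a" using g0 by simp
    also have "\<dots> \<longleftrightarrow> int n' dvd a" using cop by (simp add: coprime_dvd_mult_right_iff)
    finally show ?thesis .
  qed
  have "{a \<in> {0..<int n}. int n dvd int d * a} = (\<lambda>k. int n' * int k) ` {..<g}"
  proof (intro equalityI subsetI)
    fix a assume a: "a \<in> {a \<in> {0..<int n}. int n dvd int d * a}"
    then obtain k where k: "a = int n' * k" using iff unfolding dvd_def by auto
    have "0 \<le> k" using a k n'0 by (simp add: zero_le_mult_iff)
    have "int n' * k < int n' * int g" using a k n' by (simp add: mult.commute)
    then have "k < int g" using n'0 by simp
    then show "a \<in> (\<lambda>k. int n' * int k) ` {..<g}" using k \<open>0 \<le> k\<close> by (intro image_eqI[of _ _ "nat k"]) auto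
  next
    fix a assume "a \<in> (\<lambda>k. int n' * int k) ` {..<g}"
    then obtain k where k: "a = int n' * int k" "k < g" by auto
    have "n' * k < n' * g" using k(2) n'0 by simp
    then have "int (n' * k) < int n" unfolding n' by (simp only: of_nat_less_iff mult.commute)
    then show "a \<in> {a \<in> {0..<int n}. int n dvd int d * a}" unfolding mem_Collect_eq iff using k(1) by simp
  qed
  moreover have "inj_on (\<lambda>k. int n' * int k) {..<g}" using n'0 by (intro inj_onI) simp
  ultimately show ?thesis by (simp add: card_image g_def)
qed

text \<open>These numbers are isomorphism invariants and determine the invariant factors, which
  makes the description in \<open>invariant_factors\<close> unique.\<close>

definition torsion_count :: "('a, 'b) monoid_scheme \<Rightarrow> nat \<Rightarrow> nat" where
  "torsion_count G d = card {x \<in> carrier G. x [^]\<^bsub>G\<^esub> d = \<one>\<^bsub>G\<^esub>}"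

lemma torsion_count_cyclic_sum:
  assumes "\<forall>n\<in>set ns. 0 < n"
  shows "torsion_count (cyclic_sum ns) d = prod_list (map (gcd d) ns)"
proof -
  let ?T = "\<lambda>i. {a \<in> {0..<int (ns ! i)}. int (ns ! i) dvd int d * a}"
  have "{x \<in> carrier (cyclic_sum ns). x [^]\<^bsub>cyclic_sum ns\<^esub> d = \<one>\<^bsub>cyclic_sum ns\<^esub>} = (\<Pi>\<^sub>E i\<in>{..<length ns}. ?T i)"
  proof -
    have "x [^]\<^bsub>cyclic_sum ns\<^esub> d = \<one>\<^bsub>cyclic_sum ns\<^esub> \<longleftrightarrow> (\<forall>i<length ns. int (ns ! i) dvd int d * x i)"
      if "x \<in> carrier (cyclic_sum ns)" for x
      unfolding pow_cyclic_sum[OF assms that] one_cyclic_sum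
      by (auto simp: fun_eq_iff restrict_def dvd_eq_mod_eq_0)
    then have eq: "x \<in> carrier (cyclic_sum ns) \<and> x [^]\<^bsub>cyclic_sum ns\<^esub> d = \<one>\<^bsub>cyclic_sum ns\<^esub> \<longleftrightarrow> x \<in> (\<Pi>\<^sub>E i\<in>{..<length ns}. ?T i)" for x
      unfolding carrier_cyclic_sum[OF assms] PiE_iff by blast
    show ?thesis by (rule Set.set_eqI, subst mem_Collect_eq, rule eq)
  qed
  then have "torsion_count (cyclic_sum ns) d = (\<Prod>i<length ns. card (?T i))"
    unfolding torsion_count_def by (simp only: card_PiE finite_lessThan)
  also have "\<dots> = (\<Prod>i<length ns. gcd d (ns ! i))"
    using assms by (intro prod.cong refl card_torsion_mod) auto
  also have "\<dots> = prod_list (map (gcd d) ns)"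
    by (simp add: prod.list_conv_set_nth lessThan_atLeast0)
  finally show ?thesis .
qed

lemma torsion_count_iso:
  assumes "G \<cong> H" "group G" "group H"
  shows "torsion_count G d = torsion_count H d"
proof -
  obtain f where f: "f \<in> iso G H" using assms(1) by (auto simp: is_iso_def)
  then have hom: "f \<in> hom G H" and bij: "bij_betw f (carrier G) (carrier H)" by (auto simp: iso_def)
  interpret group_hom G H f by (intro group_hom.intro group_hom_axioms.intro assms hom)
  have "x [^]\<^bsub>G\<^esub> d = \<one>\<^bsub>G\<^esub> \<longleftrightarrow> f x [^]\<^bsub>H\<^esub> d = \<one>\<^bsub>H\<^esub>" if "x \<in> carrier G" for x
  proof -
    have p: "f x [^]\<^bsub>H\<^esub> d = f (x [^]\<^bsub>G\<^esub> d)" using hom_nat_pow[OF that] by (rule sym)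
    have o: "\<one>\<^bsub>H\<^esub> = f \<one>\<^bsub>G\<^esub>" using hom_one by (rule sym)
    have "x [^]\<^bsub>G\<^esub> d \<in> carrier G" "\<one>\<^bsub>G\<^esub> \<in> carrier G" using that by auto
    from inj_on_eq_iff[OF bij_betw_imp_inj_on[OF bij] this] show ?thesis unfolding p o by (rule sym)
  qed
  note iff = this
  have "bij_betw f {x \<in> carrier G. x [^]\<^bsub>G\<^esub> d = \<one>\<^bsub>G\<^esub>} {x \<in> carrier H. x [^]\<^bsub>H\<^esub> d = \<one>\<^bsub>H\<^esub>}"
  proof (rule bij_betw_imageI)
    show "inj_on f {x \<in> carrier G. x [^]\<^bsub>G\<^esub> d = \<one>\<^bsub>G\<^esub>}"
      using bij_betw_imp_inj_on[OF bij] by (rule inj_on_subset) blast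
    have "y \<in> {x \<in> carrier H. x [^]\<^bsub>H\<^esub> d = \<one>\<^bsub>H\<^esub>}" if y: "y \<in> f ` {x \<in> carrier G. x [^]\<^bsub>G\<^esub> d = \<one>\<^bsub>G\<^esub>}" for y
    proof -
      obtain x where x: "x \<in> carrier G" "x [^]\<^bsub>G\<^esub> d = \<one>\<^bsub>G\<^esub>" "y = f x" using y by blast
      show ?thesis unfolding x(3) mem_Collect_eq
        using iffD1[OF iff[OF x(1)] x(2)] hom_closed[OF x(1)] by (intro conjI)
    qed
    moreover have "y \<in> f ` {x \<in> carrier G. x [^]\<^bsub>G\<^esub> d = \<one>\<^bsub>G\<^esub>}" if y: "y \<in> {x \<in> carrier H. x [^]\<^bsub>H\<^esub> d = \<one>\<^bsub>H\<^esub>}" for y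
    proof -
      have "y \<in> f ` carrier G" using y unfolding bij_betw_imp_surj_on[OF bij] by simp
      then obtain x where x: "x \<in> carrier G" "y = f x" by blast
      have "f x [^]\<^bsub>H\<^esub> d = \<one>\<^bsub>H\<^esub>" using y unfolding x(2) by blast
      then have "x [^]\<^bsub>G\<^esub> d = \<one>\<^bsub>G\<^esub>" by (rule iffD2[OF iff[OF x(1)]])
      then show ?thesis unfolding x(2) using x(1) by (intro imageI CollectI conjI)
    qed
    ultimately show "f ` {x \<in> carrier G. x [^]\<^bsub>G\<^esub> d = \<one>\<^bsub>G\<^esub>} = {x \<in> carrier H. x [^]\<^bsub>H\<^esub> d = \<one>\<^bsub>H\<^esub>}"
      by (intro Set.subset_antisym Set.subsetI)
  qed
  then show ?thesis unfolding torsion_count_def by (rule bij_betw_same_card)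
qed

text \<open>The last entries are compared first. For a common multiple \<open>d\<close> of all
  entries both products are the full products, which therefore agree. For \<open>d = n\<close> the
  product over \<open>ns\<close> is still full, hence so is the one over \<open>ms\<close>, and this
  forces the last entry of \<open>ms\<close> to divide \<open>n\<close>. By symmetry the last
  entries coincide; their common positive factor \<open>gcd d n\<close> cancels and shorter lists
  remain.\<close>

lemma chain_eq_of_gcd_products:
  fixes ns ms :: "nat list"
  assumes "\<forall>n\<in>set ns. 1 < n" "sorted_wrt (dvd) ns" "\<forall>n\<in>set ms. 1 < n" "sorted_wrt (dvd) ms"
    "\<And>d. prod_list (map (gcd d) ns) = prod_list (map (gcd d) ms)"
  shows "ns = ms"
  using assms
proof (induction ns arbitrary: ms rule: rev_induct)
  case Nil
  show ?case
  proof (cases ms rule: rev_cases)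
    case (snoc ys m)
    have "prod_list (map (gcd m) ms) = 1" using Nil.prems(5)[of m] by simp
    then have "m = 1" unfolding snoc by simp
    then show ?thesis using Nil.prems(3) snoc by auto
  qed auto
next
  case (snoc n xs)
  note P = snoc.prems
  show ?case
  proof (cases ms rule: rev_cases)
    case Nil
    have "n dvd prod_list (map (gcd n) (xs @ [n]))" by simp
    also have "\<dots> = 1" unfolding P(5)[of n] Nil by simp
    finally have "n = 1" by simp
    then show ?thesis using P(1) by auto
  next
    case (snoc ys m)
    have full: "prod_list (map (gcd d) zero_sum) = prod_list zero_sum" if "\<forall>z\<in>set zero_sum. z dvd d" for d and zero_sum :: "nat list"
    proof -
      have "map (gcd d) zero_sum = zero_sum" using that by (intro map_idI) (auto simp: gcd_nat.absorb2)
      then show ?thesis by simp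
    qed
    have dn: "\<forall>z\<in>set (xs @ [n]). z dvd n" using P(2) by (auto simp: sorted_wrt_append)
    have dm: "\<forall>z\<in>set (ys @ [m]). z dvd m" using P(4) unfolding snoc by (auto simp: sorted_wrt_append)
    have last_dvd: "a dvd b" if "prod_list (map (gcd b) (zero_sum @ [a])) = prod_list (zero_sum @ [a])" "\<forall>z\<in>set (zero_sum @ [a]). (0::nat) < z" for a b zero_sum
    proof (rule ccontr)
      assume "\<not> a dvd b"
      then have "gcd b a \<noteq> a" by (metis gcd_dvd1)
      moreover have "gcd b a \<le> a" using that(2) by (intro dvd_imp_le) auto
      ultimately have lt: "gcd b a < a" by simp
      have le: "prod_list (map (gcd b) zero_sum) \<le> prod_list zero_sum" using that(2)
      proof (induction zero_sum)
        case (Cons z zero_sum)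
        have "gcd b z \<le> z" using Cons.prems by (intro dvd_imp_le) auto
        then show ?case using Cons by (simp add: mult_le_mono)
      qed simp
      have pos: "prod_list zero_sum > 0" using that(2) by (induction zero_sum) auto
      have "prod_list (map (gcd b) zero_sum) * gcd b a \<le> prod_list zero_sum * gcd b a" using le by (rule mult_le_mono1)
      also have "\<dots> < prod_list zero_sum * a" using lt pos by simp
      finally show False using that(1) by simp
    qed
    have "prod_list (xs @ [n]) = prod_list (map (gcd (n * m)) (xs @ [n]))" by (rule full[symmetric]) (use dn in \<open>auto intro: dvd_mult2\<close>)
    also have "\<dots> = prod_list (map (gcd (n * m)) (ys @ [m]))" using P(5)[of "n * m"] unfolding snoc .
    also have "\<dots> = prod_list (ys @ [m])" by (rule full) (use dm in \<open>auto intro: dvd_mult\<close>)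
    finally have tot: "prod_list (xs @ [n]) = prod_list (ys @ [m])" .
    have "prod_list (map (gcd n) (ys @ [m])) = prod_list (ys @ [m])"
      by (rule trans[OF P(5)[of n, symmetric, unfolded snoc] trans[OF full[OF dn] tot]])
    then have 1: "m dvd n" by (rule last_dvd) (use P(3) in \<open>auto simp: snoc\<close>)
    have "prod_list (map (gcd m) (xs @ [n])) = prod_list (xs @ [n])"
      by (rule trans[OF P(5)[of m, unfolded snoc] trans[OF full[OF dm] tot[symmetric]]])
    then have "n dvd m" by (rule last_dvd) (use P(1) in \<open>auto simp: snoc\<close>)
    then have mn: "m = n" using 1 by (rule dvd_antisym[rotated])
    have n0: "n > 0" using P(1) by auto
    have "prod_list (map (gcd d) xs) = prod_list (map (gcd d) ys)" for d
    proof -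
      have "prod_list (map (gcd d) xs) * gcd d n = prod_list (map (gcd d) ys) * gcd d n"
        using P(5)[of d] unfolding snoc mn by simp
      then show ?thesis using n0 by simp
    qed
    then have "xs = ys" using P(1-4) unfolding snoc by (intro snoc.IH) (auto simp: sorted_wrt_append)
    then show ?thesis using mn snoc by simp
  qed
qed

lemma invariant_factors_eq:
  assumes "comm_group G" "\<forall>n\<in>set ns. 1 < n" "sorted_wrt (dvd) ns" "G \<cong> cyclic_sum ns"
  shows "invariant_factors G = ns"
  unfolding invariant_factors_def
proof (rule the_equality)
  show "(\<forall>n\<in>set ns. 1 < n) \<and> sorted_wrt (dvd) ns \<and> G \<cong> cyclic_sum ns" using assms by blast
  fix ms assume ms: "(\<forall>n\<in>set ms. 1 < n) \<and> sorted_wrt (dvd) ms \<and> G \<cong> cyclic_sum ms"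
  have gG: "group G" using assms(1) by (simp add: comm_group_def)
  show "ms = ns"
  proof (rule chain_eq_of_gcd_products)
    fix d
    have "torsion_count (cyclic_sum ms) d = torsion_count (cyclic_sum ns) d"
      using torsion_count_iso[OF assms(4) gG group_cyclic_sum, of d]
        torsion_count_iso[OF conjunct2[OF conjunct2[OF ms]] gG group_cyclic_sum, of d] by simp
    moreover have "\<forall>n\<in>set ns. 0 < n" "\<forall>n\<in>set ms. 0 < n" using assms(2) ms by force+
    ultimately show "prod_list (map (gcd d) ms) = prod_list (map (gcd d) ns)"
      by (simp add: torsion_count_cyclic_sum)
  qed (use assms ms in auto)
qed

lemma invariant_factors:
  assumes "comm_group G" "finite (carrier G)"
  shows "\<forall>n\<in>set (invariant_factors G). 1 < n" "sorted_wrt (dvd) (invariant_factors G)"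
    "G \<cong> cyclic_sum (invariant_factors G)"
proof -
  obtain ns where "\<forall>n\<in>set ns. 1 < n" "sorted_wrt (dvd) ns" "G \<cong> cyclic_sum ns"
    using invariant_factors_exist[OF assms] by blast
  moreover from this have "invariant_factors G = ns" using invariant_factors_eq[OF assms(1)] by blast
  ultimately show "\<forall>n\<in>set (invariant_factors G). 1 < n" "sorted_wrt (dvd) (invariant_factors G)"
    "G \<cong> cyclic_sum (invariant_factors G)" by auto
qed

lemma sorted_wrt_dvd_last: "sorted_wrt (dvd) (ns :: nat list) \<Longrightarrow> x \<in> set ns \<Longrightarrow> x dvd last (1 # ns)"
  by (cases ns rule: rev_cases) (auto simp: sorted_wrt_append)

section \<open>Sums of sequences and coordinates in a finite abelian group\<close>

context comm_group begin

lemma seq_sum_eq: assumes "finite F" "set_mset S \<subseteq> F" "F \<subseteq> carrier G"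
  shows "seq_sum G S = (\<Otimes>h\<in>F. h [^] count S h)"
  unfolding seq_sum_def
  by (rule finprod_mono_neutral_cong_left) (use assms in \<open>auto simp: not_in_iff\<close>)

lemma seq_sum_empty [simp]: "seq_sum G {#} = \<one>" by (simp add: seq_sum_def)

lemma seq_sum_add_mset: assumes "g \<in> carrier G" "set_mset S \<subseteq> carrier G"
  shows "seq_sum G (add_mset g S) = g \<otimes> seq_sum G S"
proof -
  let ?F = "insert g (set_mset S)"
  have F: "finite ?F" "?F \<subseteq> carrier G" using assms by auto
  have "seq_sum G (add_mset g S) = (\<Otimes>h\<in>?F. h [^] count (add_mset g S) h)"
    by (rule seq_sum_eq) (use F in auto)
  also have "\<dots> = (\<Otimes>h\<in>?F. (if g = h then h else \<one>) \<otimes> h [^] count S h)"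
  proof (rule finprod_cong')
    fix h assume h: "h \<in> ?F"
    then have "h \<in> carrier G" using F(2) by auto
    then show "h [^] count (add_mset g S) h = (if g = h then h else \<one>) \<otimes> h [^] count S h"
      by (cases "g = h") (simp_all add: nat_pow_mult[of h 1, symmetric] m_comm)
  qed (use F(2) in auto)
  also have "\<dots> = (\<Otimes>h\<in>?F. if g = h then h else \<one>) \<otimes> (\<Otimes>h\<in>?F. h [^] count S h)"
    by (rule finprod_multf) (use F(2) in auto)
  also have "(\<Otimes>h\<in>?F. if g = h then h else \<one>) = g"
    using finprod_singleton[of g ?F "\<lambda>h. h"] F by auto
  also have "(\<Otimes>h\<in>?F. h [^] count S h) = seq_sum G S"
    by (rule seq_sum_eq[symmetric]) (use F in auto)
  finally show ?thesis .
qed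

lemma seq_sum_closed: "set_mset S \<subseteq> carrier G \<Longrightarrow> seq_sum G S \<in> carrier G"
  by (induction S) (auto simp: seq_sum_add_mset)

end

locale finite_comm_group = comm_group G for G (structure) +
  assumes finite_carrier: "finite (carrier G)"
begin

text \<open>Any isomorphism serves: by \<open>zero_sum_iff\<close> the resulting zero-sum sequences
  do not depend on the choice.\<close>

definition coord :: "'a \<Rightarrow> nat \<Rightarrow> int" where
  "coord = (SOME f. f \<in> iso G (cyclic_sum (invariant_factors G)))"

lemmas factors = invariant_factors[OF comm_group_axioms finite_carrier]

lemma factors_pos: "\<forall>n\<in>set (invariant_factors G). 0 < n" using factors(1) by force

lemma coord_iso: "coord \<in> iso G (cyclic_sum (invariant_factors G))"
  unfolding coord_def using factors(3) unfolding is_iso_def by (metis some_in_eq)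

lemma coord_mult:
  assumes "x \<in> carrier G" "y \<in> carrier G" "i < group_rank G"
  shows "coord (x \<otimes> y) i = (coord x i + coord y i) mod int (invariant_factors G ! i)"
proof -
  have "coord (x \<otimes> y) = coord x \<otimes>\<^bsub>cyclic_sum (invariant_factors G)\<^esub> coord y"
    using coord_iso assms by (auto simp: iso_def hom_def)
  then show ?thesis using assms(3) by (simp add: mult_cyclic_sum group_rank_def)
qed

lemma coord_one: "i < group_rank G \<Longrightarrow> coord \<one> i = 0"
proof -
  assume i: "i < group_rank G"
  have "coord \<one> = \<one>\<^bsub>cyclic_sum (invariant_factors G)\<^esub>"
    by (rule hom_one[OF _ is_group group_cyclic_sum]) (use coord_iso in \<open>simp add: iso_def\<close>)
  then show ?thesis using i by (simp add: one_cyclic_sum group_rank_def)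
qed

lemma coord_bounds: assumes "x \<in> carrier G" "i < group_rank G"
  shows "0 \<le> coord x i" "coord x i < int (invariant_factors G ! i)"
proof -
  have "coord x \<in> carrier (cyclic_sum (invariant_factors G))"
    using coord_iso assms(1) by (auto simp: iso_def hom_def)
  then have "coord x i \<in> {0..<int (invariant_factors G ! i)}"
    unfolding carrier_cyclic_sum[OF factors_pos] using assms(2) unfolding group_rank_def by blast
  then show "0 \<le> coord x i" "coord x i < int (invariant_factors G ! i)" by auto
qed

lemma coord_eq_one_iff: assumes "x \<in> carrier G"
  shows "x = \<one> \<longleftrightarrow> (\<forall>i<group_rank G. int (invariant_factors G ! i) dvd coord x i)"
proof
  assume "\<forall>i<group_rank G. int (invariant_factors G ! i) dvd coord x i"
  then have z: "coord x i = 0" if "i < group_rank G" for i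
    using coord_bounds[OF assms that] that by (metis dvd_eq_mod_eq_0 mod_pos_pos_trivial)
  have inj: "inj_on coord (carrier G)" and im: "\<And>y. y \<in> carrier G \<Longrightarrow> coord y \<in> carrier (cyclic_sum (invariant_factors G))"
    using coord_iso by (auto simp: iso_def bij_betw_def hom_def)
  have "coord x = coord \<one>"
  proof (rule PiE_ext)
    show "coord x \<in> (\<Pi>\<^sub>E i\<in>{..<length (invariant_factors G)}. {0..<int (invariant_factors G ! i)})"
      "coord \<one> \<in> (\<Pi>\<^sub>E i\<in>{..<length (invariant_factors G)}. {0..<int (invariant_factors G ! i)})"
      using im assms unfolding carrier_cyclic_sum[OF factors_pos] by auto
    fix i assume "i \<in> {..<length (invariant_factors G)}"
    then show "coord x i = coord \<one> i" using z coord_one by (simp add: group_rank_def)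
  qed
  then show "x = \<one>" using inj assms by (simp add: inj_on_eq_iff)
qed (simp add: coord_one)

text \<open>From here on the results on congruences apply to sequences over \<open>G\<close>, with
  \<open>n\<close> the exponent. The modulus is positive also for the trivial group, by the leading
  1 in \<open>group_exponent\<close>.\<close>

sublocale congruence_seqs "carrier G" "group_rank G" "group_exponent G" "\<lambda>i. invariant_factors G ! i" coord
proof
  have "last (1 # invariant_factors G) \<in> insert 1 (set (invariant_factors G))"
    by (metis last_in_set list.simps(15) list.discI)
  then show "0 < group_exponent G" unfolding group_exponent_def using factors(1) by fastforce
  show "invariant_factors G ! i dvd group_exponent G" if "i < group_rank G" for i
    using sorted_wrt_dvd_last[OF factors(2)] that unfolding group_exponent_def group_rank_def by auto
qed (rule finite_carrier)

text \<open>Coordinates are reduced residues, so they are additive only modulo the invariant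
  factors.\<close>

lemma coord_seq_sum:
  assumes "set_mset S \<subseteq> carrier G" "i < group_rank G"
  shows "int (invariant_factors G ! i) dvd coord (seq_sum G S) i - (\<Sum>g\<in>#S. coord g i)"
  using assms(1)
proof (induction S)
  case empty
  then show ?case using coord_one assms(2) by simp
next
  case (add g S)
  let ?n = "int (invariant_factors G ! i)"
  have g: "g \<in> carrier G" "set_mset S \<subseteq> carrier G" using add.prems by auto
  have "coord (seq_sum G (add_mset g S)) i = (coord g i + coord (seq_sum G S) i) mod ?n"
    using coord_mult[OF g(1) seq_sum_closed[OF g(2)] assms(2)] seq_sum_add_mset[OF g] by simp
  then have "?n dvd coord (seq_sum G (add_mset g S)) i - (coord g i + coord (seq_sum G S) i)"
    by (metis dvd_minus_mod dvd_diff_commute)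
  then have "?n dvd (coord (seq_sum G (add_mset g S)) i - (coord g i + coord (seq_sum G S) i)) +
      (coord (seq_sum G S) i - (\<Sum>g\<in>#S. coord g i))"
    using add.IH[OF g(2)] by (rule dvd_add)
  then show ?case by (simp add: algebra_simps)
qed

lemma zero_sum_iff: "zero_sum S \<longleftrightarrow> S \<in> zero_sum_seqs G"
proof (cases "set_mset S \<subseteq> carrier G")
  case True
  have "int (invariant_factors G ! i) dvd coord (seq_sum G S) i \<longleftrightarrow>
      int (invariant_factors G ! i) dvd (\<Sum>g\<in>#S. coord g i)" if "i < group_rank G" for i
    using dvd_add_right_iff[OF coord_seq_sum[OF True that], of "\<Sum>g\<in>#S. coord g i"] by simp
  then show ?thesis using True coord_eq_one_iff[OF seq_sum_closed[OF True]]
    by (simp add: zero_sum_def zero_sum_seqs_def sequences_def)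
qed (simp add: zero_sum_def zero_sum_seqs_def sequences_def)

lemma atom_iff: "atom A \<longleftrightarrow> A \<in> minimal_zero_sum_seqs G"
proof
  assume A: "atom A"
  have "\<not> (zero_sum U \<and> zero_sum V \<and> U \<noteq> {#} \<and> V \<noteq> {#} \<and> A = U + V)" for U V
  proof
    assume UV: "zero_sum U \<and> zero_sum V \<and> U \<noteq> {#} \<and> V \<noteq> {#} \<and> A = U + V"
    then have "zero_sum U" "U \<subseteq># A" by simp_all
    then have "U = {#} \<or> U = A" using A unfolding atom_def by blast
    then show False using UV by simp
  qed
  then show "A \<in> minimal_zero_sum_seqs G"
    using A unfolding minimal_zero_sum_seqs_def atom_def zero_sum_iff[symmetric] mem_Collect_eq Bex_def by blast
next
  assume A: "A \<in> minimal_zero_sum_seqs G"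
  then have A': "zero_sum A" "A \<noteq> {#}" "\<And>U V. zero_sum U \<Longrightarrow> zero_sum V \<Longrightarrow> U \<noteq> {#} \<Longrightarrow> V \<noteq> {#} \<Longrightarrow> A \<noteq> U + V"
    unfolding minimal_zero_sum_seqs_def zero_sum_iff by auto
  have "U = {#} \<or> U = A" if U: "zero_sum U" "U \<subseteq># A" for U
  proof (rule ccontr)
    assume n: "\<not> ?thesis"
    have "A = U + (A - U)" using U(2) by simp
    moreover have "A - U \<noteq> {#}" using n U(2) by (auto simp: Diff_eq_empty_iff_mset subset_mset.antisym)
    ultimately show False using A'(3)[OF U(1) zero_sum_diff[OF A'(1) U]] n by blast
  qed
  then show "atom A" using A' unfolding atom_def by blast
qed

lemma lengths_eq: "lengths S = set_of_lengths G S"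
  unfolding lengths_def set_of_lengths_def factors_def atom_iff by (auto simp: subset_iff)

end

text \<open>Formulated through the system of sets of lengths alone, so that it passes from
  \<open>G\<close> to \<open>G'\<close>. For \<open>M = 0\<close> the set \<open>{0}\<close> of the
  empty sequence satisfies it in every abelian group, hence the conditions \<open>1 \<le> M\<close>
  below.\<close>

definition long_progression :: "('a, 'b) monoid_scheme \<Rightarrow> nat \<Rightarrow> bool" where
  "long_progression G M \<longleftrightarrow> (\<forall>N. \<exists>y k. N \<le> k \<and> {y + M * i |i. i \<le> k} \<in> system_of_sets_of_lengths G)"

context finite_comm_group begin

lemma long_progression_iff:
  "long_progression G M \<longleftrightarrow> (\<forall>N. \<exists>S y k. zero_sum S \<and> N \<le> k \<and> lengths S = {y + M * i |i. i \<le> k})"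
proof -
  have "L \<in> system_of_sets_of_lengths G \<longleftrightarrow> (\<exists>S. zero_sum S \<and> lengths S = L)" for L
    unfolding system_of_sets_of_lengths_def lengths_eq zero_sum_iff image_iff by auto
  then show ?thesis unfolding long_progression_def
    by (simp only:) (rule iff_allI, rule iffI; elim exE conjE; intro exI conjI; assumption)
qed

lemma lin_pow_cong: "(\<And>i. i < s \<Longrightarrow> e i [^] x i = e i [^] y i) \<Longrightarrow> lin G e s x = lin G e s y"
  by (induction s) auto

lemma seq_sum_union:
  "set_mset S \<subseteq> carrier G \<Longrightarrow> set_mset T \<subseteq> carrier G \<Longrightarrow> seq_sum G (S + T) = seq_sum G S \<otimes> seq_sum G T"
  by (induction S) (auto simp: seq_sum_add_mset seq_sum_closed m_assoc)

lemma seq_sum_replicate: "g \<in> carrier G \<Longrightarrow> seq_sum G (replicate_mset c g) = g [^] c"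
  by (induction c) (auto simp: seq_sum_add_mset nat_pow_Suc2 m_comm)

lemma seq_sum_sum_replicate:
  assumes "\<And>i. i < s \<Longrightarrow> e i \<in> carrier G"
  shows "seq_sum G (\<Sum>i<s. replicate_mset (c i) (e i)) = lin G e s (\<lambda>i. int (c i)) \<and>
    set_mset (\<Sum>i<s. replicate_mset (c i) (e i)) \<subseteq> carrier G"
  using assms
proof (induction s)
  case (Suc s)
  then show ?case by (simp add: seq_sum_union seq_sum_replicate int_pow_int) 
qed simp

text \<open>One element \<open>g\<close> of the set \<open>E\<close> is dropped and the others are
  enumerated. Integer coefficients are reduced modulo the exponent and become multiplicities below
  it, so the independence statement for \<open>E\<close>, which concerns sequences, turns into
  \<open>independent\<close>.\<close>

theorem long_progression_upper:
  assumes "long_progression G M" "M \<ge> 1" "group_rank G \<le> M" "group_exponent G \<le> 2 * M + 1"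
  shows "M + 2 \<le> group_exponent G \<and> has_subgroup_iso G (cyclic_power (group_exponent G) (group_exponent G - M - 1))"
proof -
  let ?n = "group_exponent G"
  have "\<exists>Y\<subseteq>carrier G. one_length_class M Y \<and> \<not> half_factorial Y"
    by (rule long_progressions[OF assms(2)]) (rule assms(1)[unfolded long_progression_iff, THEN spec])
  then obtain Y where Y: "Y \<subseteq> carrier G" "one_length_class M Y" "\<not> half_factorial Y" by (elim exE conjE)
  from independent_set_exists[OF Y(2,1,3) assms(2-4)]
  obtain E where E: "E \<subseteq> carrier G" "M + card E = ?n" "card E \<ge> 2" "\<forall>g\<in>E. elt_order g = ?n"
    and ind: "\<forall>g\<in>E. \<forall>Z. zero_sum Z \<longrightarrow> set_mset Z \<subseteq> E - {g} \<longrightarrow> (\<forall>h. count Z h < ?n) \<longrightarrow> Z = {#}"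
    by (elim exE conjE)
  have finE: "finite E" using E(3) by (metis card.infinite not_numeral_le_zero)
  obtain g where g: "g \<in> E" using E(3) by fastforce
  define s where "s = card (E - {g})"
  have s: "s = ?n - M - 1" using E(2,3) g finE by (simp add: s_def)
  obtain e where e: "bij_betw e {..<s} (E - {g})"
    using ex_bij_betw_nat_finite[of "E - {g}"] finE unfolding s_def lessThan_atLeast0 by blast
  have eE: "e i \<in> E - {g}" if "i < s" for i using bij_betwE[OF e] that by blast
  then have eG: "\<And>i. i < s \<Longrightarrow> e i \<in> carrier G" using E(1) by blast
  have inj: "inj_on e {..<s}" using e by (rule bij_betw_imp_inj_on)
  have en: "e i [^] int ?n = \<one>" if "i < s" for i
  proof -
    have "zero_sum (replicate_mset ?n (e i))" using zero_sum_replicate_iff[OF eG[OF that]] E(4) eE[OF that] by simp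
    then have "e i [^] ?n = \<one>"
      using seq_sum_replicate[OF eG[OF that]] unfolding zero_sum_iff zero_sum_seqs_def by simp
    then show ?thesis by (simp add: int_pow_int)
  qed
  have red: "e i [^] x = e i [^] (x mod int ?n)" if "i < s" for i and x :: int
  proof -
    have "e i [^] x = e i [^] (int ?n * (x div int ?n) + x mod int ?n)" by simp
    also have "\<dots> = (e i [^] int ?n) [^] (x div int ?n) \<otimes> e i [^] (x mod int ?n)"
      using eG[OF that] by (simp only: int_pow_mult int_pow_pow)
    also have "\<dots> = e i [^] (x mod int ?n)" using en[OF that] eG[OF that] by simp
    finally show ?thesis .
  qed
  have "independent G e (replicate s ?n)" unfolding independent_def
  proof (intro conjI allI impI)
    fix x :: "nat \<Rightarrow> int"
    let ?c = "\<lambda>i. nat (x i mod int ?n)"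
    have nn: "int (?c i) = x i mod int ?n" for i using n_pos by simp
    let ?Z = "\<Sum>i<s. replicate_mset (?c i) (e i)"
    have ss: "seq_sum G ?Z = lin G e s (\<lambda>i. int (?c i)) \<and> set_mset ?Z \<subseteq> carrier G"
      by (rule seq_sum_sum_replicate) (rule eG)
    have "lin G e s x = lin G e s (\<lambda>i. int (?c i))" unfolding nn by (rule lin_pow_cong) (rule red)
    then have L: "lin G e s x = seq_sum G ?Z" by (simp only: ss)
    have cZ: "count ?Z h = (\<Sum>i<s. if h = e i then ?c i else 0)" for h
      unfolding count_sum by (intro sum.cong) auto
    have cZe: "count ?Z (e j) = ?c j" if "j < s" for j
    proof -
      have "(\<Sum>i<s. if e j = e i then ?c i else 0) = (\<Sum>i<s. if j = i then ?c i else 0)"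
        using inj that by (intro sum.cong) (auto simp: inj_on_eq_iff)
      then show ?thesis unfolding cZ using that by simp
    qed
    have c0: "count ?Z h = 0" if "h \<notin> e ` {..<s}" for h
      unfolding cZ using that by (intro sum.neutral) auto
    have "lin G e s x = \<one> \<longleftrightarrow> zero_sum ?Z"
      unfolding L zero_sum_iff zero_sum_seqs_def sequences_def using ss by blast
    also have "\<dots> \<longleftrightarrow> ?Z = {#}"
    proof
      assume z: "zero_sum ?Z"
      have sub: "set_mset ?Z \<subseteq> E - {g}"
      proof
        fix h assume "h \<in># ?Z"
        then have nz: "count ?Z h \<noteq> 0" by (simp only: count_eq_zero_iff not_not)
        have "h \<in> e ` {..<s}"
        proof (rule ccontr)
          assume "h \<notin> e ` {..<s}"
          from nz c0[OF this] show False by (rule notE)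
        qed
        then show "h \<in> E - {g}" using eE by blast
      qed
      have lt: "count ?Z h < ?n" for h
      proof (cases "h \<in> e ` {..<s}")
        case True
        then obtain j where j: "j < s" "h = e j" by blast
        have "int (?c j) < int ?n" unfolding nn using n_pos by simp
        then show ?thesis unfolding j(2) cZe[OF j(1)] by (simp only: of_nat_less_iff)
      next
        case False then show ?thesis using c0[OF False] n_pos by simp
      qed
      show "?Z = {#}" using ind[rule_format, OF g z sub lt] .
    qed (simp only: zero_sum_empty)
    also have "\<dots> \<longleftrightarrow> (\<forall>i<s. ?c i = 0)"
    proof
      assume "?Z = {#}"
      then have c: "count ?Z (e i) = 0" for i by (simp only: count_empty)
      show "\<forall>i<s. ?c i = 0"
      proof (intro allI impI)
        fix i assume "i < s"
        from trans[OF cZe[OF this, symmetric] c] show "?c i = 0" .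
      qed
    next
      assume z: "\<forall>i<s. ?c i = 0"
      have "?Z = (\<Sum>i<s. {#})" by (rule sum.cong[OF refl]) (simp only: z[rule_format] lessThan_iff replicate_mset_0)
      then show "?Z = {#}" by simp
    qed
    also have "\<dots> \<longleftrightarrow> (\<forall>i<s. int ?n dvd x i)"
    proof -
      have "?c i = 0 \<longleftrightarrow> int ?n dvd x i" for i
      proof -
        have "?c i = 0 \<longleftrightarrow> int (?c i) = 0" by (simp only: of_nat_eq_0_iff)
        also have "\<dots> \<longleftrightarrow> int ?n dvd x i" by (simp only: nn dvd_eq_mod_eq_0)
        finally show ?thesis .
      qed
      then show ?thesis by (simp only:)
    qed
    finally have "lin G e s x = \<one> \<longleftrightarrow> (\<forall>i<s. int ?n dvd x i)" .
    then show "(lin G e (length (replicate s ?n)) x = \<one>) = (\<forall>i<length (replicate s ?n). int (replicate s ?n ! i) dvd x i)"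
      by simp
  qed (use eG in simp)
  then have "has_subgroup_iso G (cyclic_sum (replicate s ?n))"
    by (rule has_subgroup_iso_of_independent) (use n_pos in simp)
  then show ?thesis using s E(2,3) unfolding cyclic_power_def by simp
qed

end

section \<open>Long arithmetic progressions and the Davenport constant\<close>

context congruence_seqs begin

text \<open>The model for \<open>U\<close> is a family of independent elements of order
  \<open>q\<close> together with minus their sum: a sequence is zero-sum iff all multiplicities
  agree modulo \<open>q\<close>. The only atoms are the squarefree \<open>W\<close> and the full
  powers, and \<open>q\<close> copies of \<open>W\<close> can be traded for \<open>card U\<close>
  full powers, a loss of \<open>q - card U = M\<close> factors. The \<open>q * k\<close> copies of
  \<open>W\<close> allow up to \<open>k\<close> trades.\<close>

lemma lengths_balanced:
  assumes U: "U \<subseteq> V" "g \<in> U" "card U \<ge> 2" and q: "q = M + card U"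
    and zc: "\<And>S. set_mset S \<subseteq> U \<Longrightarrow> zero_sum S \<longleftrightarrow> (\<forall>u\<in>U. int q dvd int (count S u) - int (count S g))"
  shows "zero_sum (repeat_mset (q * k) (mset_set U))"
    "lengths (repeat_mset (q * k) (mset_set U)) = {q * k - M * k + M * j |j. j \<le> k}"
proof -
  have finU: "finite U" using U(3) by (metis card.infinite not_numeral_le_zero)
  have q2: "q \<ge> 2" using q U(3) by simp
  define W where "W = mset_set U"
  have cW: "count W u = (if u \<in> U then 1 else 0)" for u using finU by (simp add: W_def count_mset_set')
  have WU: "set_mset W = U" using finU by (simp add: W_def)
  have sW: "size W = card U" by (simp add: W_def)
  have zW: "zero_sum (repeat_mset c W)" for c
    by (subst zc) (use WU set_repeat[of c W] cW U(2) in auto)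
  show "zero_sum (repeat_mset (q * k) (mset_set U))" using zW unfolding W_def .
  have ordq: "elt_order u = q" if u: "u \<in> U" for u
  proof -
    have "zero_sum (replicate_mset c u) \<longleftrightarrow> q dvd c" for c
    proof -
      have "zero_sum (replicate_mset c u) \<longleftrightarrow> (\<forall>w\<in>U. int q dvd int (count (replicate_mset c u) w) - int (count (replicate_mset c u) g))"
        by (rule zc) (use u in auto)
      also have "\<dots> \<longleftrightarrow> q dvd c"
      proof
        assume all: "\<forall>w\<in>U. int q dvd int (count (replicate_mset c u) w) - int (count (replicate_mset c u) g)"
        show "q dvd c"
        proof (cases "u = g")
          case True
          have "\<exists>w\<in>U. w \<noteq> g" 
          proof (rule ccontr)
            assume "\<not> ?thesis"
            then have "U \<subseteq> {g}" by blast
            then have "card U \<le> 1" using card_mono[of "{g}" U] by simp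
            then show False using U(3) by simp
          qed
          then obtain w where w: "w \<in> U" "w \<noteq> g" by blast
          have "int q dvd int (count (replicate_mset c u) w) - int (count (replicate_mset c u) g)" using all w(1) by blast
          then have "int q dvd - int c" using w(2) True by simp
          then show ?thesis by simp
        next
          case False
          have "int q dvd int (count (replicate_mset c u) u) - int (count (replicate_mset c u) g)" using all u by blast
          then show ?thesis using False by simp
        qed
      qed auto
      finally show ?thesis .
    qed
    then have "elt_order u dvd c \<longleftrightarrow> q dvd c" for c using zero_sum_replicate_iff[of u c] u U(1) by blast
    then show ?thesis by (meson dvd_antisym dvd_refl)
  qed
  have pwU: "ord_power u = replicate_mset q u" if "u \<in> U" for u using ordq[OF that] by (simp add: ord_power_def)
  have small0: "S = {#}" if S: "zero_sum S" "set_mset S \<subseteq> U" "\<forall>u\<in>U. count S u < q" "\<exists>u\<in>U. count S u = 0" for S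
  proof -
    have all: "int q dvd int (count S u) - int (count S g)" if "u \<in> U" for u using zc[OF S(2)] S(1) that by blast
    obtain w where w: "w \<in> U" "count S w = 0" using S(4) by blast
    have "int q dvd - int (count S g)" using all[OF w(1)] w(2) by simp
    then have qg: "q dvd count S g" by simp
    then have g0: "count S g = 0" using S(3) U(2) by (metis dvd_imp_le leD neq0_conv)
    have "count S u = 0" if "u \<in> U" for u
    proof -
      have "q dvd count S u" using all[OF that] g0 by simp
      then show ?thesis using S(3) that by (metis dvd_imp_le leD neq0_conv)
    qed
    then have "u \<notin># S" for u using S(2) by (cases "u \<in> U") (auto simp: not_in_iff)
    then show ?thesis by (meson multiset_nonemptyE)
  qed
  have atomW: "atom W" unfolding atom_def
  proof (intro conjI allI impI)
    show "zero_sum W" using zW[of 1] by simp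
    show "W \<noteq> {#}" using sW U(3) by auto
    fix S assume S: "zero_sum S" "S \<subseteq># W"
    have c1: "count S u \<le> count W u" for u using S(2) by (rule mset_subset_eq_count)
    have SU: "set_mset S \<subseteq> U" using set_mset_mono[OF S(2)] WU by simp
    show "S = {#} \<or> S = W"
    proof (cases "\<exists>u\<in>U. count S u = 0")
      case True
      have "count S u < q" for u using c1[of u] cW[of u] q2 by (simp split: if_splits)
      then show ?thesis using small0[OF S(1) SU _ True] by blast
    next
      case nz: False
      have "count S u = count W u" for u
      proof (cases "u \<in> U")
        case True
        then have "count S u > 0" using nz by auto
        moreover have "count W u = 1" using cW True by simp
        ultimately show ?thesis using c1[of u] by linarith
      next
        case False
        then show ?thesis using c1[of u] cW[of u] by simp
      qed
      then show ?thesis by (simp add: multiset_eq_iff)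
    qed
  qed
  have atoms: "A = W \<or> (\<exists>u\<in>U. A = ord_power u)" if A: "atom A" "set_mset A \<subseteq> U" for A
  proof (cases "\<exists>u\<in>U. count A u = 0")
    case True
    show ?thesis
    proof (rule ccontr)
      assume n: "\<not> ?thesis"
      have "count A u < q" if u: "u \<in> U" for u
        using atom_count[OF A(1), of u] n u U(1) ordq[OF u] by auto
      then have "A = {#}" using small0[OF atom_zero_sum[OF A(1)] A(2) _ True] by blast
      then show False using A(1) by (simp add: atom_def)
    qed
  next
    case False
    have "W \<subseteq># A" by (rule mset_subset_eqI) (use False cW in \<open>auto simp: Suc_le_eq\<close>)
    moreover have "zero_sum W" "W \<noteq> {#}" using atomW by (simp_all add: atom_def)
    ultimately have "W = A" using A(1) unfolding atom_def by blast
    then show ?thesis by simp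
  qed
  have Wpw: "W \<noteq> ord_power u" if "u \<in> U" for u
  proof
    assume "W = ord_power u"
    then have "U = {u}" using set_ord_power[of u] WU that U(1) by auto
    then show False using U(3) by simp
  qed
  have pwinj: "ord_power u = ord_power w \<longleftrightarrow> u = w" if "u \<in> U" "w \<in> U" for u w
    using set_ord_power[of u] set_ord_power[of w] that U(1) by (metis singleton_inject subsetD)
  have cnt: "(\<forall>u\<in>U. count (\<Sum>\<^sub># Z) u = count Z W + q * count Z (ord_power u)) \<and> size Z = count Z W + (\<Sum>u\<in>U. count Z (ord_power u))"
    if "\<forall>A\<in>#Z. A = W \<or> (\<exists>u\<in>U. A = ord_power u)" for Z
    using that
  proof (induction Z)
    case (add A Z)
    then have IH: "\<forall>u\<in>U. count (\<Sum>\<^sub># Z) u = count Z W + q * count Z (ord_power u)" "size Z = count Z W + (\<Sum>u\<in>U. count Z (ord_power u))" by auto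
    consider "A = W" | w where "w \<in> U" "A = ord_power w" using add.prems by auto
    then show ?case
    proof cases
      case 1
      have "count (add_mset A Z) (ord_power u) = count Z (ord_power u)" if "u \<in> U" for u using Wpw[OF that] 1 by simp
      then show ?thesis using IH 1 cW by simp
    next
      case 2
      have c: "count (add_mset A Z) (ord_power u) = count Z (ord_power u) + (if u = w then 1 else 0)" if "u \<in> U" for u
        using pwinj[OF that 2(1)] 2(2) by auto
      have "(\<Sum>u\<in>U. count (add_mset A Z) (ord_power u)) = (\<Sum>u\<in>U. count Z (ord_power u)) + 1"
      proof -
        have "(\<Sum>u\<in>U. count (add_mset A Z) (ord_power u)) = (\<Sum>u\<in>U. count Z (ord_power u) + (if u = w then 1 else 0))"
          by (rule sum.cong[OF refl c])
        then show ?thesis using 2(1) finU by (simp add: sum.distrib)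
      qed
      moreover have "count (add_mset A Z) W = count Z W" using Wpw[OF 2(1)] 2(2) by simp
      moreover have "count (\<Sum>\<^sub># (add_mset A Z)) u = count (\<Sum>\<^sub># Z) u + (if u = w then q else 0)" if "u \<in> U" for u
        using 2 pwU[OF 2(1)] by simp
      ultimately show ?thesis using IH c by (auto simp: algebra_simps)
    qed
  qed simp
  have "lengths (repeat_mset (q * k) W) = {q * k - M * k + M * j |j. j \<le> k}"
  proof (rule subset_antisym)
    show "lengths (repeat_mset (q * k) W) \<subseteq> {q * k - M * k + M * j |j. j \<le> k}"
    proof
      fix l assume "l \<in> lengths (repeat_mset (q * k) W)"
      then obtain Z where Z: "factors Z (repeat_mset (q * k) W)" "l = size Z" unfolding lengths_def by blast
      have "\<forall>A\<in>#Z. A = W \<or> (\<exists>u\<in>U. A = ord_power u)"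
      proof
        fix A assume A: "A \<in># Z"
        have "set_mset A \<subseteq> U" using factors_mem_set[OF Z(1) A] set_repeat[of "q * k" W] WU by blast
        then show "A = W \<or> (\<exists>u\<in>U. A = ord_power u)" using atoms Z(1) A by (simp add: factors_def)
      qed
      from cnt[OF this] have c: "\<And>u. u \<in> U \<Longrightarrow> count (\<Sum>\<^sub># Z) u = count Z W + q * count Z (ord_power u)"
        and sz: "size Z = count Z W + (\<Sum>u\<in>U. count Z (ord_power u))" by auto
      \<comment> \<open>The number of trades. It is the same for every \<open>u\<close> because all
        elements of \<open>U\<close> have equal multiplicity in the sequence.\<close>
      define b where "b = count Z (ord_power g)"
      have e: "count Z W + q * count Z (ord_power u) = q * k" if "u \<in> U" for u
        using c[OF that] Z(1) cW[of u] that by (simp add: factors_def)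
      have "count Z (ord_power u) = b" if "u \<in> U" for u
      proof -
        have "q * count Z (ord_power u) = q * b" using e[OF that] e[OF U(2)] unfolding b_def by linarith
        then show ?thesis using q2 by simp
      qed
      then have "l = count Z W + card U * b" using sz Z(2) by simp
      moreover have a: "count Z W + q * b = q * k" using e[OF U(2)] by (simp add: b_def)
      moreover have bk: "b \<le> k"
      proof -
        have "q * b \<le> q * k" using a by linarith
        then show ?thesis using q2 by simp
      qed
      moreover obtain j where j: "k = b + j" using le_Suc_ex[OF bk] by blast
      ultimately have "l = q * k - M * k + M * j" using q by (simp add: algebra_simps)
      then show "l \<in> {q * k - M * k + M * j |j. j \<le> k}" using j by auto
    qed
    show "{q * k - M * k + M * j |j. j \<le> k} \<subseteq> lengths (repeat_mset (q * k) W)"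
    proof
      fix l assume "l \<in> {q * k - M * k + M * j |j. j \<le> k}"
      then obtain j where j: "j \<le> k" "l = q * k - M * k + M * j" by blast
      obtain b where b: "k = j + b" using le_Suc_ex[OF j(1)] by blast
      let ?D = "repeat_mset b W"
      have DV: "set_mset ?D \<subseteq> V" using set_repeat[of b W] WU U(1) by blast
      let ?Z = "replicate_mset (q * j) W + image_mset ord_power ?D"
      have "factors ?Z (repeat_mset (q * j) W + \<Sum>\<^sub># (image_mset ord_power ?D))"
        by (rule factors_add[OF factors_repeat[OF atomW] factors_ord_powers[OF DV]])
      moreover have "repeat_mset (q * j) W + \<Sum>\<^sub># (image_mset ord_power ?D) = repeat_mset (q * k) W"
      proof (rule multiset_eqI)
        fix u
        show "count (repeat_mset (q * j) W + \<Sum>\<^sub># (image_mset ord_power ?D)) u = count (repeat_mset (q * k) W) u"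
          unfolding count_union count_ord_powers using cW[of u] ordq[of u] b by (simp add: algebra_simps)
      qed
      moreover have "size ?Z = l" using j(2) b q by (simp add: sW algebra_simps)
      ultimately show "l \<in> lengths (repeat_mset (q * k) W)" unfolding lengths_def by force
    qed
  qed
  then show "lengths (repeat_mset (q * k) (mset_set U)) = {q * k - M * k + M * j |j. j \<le> k}" unfolding W_def .
qed

text \<open>Greedy choice: the first part is as small as the remaining \<open>t\<close> parts of
  size at most \<open>q\<close> permit.\<close>

lemma exists_composition:
  "t \<le> y \<Longrightarrow> y \<le> q * t \<Longrightarrow> \<exists>T. size T = t \<and> (\<forall>a\<in>#T. 1 \<le> a \<and> a \<le> q) \<and> \<Sum>\<^sub># T = (y :: nat)"
proof (induction t arbitrary: y)
  case 0
  then show ?case by (intro exI[of _ "{#}"]) simp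
next
  case (Suc t)
  define a where "a = max 1 (y - q * t)"
  have "q \<ge> 1" using Suc.prems by (cases q) auto
  then have a: "1 \<le> a" "a \<le> q" "a \<le> y" using Suc.prems by (auto simp: a_def)
  have "t \<le> y - a" "y - a \<le> q * t"
  proof -
    have "t \<le> q * t" using a(1,2) by simp
    then show "t \<le> y - a" using Suc.prems by (auto simp: a_def max_def)
    show "y - a \<le> q * t" by (auto simp: a_def)
  qed
  from Suc.IH[OF this] obtain T where T: "size T = t" "\<forall>a\<in>#T. 1 \<le> a \<and> a \<le> q" "\<Sum>\<^sub># T = y - a" by blast
  show ?case by (intro exI[of _ "add_mset a T"]) (use T a in auto)
qed

text \<open>In the model, \<open>g\<close> is the sum of the \<open>M + 1\<close> independent
  elements of \<open>E\<close>, all of order \<open>q\<close>. The atoms are \<open>g ^ a\<close>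
  times all \<open>u ^ (q - a)\<close> with \<open>1 \<le> a \<le> q\<close>, and the full powers of
  the \<open>u\<close>. If \<open>t\<close> atoms of a factorization of \<open>B\<close> contain
  \<open>g\<close>, then each \<open>u\<close> contributes \<open>q * k - t\<close> full powers, so
  the length is \<open>t + (M + 1) * (q * k - t)\<close>. The \<open>q * k\<close> copies of
  \<open>g\<close> can be spread over any number \<open>t\<close> of atoms from \<open>k\<close> to
  \<open>q * k\<close>.\<close>

lemma lengths_rank:
  assumes E: "insert g E \<subseteq> V" "g \<notin> E" "card E = M + 1" "M \<ge> 1" and q2: "q \<ge> 2"
    and zc: "\<And>S. set_mset S \<subseteq> insert g E \<Longrightarrow> zero_sum S \<longleftrightarrow> (\<forall>u\<in>E. q dvd count S u + count S g)"
    and B: "B = replicate_mset (q * k) g + repeat_mset ((q - 1) * (q * k)) (mset_set E)"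
  shows "zero_sum B" "lengths B = {q * k + M * i |i. i \<le> (q - 1) * k}"
proof -
  have finE: "finite E" using E(3) by (metis card.infinite add_is_0 one_neq_zero)
  have Ene: "E \<noteq> {}" using E(3) by auto
  have cE: "count (mset_set E) u = (if u \<in> E then 1 else 0)" for u using finE by (simp add: count_mset_set')
  \<comment> \<open>For \<open>a = q\<close> only copies of \<open>g\<close> remain, so the full
    power of \<open>g\<close> belongs to this family.\<close>
  define Va where "Va a = replicate_mset a g + repeat_mset (q - a) (mset_set E)" for a
  have cV: "count (Va a) u = (if u = g then a else if u \<in> E then q - a else 0)" for a u
    using E(2) by (simp add: Va_def cE)
  have setV: "set_mset (Va a) \<subseteq> insert g E" for a
    unfolding Va_def using set_repeat[of "q - a" "mset_set E"] finE by auto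
  have cB: "count B u = (if u = g then q * k else if u \<in> E then (q - 1) * (q * k) else 0)" for u
    using E(2) by (simp add: B cE)
  have setB: "set_mset B \<subseteq> insert g E"
    unfolding B using set_repeat[of "(q - 1) * (q * k)" "mset_set E"] finE by auto
  obtain q1 where q1: "q = Suc q1" using q2 by (cases q) auto
  show "zero_sum B" unfolding zc[OF setB]
  proof
    fix u assume u: "u \<in> E"
    then have "count B u + count B g = q * (q * k)" using E(2) q1 by (auto simp: cB algebra_simps)
    then show "q dvd count B u + count B g" by simp
  qed
  have ordq: "elt_order u = q" if u: "u \<in> insert g E" for u
  proof -
    have "zero_sum (replicate_mset c u) \<longleftrightarrow> q dvd c" for c
    proof -
      have "zero_sum (replicate_mset c u) \<longleftrightarrow> (\<forall>w\<in>E. q dvd count (replicate_mset c u) w + count (replicate_mset c u) g)"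
        by (rule zc) (use u in auto)
      also have "\<dots> \<longleftrightarrow> q dvd c"
      proof (cases "u = g")
        case True
        have "count (replicate_mset c u) w + count (replicate_mset c u) g = c" if "w \<in> E" for w
          using that True E(2) by auto
        then show ?thesis using Ene by auto
      next
        case False
        then have "u \<in> E" using u by simp
        have "count (replicate_mset c u) w + count (replicate_mset c u) g = (if w = u then c else 0)" for w
          using False by auto
        then show ?thesis using \<open>u \<in> E\<close> by auto
      qed
      finally show ?thesis .
    qed
    then have "elt_order u dvd c \<longleftrightarrow> q dvd c" for c using zero_sum_replicate_iff[of u c] u E(1) by blast
    then show ?thesis by (meson dvd_antisym dvd_refl)
  qed
  have pwU: "ord_power u = replicate_mset q u" if "u \<in> insert g E" for u using ordq[OF that] by (simp add: ord_power_def)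
  have zV: "zero_sum (Va a)" if "a \<le> q" for a
    unfolding zc[OF setV] using that E(2) by (auto simp: cV)
  have le_part: "q - count S g \<le> count S u" if S: "zero_sum S" "set_mset S \<subseteq> insert g E" "count S g \<ge> 1" "u \<in> E" for S u
  proof -
    have "q dvd count S u + count S g" using zc[OF S(2)] S(1,4) by blast
    then have "q \<le> count S u + count S g" using S(3) by (intro dvd_imp_le) auto
    then show ?thesis by linarith
  qed
  have atomV: "atom (Va a)" if a: "1 \<le> a" "a \<le> q" for a
    unfolding atom_def
  proof (intro conjI allI impI)
    show "zero_sum (Va a)" using zV a by simp
    show "Va a \<noteq> {#}" using a(1) by (simp add: Va_def)
    fix S assume S: "zero_sum S" "S \<subseteq># Va a"
    have le: "count S u \<le> count (Va a) u" for u using S(2) by (rule mset_subset_eq_count)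
    have SU: "set_mset S \<subseteq> insert g E" using set_mset_mono[OF S(2)] setV by blast
    have out: "count S u = 0" if "u \<notin> insert g E" for u using le[of u] that by (simp add: cV)
    show "S = {#} \<or> S = Va a"
    proof (cases "count S g = 0")
      case True
      have "count S u = 0" if u: "u \<in> E" for u
      proof -
        have "q dvd count S u" using zc[OF SU] S(1) u True by fastforce
        moreover have "count S u < q"
        proof -
          have "count (Va a) u = q - a" using u E(2) by (auto simp: cV)
          then show ?thesis using le[of u] a by linarith
        qed
        ultimately show ?thesis by (metis dvd_imp_le leD neq0_conv)
      qed
      then have "count S u = 0" for u using out True by (cases "u \<in> insert g E") auto
      then show ?thesis by (simp add: multiset_eq_iff)
    next
      case False
      then have g1: "count S g \<ge> 1" by simp
      have ga: "count S g = a"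
      proof -
        obtain u where u: "u \<in> E" using Ene by blast
        have "count (Va a) u = q - a" using u E(2) by (auto simp: cV)
        then have "q - count S g \<le> q - a" using le_part[OF S(1) SU g1 u] le[of u] by linarith
        moreover have "count S g \<le> a" using le[of g] by (simp add: cV)
        ultimately show ?thesis using a by linarith
      qed
      have "count S u = count (Va a) u" for u
      proof -
        consider "u = g" | "u \<in> E" "u \<noteq> g" | "u \<notin> insert g E" using E(2) by blast
        then show ?thesis
        proof cases
          case 2
          then show ?thesis using le_part[OF S(1) SU g1 2(1)] le[of u] ga by (simp add: cV)
        qed (use ga out in \<open>auto simp: cV\<close>)
      qed
      then show ?thesis by (simp add: multiset_eq_iff)
    qed
  qed
  have atoms: "(g \<in># A \<and> (\<forall>u\<in>E. count A u + count A g = q)) \<or> (g \<notin># A \<and> (\<exists>u\<in>E. A = ord_power u))"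
    and gle: "count A g \<le> q" if A: "atom A" "set_mset A \<subseteq> insert g E" for A
  proof -
    have gV: "g \<in> V" using E(1) by simp
    show le: "count A g \<le> q" using atom_count_le[OF A(1) gV] ordq[of g] by simp
    have zA: "zero_sum A" using A(1) by (rule atom_zero_sum)
    show "(g \<in># A \<and> (\<forall>u\<in>E. count A u + count A g = q)) \<or> (g \<notin># A \<and> (\<exists>u\<in>E. A = ord_power u))"
    proof (cases "g \<in># A")
      case True
      then have g1: "count A g \<ge> 1" by (simp add: Suc_le_eq)
      have "Va (count A g) \<subseteq># A"
      proof (rule mset_subset_eqI)
        fix u show "count (Va (count A g)) u \<le> count A u"
          using le_part[OF zA A(2) g1, of u] by (simp add: cV)
      qed
      then have "Va (count A g) = {#} \<or> Va (count A g) = A" using A(1) zV[OF le] unfolding atom_def by blast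
      moreover have "Va (count A g) \<noteq> {#}" using g1 by (simp add: Va_def)
      ultimately have VA: "Va (count A g) = A" by blast
      have "count A u + count A g = q" if u: "u \<in> E" for u
      proof -
        have "count A u = count (Va (count A g)) u" using VA by simp
        also have "\<dots> = q - count A g" using u E(2) by (auto simp: cV)
        finally show ?thesis using le by simp
      qed
      then show ?thesis using True by blast
    next
      case False
      then have g0: "count A g = 0" by (simp add: not_in_iff)
      obtain u where u: "u \<in># A" using A(1) unfolding atom_def by (meson multiset_nonemptyE)
      then have uE: "u \<in> E" using A(2) False by auto
      have "q dvd count A u" using zc[OF A(2)] zA uE g0 by fastforce
      then have "q \<le> count A u" using u by (intro dvd_imp_le) auto
      then have "elt_order u \<le> count A u" using ordq uE by simp
      then have "A = ord_power u" using atom_count[OF A(1), of u] uE E(1) by force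
      then show ?thesis using False uE by blast
    qed
  qed
  have pwinj: "ord_power u = ord_power w \<longleftrightarrow> u = w" if "u \<in> E" "w \<in> E" for u w
    using set_ord_power[of u] set_ord_power[of w] that E(1) by (metis insert_subset singleton_inject subsetD)
  \<comment> \<open>To the multiplicity of \<open>u\<close> plus that of \<open>g\<close>, an atom
    containing \<open>g\<close> contributes \<open>q\<close>, as does the full power of
    \<open>u\<close>; all other atoms contribute 0. This gives one linear equation for each
    \<open>u\<close>.\<close>
  have cnt: "(\<forall>u\<in>E. count (\<Sum>\<^sub># Z) u + count (\<Sum>\<^sub># Z) g = q * size (filter_mset (\<lambda>A. g \<in># A) Z) + q * count Z (ord_power u)) \<and>
      size Z = size (filter_mset (\<lambda>A. g \<in># A) Z) + (\<Sum>u\<in>E. count Z (ord_power u)) \<and>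
      count (\<Sum>\<^sub># Z) g \<le> q * size (filter_mset (\<lambda>A. g \<in># A) Z)"
    if "\<forall>A\<in>#Z. atom A \<and> set_mset A \<subseteq> insert g E" for Z
    using that
  proof (induction Z)
    case (add A Z)
    then have IH: "\<forall>u\<in>E. count (\<Sum>\<^sub># Z) u + count (\<Sum>\<^sub># Z) g = q * size (filter_mset (\<lambda>A. g \<in># A) Z) + q * count Z (ord_power u)"
      "size Z = size (filter_mset (\<lambda>A. g \<in># A) Z) + (\<Sum>u\<in>E. count Z (ord_power u))"
      "count (\<Sum>\<^sub># Z) g \<le> q * size (filter_mset (\<lambda>A. g \<in># A) Z)" by auto
    have A: "atom A" "set_mset A \<subseteq> insert g E" using add.prems by auto
    have gpw: "g \<notin># ord_power u" if "u \<in> E" for u using set_ord_power[of u] that E(1,2) by auto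
    from atoms[OF A] show ?case
    proof
      assume g: "g \<in># A \<and> (\<forall>u\<in>E. count A u + count A g = q)"
      have "count (add_mset A Z) (ord_power u) = count Z (ord_power u)" if "u \<in> E" for u
        using gpw[OF that] g by auto
      then show ?thesis using IH g gle[OF A] by (auto simp: algebra_simps)
    next
      assume "g \<notin># A \<and> (\<exists>u\<in>E. A = ord_power u)"
      then obtain w where w: "g \<notin># A" "w \<in> E" "A = ord_power w" by blast
      have c: "count (add_mset A Z) (ord_power u) = count Z (ord_power u) + (if u = w then 1 else 0)" if "u \<in> E" for u
        using pwinj[OF that w(2)] w(3) by auto
      have "(\<Sum>u\<in>E. count (add_mset A Z) (ord_power u)) = (\<Sum>u\<in>E. count Z (ord_power u)) + 1"
      proof -
        have "(\<Sum>u\<in>E. count (add_mset A Z) (ord_power u)) = (\<Sum>u\<in>E. count Z (ord_power u) + (if u = w then 1 else 0))"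
          by (rule sum.cong[OF refl c])
        then show ?thesis using w(2) finE by (simp add: sum.distrib)
      qed
      moreover have "count A g = 0" using w(1) by (simp add: not_in_iff)
      moreover have "count A u = (if u = w then q else 0)" for u using w(2,3) pwU[of w] by simp
      ultimately show ?thesis using IH w(1) c by (auto simp: algebra_simps)
    qed
  qed simp
  show "lengths B = {q * k + M * i |i. i \<le> (q - 1) * k}"
  proof (rule subset_antisym)
    show "lengths B \<subseteq> {q * k + M * i |i. i \<le> (q - 1) * k}"
    proof
      fix l assume "l \<in> lengths B"
      then obtain Z where Z: "factors Z B" "l = size Z" unfolding lengths_def by blast
      have ZB: "\<Sum>\<^sub># Z = B" using Z(1) by (simp add: factors_def)
      have "\<forall>A\<in>#Z. atom A \<and> set_mset A \<subseteq> insert g E"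
        using factors_mem_set[OF Z(1)] setB Z(1) unfolding factors_def by blast
      note c = cnt[OF this, unfolded ZB]
      define t where "t = size (filter_mset (\<lambda>A. g \<in># A) Z)"
      have e: "q * t + q * count Z (ord_power u) = q * (q * k)" if u: "u \<in> E" for u
      proof -
        have "count B u + count B g = q * (q * k)" using u E(2) q1 by (auto simp: cB algebra_simps)
        then show ?thesis using c u by (simp add: t_def)
      qed
      then have e': "t + count Z (ord_power u) = q * k" if "u \<in> E" for u
      proof -
        have "q * (t + count Z (ord_power u)) = q * (q * k)" using e[OF that] by (simp add: algebra_simps)
        then show ?thesis using q2 by simp
      qed
      obtain u0 where u0: "u0 \<in> E" using Ene by blast
      define b where "b = count Z (ord_power u0)"
      have tb: "t + b = q * k" using e'[OF u0] by (simp add: b_def)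
      have "count Z (ord_power u) = b" if "u \<in> E" for u using e'[OF that] tb by linarith
      then have "l = t + (M + 1) * b" using c Z(2) E(3) by (simp add: t_def)
      then have l: "l = q * k + M * b" using tb by (simp add: algebra_simps)
      have "q * k \<le> q * t" using c by (simp add: t_def cB)
      then have "k \<le> t" using q2 by simp
      then have "b \<le> (q - 1) * k" using tb q1 by simp
      then show "l \<in> {q * k + M * i |i. i \<le> (q - 1) * k}" using l by blast
    qed
    show "{q * k + M * i |i. i \<le> (q - 1) * k} \<subseteq> lengths B"
    proof
      fix l assume "l \<in> {q * k + M * i |i. i \<le> (q - 1) * k}"
      then obtain i where i: "i \<le> (q - 1) * k" "l = q * k + M * i" by blast
      define t where "t = q * k - i"
      have it: "t + i = q * k" "k \<le> t" using i(1) q1 by (auto simp: t_def)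
      have "t \<le> q * k" "q * k \<le> q * t" using it by auto
      from exists_composition[OF this]
      obtain T where T: "size T = t" "\<forall>a\<in>#T. 1 \<le> a \<and> a \<le> q" "\<Sum>\<^sub># T = q * k" by blast
      let ?D = "repeat_mset i (mset_set E)"
      have DV: "set_mset ?D \<subseteq> V" using set_repeat[of i "mset_set E"] finE E(1) by auto
      let ?Z = "image_mset Va T + image_mset ord_power ?D"
      have "factors (image_mset Va T) (\<Sum>\<^sub># (image_mset Va T))" unfolding factors_def using T(2) atomV by auto
      then have f: "factors ?Z (\<Sum>\<^sub># (image_mset Va T) + \<Sum>\<^sub># (image_mset ord_power ?D))" using factors_ord_powers[OF DV] by (rule factors_add)
      have cT: "count (\<Sum>\<^sub># (image_mset Va T)) u =
          (if u = g then \<Sum>\<^sub># T else if u \<in> E then q * size T - \<Sum>\<^sub># T else 0) \<and> \<Sum>\<^sub># T \<le> q * size T"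
        if "\<forall>a\<in>#T. 1 \<le> a \<and> a \<le> q" for u and T :: "nat multiset"
        using that by (induction T) (auto simp: cV)
      have "\<Sum>\<^sub># (image_mset Va T) + \<Sum>\<^sub># (image_mset ord_power ?D) = B"
      proof (rule multiset_eqI)
        fix u
        have "q * t - q * k + i * q = (q - 1) * (q * k)"
        proof -
          have "q * t + i * q = q * (q * k)" using it(1) by (metis add_mult_distrib2 mult.commute)
          moreover have "q * k \<le> q * t" using it(2) by simp
          ultimately show ?thesis using q1 by simp
        qed
        then show "count (\<Sum>\<^sub># (image_mset Va T) + \<Sum>\<^sub># (image_mset ord_power ?D)) u = count B u"
          unfolding count_union count_ord_powers using cT[OF T(2), of u] T(1,3) ordq[of u] E(2)
          by (auto simp: cB cE)
      qed
      moreover have "size ?Z = l" using i(2) it(1) T(1) E(3) by (simp add: algebra_simps)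
      ultimately show "l \<in> lengths B" using f unfolding lengths_def by force
    qed
  qed
qed

end

section \<open>Progressions realized by independent elements\<close>

lemma (in comm_group) lin_extend:
  "s \<le> r \<Longrightarrow> (\<And>i. i < r \<Longrightarrow> e i \<in> carrier G) \<Longrightarrow> lin G e r (\<lambda>i. if i < s then x i else 0) = lin G e s x"
proof (induction r)
  case (Suc r)
  show ?case
  proof (cases "s = Suc r")
    case True
    show ?thesis unfolding True by (rule lin_cong) simp
  next
    case False
    then have "s \<le> r" using Suc.prems by simp
    then have "lin G e r (\<lambda>i. if i < s then x i else 0) = lin G e s x" using Suc by simp
    moreover have "lin G e s x \<in> carrier G" using lin_closed Suc.prems by simp
    ultimately show ?thesis using \<open>s \<le> r\<close> by simp
  qed
qed simp

context finite_comm_group begin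

text \<open>The parameter \<open>\<sigma>\<close> serves both constructions: it is
  \<open>- 1\<close> in \<open>long_progression_exponent\<close> and \<open>1\<close> in
  \<open>long_progression_rank\<close>.\<close>

lemma seq_sum_insert_lin:
  assumes e: "\<And>i. i < s \<Longrightarrow> e i \<in> carrier G" "inj_on e {..<s}"
    and g: "g = lin G e s (\<lambda>_. \<sigma>)" "g \<notin> e ` {..<s}"
    and S: "set_mset S \<subseteq> insert g (e ` {..<s})"
  shows "seq_sum G S = lin G e s (\<lambda>i. int (count S (e i)) + \<sigma> * int (count S g))"
  using S
proof (induction S)
  case empty
  then show ?case by (simp add: lin_zero)
next
  case (add x S)
  have sub: "insert g (e ` {..<s}) \<subseteq> carrier G" using e(1) lin_closed[OF e(1)] g(1) by auto
  have x: "x \<in> carrier G" "set_mset S \<subseteq> carrier G" using add.prems sub by auto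
  have IH: "seq_sum G S = lin G e s (\<lambda>i. int (count S (e i)) + \<sigma> * int (count S g))" using add by simp
  have ss: "seq_sum G (add_mset x S) = x \<otimes> lin G e s (\<lambda>i. int (count S (e i)) + \<sigma> * int (count S g))"
    using seq_sum_add_mset[OF x] IH by simp
  have ng: "e i \<noteq> g" if "i < s" for i using g(2) that by blast
  show ?case
  proof (cases "x = g")
    case True
    have "seq_sum G (add_mset x S) = lin G e s (\<lambda>i. \<sigma> + (int (count S (e i)) + \<sigma> * int (count S g)))"
      using ss lin_add[OF e(1), where x = "\<lambda>_. \<sigma>" and y = "\<lambda>i. int (count S (e i)) + \<sigma> * int (count S g)"]
      by (simp only: True g(1)[symmetric])
    also have "\<dots> = lin G e s (\<lambda>i. int (count (add_mset x S) (e i)) + \<sigma> * int (count (add_mset x S) g))"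
    proof (rule lin_cong)
      fix i assume "i < s"
      then have "e i \<noteq> x" using ng True by blast
      then show "e i = e i \<and> \<sigma> + (int (count S (e i)) + \<sigma> * int (count S g)) =
        int (count (add_mset x S) (e i)) + \<sigma> * int (count (add_mset x S) g)" using True by (simp add: algebra_simps)
    qed
    finally show ?thesis .
  next
    case False
    then obtain j where j: "j < s" "x = e j" using add.prems by auto
    have "x = lin G e s (\<lambda>i. if i = j then 1 else 0)" using lin_delta[OF e(1) j(1), where z = 1] e(1)[OF j(1)] j(2) by simp
    then have "seq_sum G (add_mset x S) = lin G e s (\<lambda>i. (if i = j then 1 else 0) + (int (count S (e i)) + \<sigma> * int (count S g)))"
      unfolding ss using lin_add[of s e "\<lambda>i. if i = j then 1 else 0" "\<lambda>i. int (count S (e i)) + \<sigma> * int (count S g)"] e(1) by simp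
    also have "\<dots> = lin G e s (\<lambda>i. int (count (add_mset x S) (e i)) + \<sigma> * int (count (add_mset x S) g))"
    proof (rule lin_cong)
      fix i assume i: "i < s"
      have "e i = x \<longleftrightarrow> i = j" unfolding j(2) using e(2) i j(1) by (simp add: inj_on_eq_iff)
      then show "e i = e i \<and> (if i = j then 1 else 0) + (int (count S (e i)) + \<sigma> * int (count S g)) =
        int (count (add_mset x S) (e i)) + \<sigma> * int (count (add_mset x S) g)" using False by auto
    qed
    finally show ?thesis .
  qed
qed

lemma independent_inj:
  assumes "independent G e (replicate s q)" "q \<ge> 2"
  shows "inj_on e {..<s}"
proof (rule inj_onI)
  fix i j assume ij: "i \<in> {..<s}" "j \<in> {..<s}" "e i = e j"
  have eG: "\<And>i. i < s \<Longrightarrow> e i \<in> carrier G" using assms(1) by (simp add: independent_def)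
  have "lin G e (length (replicate s q)) (\<lambda>k. if k = i then 1 else 0) = lin G e (length (replicate s q)) (\<lambda>k. if k = j then 1 else 0)"
    using lin_delta[OF eG, where j = i and z = 1] lin_delta[OF eG, where j = j and z = 1] ij by simp
  then have "\<forall>k<s. int q dvd (if k = i then 1 else 0) - (if k = j then 1 else 0)"
    unfolding lin_eq_iff[OF assms(1)] by simp
  then have "int q dvd (if i = i then 1 else 0) - (if i = j then 1 else 0)" using ij(1) by blast
  then show "i = j" using assms(2) by (cases "i = j") auto
qed

lemma independent_take:
  assumes "independent G e ns" "s \<le> length ns"
  shows "independent G e (take s ns)"
  unfolding independent_def
proof (intro conjI allI impI)
  have eG: "\<And>i. i < length ns \<Longrightarrow> e i \<in> carrier G" using assms(1) by (simp add: independent_def)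
  show "e i \<in> carrier G" if "i < length (take s ns)" for i using eG that by simp
  fix x
  have "lin G e (length ns) (\<lambda>i. if i < s then x i else 0) = lin G e s x" by (rule lin_extend[OF assms(2) eG])
  moreover have "lin G e (length ns) (\<lambda>i. if i < s then x i else 0) = \<one> \<longleftrightarrow>
      (\<forall>i<length ns. int (ns ! i) dvd (if i < s then x i else 0))"
    using assms(1) by (simp add: independent_def)
  moreover have "\<dots> \<longleftrightarrow> (\<forall>i<s. int (ns ! i) dvd x i)" using assms(2) by auto
  ultimately show "lin G e (length (take s ns)) x = \<one> \<longleftrightarrow> (\<forall>i<length (take s ns). int (take s ns ! i) dvd x i)"
    using assms(2) by simp
qed

lemma independent_iff:
  assumes "independent G e (replicate s q)"
  shows "lin G e s x = \<one> \<longleftrightarrow> (\<forall>i<s. int q dvd x i)"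
  using assms by (simp add: independent_def)

lemma generated_sum_notin:
  assumes ind: "independent G e (replicate s q)" and g: "g = lin G e s (\<lambda>_. \<sigma>)"
    and "\<And>j. j < s \<Longrightarrow> \<exists>i<s. \<not> int q dvd \<sigma> - (if i = j then 1 else 0)"
  shows "g \<notin> e ` {..<s}"
proof
  assume "g \<in> e ` {..<s}"
  then obtain j where j: "j < s" "g = e j" by blast
  have eG: "\<And>i. i < s \<Longrightarrow> e i \<in> carrier G" using ind by (simp add: independent_def)
  have "lin G e (length (replicate s q)) (\<lambda>_. \<sigma>) = lin G e (length (replicate s q)) (\<lambda>k. if k = j then 1 else 0)"
    using lin_delta[OF eG j(1), where z = 1] eG[OF j(1)] j(2) g by simp
  then have "\<forall>k<s. int q dvd \<sigma> - (if k = j then 1 else 0)" unfolding lin_eq_iff[OF ind] by simp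
  then show False using assms(3)[OF j(1)] by blast
qed

theorem long_progression_exponent:
  assumes ind: "independent G e (replicate s q)" and "s \<ge> 1" "M \<ge> 1" "q = M + s + 1"
  shows "long_progression G M"
  unfolding long_progression_iff
proof
  fix N
  \<comment> \<open>For \<open>s = 1\<close> the element \<open>g\<close> is the inverse of
    \<open>e 0\<close>; an order of at least 3 keeps the two apart.\<close>
  have q3: "q \<ge> 3" using assms by simp
  have eG: "\<And>i. i < s \<Longrightarrow> e i \<in> carrier G" using ind by (simp add: independent_def)
  have inj: "inj_on e {..<s}" using independent_inj[OF ind] q3 by simp
  define g where "g = lin G e s (\<lambda>_. - 1)"
  have gn: "g \<notin> e ` {..<s}"
  proof (rule generated_sum_notin[OF ind g_def])
    fix j assume j: "j < s"
    have "\<not> int q dvd - 1 - 1" 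
    proof
      assume "int q dvd - 1 - 1"
      then have "int q dvd 2" by simp
      then have "int q \<le> 2" by (rule zdvd_imp_le) simp
      then show False using q3 by simp
    qed
    then show "\<exists>i<s. \<not> int q dvd - 1 - (if i = j then 1 else 0)" using j by (intro exI[of _ j]) simp
  qed
  define U where "U = insert g (e ` {..<s})"
  have cU: "card U = s + 1" unfolding U_def using gn card_image[OF inj] by simp
  have UV: "U \<subseteq> carrier G" unfolding U_def g_def using eG lin_closed[OF eG] by auto
  have zc: "zero_sum S \<longleftrightarrow> (\<forall>u\<in>U. int q dvd int (count S u) - int (count S g))" if S: "set_mset S \<subseteq> U" for S
  proof -
    have "zero_sum S \<longleftrightarrow> seq_sum G S = \<one>" unfolding zero_sum_iff zero_sum_seqs_def sequences_def using S UV by auto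
    also have "\<dots> \<longleftrightarrow> (\<forall>i<s. int q dvd int (count S (e i)) + (- 1) * int (count S g))"
    proof -
      have "seq_sum G S = lin G e s (\<lambda>i. int (count S (e i)) + (- 1) * int (count S g))"
        by (rule seq_sum_insert_lin[OF _ inj g_def gn S[unfolded U_def]]) (rule eG)
      then show ?thesis by (simp only: independent_iff[OF ind])
    qed
    also have "\<dots> \<longleftrightarrow> (\<forall>u\<in>U. int q dvd int (count S u) - int (count S g))" unfolding U_def by auto
    finally show ?thesis .
  qed
  have qU: "q = M + card U" using cU assms(4) by simp
  have gU: "g \<in> U" by (simp add: U_def)
  have cU2: "card U \<ge> 2" using cU assms(2) by simp
  note L = lengths_balanced[OF UV gU cU2 qU zc, of N]
  have "zero_sum (repeat_mset (q * N) (mset_set U)) \<and> N \<le> N \<and>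
      lengths (repeat_mset (q * N) (mset_set U)) = {(q * N - M * N) + M * i |i. i \<le> N}" using L by simp
  then show "\<exists>S y k. zero_sum S \<and> N \<le> k \<and> lengths S = {y + M * i |i. i \<le> k}" by blast
qed

theorem long_progression_rank:
  assumes ind: "independent G e (replicate (M + 1) q)" and "q \<ge> 2" "M \<ge> 1"
  shows "long_progression G M"
  unfolding long_progression_iff
proof
  fix N
  let ?s = "M + 1"
  have eG: "\<And>i. i < ?s \<Longrightarrow> e i \<in> carrier G" using ind by (simp add: independent_def)
  have inj: "inj_on e {..<?s}" using independent_inj[OF ind assms(2)] .
  define g where "g = lin G e ?s (\<lambda>_. 1)"
  have gn: "g \<notin> e ` {..<?s}"
  proof (rule generated_sum_notin[OF ind g_def])
    fix j assume j: "j < ?s"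
    \<comment> \<open>A coordinate other than \<open>j\<close>, available since
      \<open>M + 1 \<ge> 2\<close>: there \<open>g\<close> has coefficient 1 and \<open>e j\<close>
      has 0.\<close>
    define i where "i = (if j = 0 then 1 else 0 :: nat)"
    have "i < ?s" "i \<noteq> j" using assms(3) by (auto simp: i_def)
    then show "\<exists>i<?s. \<not> int q dvd 1 - (if i = j then 1 else 0)" using assms(2) by (intro exI[of _ i]) auto
  qed
  define E where "E = e ` {..<?s}"
  have cE: "card E = M + 1" unfolding E_def card_image[OF inj] by simp
  have gE: "g \<notin> E" using gn by (simp add: E_def)
  have EV: "insert g E \<subseteq> carrier G" unfolding E_def g_def using eG lin_closed[OF eG] by auto
  have zc: "zero_sum S \<longleftrightarrow> (\<forall>u\<in>E. q dvd count S u + count S g)" if S: "set_mset S \<subseteq> insert g E" for S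
  proof -
    have "zero_sum S \<longleftrightarrow> seq_sum G S = \<one>" unfolding zero_sum_iff zero_sum_seqs_def sequences_def using S EV by auto
    also have "\<dots> \<longleftrightarrow> (\<forall>i<?s. int q dvd int (count S (e i)) + 1 * int (count S g))"
    proof -
      have "seq_sum G S = lin G e ?s (\<lambda>i. int (count S (e i)) + 1 * int (count S g))"
        by (rule seq_sum_insert_lin[OF _ inj g_def gn S[unfolded E_def]]) (rule eG)
      then show ?thesis by (simp only: independent_iff[OF ind])
    qed
    also have "\<dots> \<longleftrightarrow> (\<forall>i<?s. int q dvd int (count S (e i) + count S g))" by simp
    also have "\<dots> \<longleftrightarrow> (\<forall>u\<in>E. q dvd count S u + count S g)" unfolding E_def int_dvd_int_iff by auto
    finally show ?thesis .
  qed
  note L = lengths_rank[OF EV gE cE assms(3,2) zc refl, of N]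
  have "1 * N \<le> (q - 1) * N" using assms(2) by (intro mult_right_mono) auto
  then have "N \<le> (q - 1) * N" by simp
  then show "\<exists>S y k. zero_sum S \<and> N \<le> k \<and> lengths S = {y + M * i |i. i \<le> k}" using L by blast
qed

end

section \<open>The Davenport constant and sets of lengths containing 2\<close>

lemma (in congruence_seqs) atom_subset:
  "atom A \<Longrightarrow> zero_sum U \<Longrightarrow> U \<subseteq># A \<Longrightarrow> U = {#} \<or> U = A"
  unfolding atom_def by blast

text \<open>A crude bound for the Davenport constant, which guarantees that a longest atom
  exists.\<close>

lemma (in congruence_seqs) atom_size_le: assumes "atom A" shows "size A \<le> (\<Sum>g\<in>V. elt_order g)"
proof -
  have sub: "set_mset A \<subseteq> V" using zero_sum_set[OF atom_zero_sum[OF assms]] .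
  have "size A = (\<Sum>g\<in>set_mset A. count A g)" by (rule size_multiset_overloaded_eq)
  also have "\<dots> \<le> (\<Sum>g\<in>V. count A g)" by (rule sum_mono2[OF finV sub]) simp
  also have "\<dots> \<le> (\<Sum>g\<in>V. elt_order g)" using atom_count_le[OF assms] by (rule sum_mono)
  finally show ?thesis .
qed

lemma (in finite_comm_group) zero_sum_iff_seq_sum: "zero_sum S \<longleftrightarrow> set_mset S \<subseteq> carrier G \<and> seq_sum G S = \<one>"
  unfolding zero_sum_iff zero_sum_seqs_def sequences_def by simp

lemma (in finite_comm_group) zero_sum_single: "x \<in> carrier G \<Longrightarrow> zero_sum {#x#} \<longleftrightarrow> x = \<one>"
  using seq_sum_add_mset[of x "{#}"] unfolding zero_sum_iff_seq_sum by simp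

lemma (in finite_comm_group) size_ge_2:
  assumes "atom A" "\<one> \<notin># A" shows "size A \<ge> 2"
proof (rule ccontr)
  assume "\<not> ?thesis"
  moreover have "size A \<noteq> 0" using assms(1) by (simp add: atom_def)
  ultimately have "size A = 1" by linarith
  then obtain x where x: "A = {#x#}" using size_1_singleton_mset by blast
  have z: "zero_sum {#x#}" using atom_zero_sum[OF assms(1)] unfolding x .
  have "x \<in> carrier G" using zero_sum_set[OF z] by simp
  then have "x = \<one>" using zero_sum_single[of x] z by blast
  then show False using assms(2) x by simp
qed

lemma (in finite_comm_group) atom_one: assumes "atom A" "\<one> \<in># A" shows "A = {#\<one>#}"
proof -
  have "zero_sum {#\<one>#}" using zero_sum_single[OF one_closed] by blast
  moreover have "{#\<one>#} \<subseteq># A" using assms(2) by simp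
  ultimately have "{#\<one>#} = {#} \<or> {#\<one>#} = A" by (rule atom_subset[OF assms(1)])
  then show ?thesis by auto
qed

text \<open>If the neutral element does not occur, every atom has at least two terms, while
  \<open>S\<close>, a product of two atoms, has at most \<open>2 * D\<close>. If it occurs, one of
  the two atoms consists of it alone and cancels, which forces length 2; hence the maximum with
  2.\<close>

lemma (in finite_comm_group) length_two_bound:
  assumes D: "\<And>A. atom A \<Longrightarrow> size A \<le> D" and "2 \<in> lengths S" "l \<in> lengths S"
  shows "l \<le> max 2 D"
proof -
  obtain W where W: "factors W S" "size W = 2" using assms(2) unfolding lengths_def by auto
  obtain Z where Z: "factors Z S" "size Z = l" using assms(3) unfolding lengths_def by auto
  obtain A1 A2 where AW: "W = {#A1, A2#}"
  proof -
    obtain A1 W1 where 1: "W = add_mset A1 W1" using W(2) by (cases W) auto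
    then have "size W1 = 1" using W(2) by simp
    then obtain A2 where "W1 = {#A2#}" using size_1_singleton_mset by blast
    then have "W = {#A1, A2#}" using 1 by simp
    then show ?thesis by (rule that)
  qed
  have A: "atom A1" "atom A2" "S = A1 + A2" using W(1) unfolding AW factors_def by auto
  show ?thesis
  proof (cases "\<one> \<in># S")
    case False
    have at: "atom B" "size B \<ge> 2" if B: "B \<in># Z" for B
    proof -
      show a: "atom B" using Z(1) B by (simp add: factors_def)
      have "\<one> \<notin># B" using factors_mem_set[OF Z(1) B] False by blast
      then show "size B \<ge> 2" using size_ge_2 a by blast
    qed
    have sz: "size (\<Sum>\<^sub># T) = (\<Sum>B\<in>#T. size B)" for T :: "'a multiset multiset" by (induction T) auto
    have "(\<Sum>B\<in>#Z. 2) \<le> (\<Sum>B\<in>#Z. size B)" using at(2) by (intro sum_mset_mono) auto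
    then have "2 * size Z \<le> size (\<Sum>\<^sub># Z)" unfolding sz by (simp add: mult.commute)
    moreover have ZS: "\<Sum>\<^sub># Z = S" using Z(1) by (simp add: factors_def)
    ultimately have "2 * size Z \<le> size S" by (simp only: ZS)
    also have "\<dots> \<le> D + D" using D[OF A(1)] D[OF A(2)] A(3) by simp
    finally show ?thesis using Z(2) by simp
  next
    case True
    have *: "l = 2" if AB: "atom A" "atom B" "S = A + B" "\<one> \<in># A" for A B
    proof -
      have A1: "A = {#\<one>#}" using atom_one AB(1,4) by blast
      have "\<one> \<in># \<Sum>\<^sub># Z" using Z(1) True by (simp add: factors_def)
      then obtain C where C: "C \<in># Z" "\<one> \<in># C" by auto
      have "atom C" using Z(1) C(1) by (simp add: factors_def)
      then have "C = {#\<one>#}" using C(2) by (rule atom_one)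
      then have f: "factors (Z - {#{#\<one>#}#}) (S - {#\<one>#})"
        using factors_sub(2)[OF Z(1), of "{#{#\<one>#}#}"] C(1) by simp
      have SB: "S - {#\<one>#} = B" using AB(3) A1 by simp
      have "Z - {#{#\<one>#}#} = {#B#}" by (rule factors_of_atom[OF f[unfolded SB] AB(2)])
      then have "size (Z - {#{#\<one>#}#}) = 1" by simp
      then show "l = 2" using C(1) \<open>C = {#\<one>#}\<close> Z(2) by (simp add: size_Diff_singleton)
    qed
    have "\<one> \<in># A1 \<or> \<one> \<in># A2" using True A(3) by simp
    then have "l = 2" using *[OF A] *[OF A(2,1)] A(3) by (auto simp: add.commute)
    then show ?thesis by simp
  qed
qed

text \<open>The inverses of the terms of \<open>A\<close> form an atom too, and the product of both
  atoms can be regrouped into the pairs \<open>{#x, inv x#}\<close>. Together with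
  \<open>length_two_bound\<close> this makes the size of a longest atom visible in the sets of
  lengths that contain 2.\<close>

lemma (in finite_comm_group) atom_times_inverse:
  assumes A: "atom A" "size A \<ge> 2"
  shows "\<exists>S. zero_sum S \<and> 2 \<in> lengths S \<and> size A \<in> lengths S"
proof -
  have AG: "set_mset A \<subseteq> carrier G" using zero_sum_set[OF atom_zero_sum[OF A(1)]] .
  have one: "\<one> \<notin># A"
  proof
    assume "\<one> \<in># A"
    then have "A = {#\<one>#}" using atom_one A(1) by blast
    then show False using A(2) by simp
  qed
  let ?I = "image_mset (m_inv G)"
  have ss: "seq_sum G (?I S) = inv (seq_sum G S)" if "set_mset S \<subseteq> carrier G" for S
    using that
  proof (induction S)
    case (add x S)
    then have x: "x \<in> carrier G" "set_mset S \<subseteq> carrier G" by auto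
    have "set_mset (?I S) \<subseteq> carrier G" using x(2) by auto
    then have "seq_sum G (?I (add_mset x S)) = inv x \<otimes> inv (seq_sum G S)"
      using seq_sum_add_mset[of "inv x" "?I S"] x add.IH by simp
    then show ?case using seq_sum_add_mset[OF x] x seq_sum_closed[OF x(2)] by (simp add: inv_mult)
  qed simp
  have zI: "zero_sum (?I S)" if S: "zero_sum S" for S
  proof -
    have "set_mset S \<subseteq> carrier G" "seq_sum G S = \<one>" using S by (auto simp: zero_sum_iff_seq_sum)
    then show ?thesis using ss unfolding zero_sum_iff_seq_sum by auto
  qed
  have II: "?I (?I S) = S" if "set_mset S \<subseteq> carrier G" for S
  proof -
    have "image_mset (\<lambda>x. inv (inv x)) S = image_mset (\<lambda>x. x) S" using that by (intro image_mset_cong) auto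
    then show ?thesis by (simp add: image_mset.compositionality comp_def)
  qed
  have atI: "atom (?I A)" unfolding atom_def
  proof (intro conjI allI impI)
    show "zero_sum (?I A)" using zI atom_zero_sum[OF A(1)] .
    show "?I A \<noteq> {#}" using A(1) by (simp add: atom_def)
    fix U assume U: "zero_sum U" "U \<subseteq># ?I A"
    have "?I U \<subseteq># ?I (?I A)" using U(2) by (rule image_mset_subseteq_mono)
    then have "?I U \<subseteq># A" using II[OF AG] by simp
    then have "?I U = {#} \<or> ?I U = A" using atom_subset[OF A(1) zI[OF U(1)]] by blast
    then show "U = {#} \<or> U = ?I A"
    proof
      assume "?I U = A"
      then have "U = ?I A" using II[OF zero_sum_set[OF U(1)]] by simp
      then show ?thesis ..
    qed simp
  qed
  have pair: "atom {#x, inv x#}" if x: "x \<in># A" for x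
  proof -
    have xG: "x \<in> carrier G" "x \<noteq> \<one>" using x AG one by auto
    have ixG: "inv x \<in> carrier G" "inv x \<noteq> \<one>" using xG by (auto simp: inv_eq_1_iff)
    show ?thesis unfolding atom_def
    proof (intro conjI allI impI)
      show "zero_sum {#x, inv x#}" unfolding zero_sum_iff_seq_sum
        using xG ixG seq_sum_add_mset[of x "{#inv x#}"] seq_sum_add_mset[of "inv x" "{#}"] by simp
      fix U assume U: "zero_sum U" "U \<subseteq># {#x, inv x#}"
      show "U = {#} \<or> U = {#x, inv x#}"
      proof (rule ccontr)
        assume n: "\<not> ?thesis"
        have "size U \<noteq> 2"
        proof
          assume "size U = 2"
          then have "size ({#x, inv x#} - U) = 0" using size_Diff_submset[OF U(2)] by simp
          then have "{#x, inv x#} - U = {#}" by simp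
          then have "{#x, inv x#} \<subseteq># U" by (simp only: Diff_eq_empty_iff_mset)
          then have "U = {#x, inv x#}" using U(2) by (rule subset_mset.antisym[rotated])
          then show False using n by simp
        qed
        moreover have "size U \<le> 2" using size_mset_mono[OF U(2)] by simp
        moreover have "size U \<noteq> 0" using n by simp
        ultimately have "size U = 1" by linarith
        then obtain y where y: "U = {#y#}" using size_1_singleton_mset by blast
        then have "y \<in># {#x, inv x#}" using U(2) by simp
        then have "y = x \<or> y = inv x" by simp
        then have "y \<in> carrier G" "y \<noteq> \<one>" using xG ixG by metis+
        then show False using zero_sum_single[of y] U(1) y by blast
      qed
    qed simp
  qed
  let ?S = "A + ?I A"
  have "factors {#A, ?I A#} ?S" using A(1) atI by (auto simp: factors_def)
  then have 2: "2 \<in> lengths ?S" unfolding lengths_def by force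
  let ?Z = "image_mset (\<lambda>x. {#x, inv x#}) A"
  have "\<Sum>\<^sub># (image_mset (\<lambda>x. {#x, inv x#}) T) = T + ?I T" for T by (induction T) auto
  then have "factors ?Z ?S" using pair by (auto simp: factors_def)
  then have "size A \<in> lengths ?S" unfolding lengths_def by force
  moreover have "zero_sum ?S" using zero_sum_add[OF atom_zero_sum[OF A(1)] atom_zero_sum[OF atI]] .
  ultimately show ?thesis using 2 by blast
qed

text \<open>The Davenport constant is strictly monotone: an element outside the image allows one
  to split a term of a longest atom.\<close>
theorem system_of_sets_of_lengths_neq:
  fixes G :: "('a, 'c) monoid_scheme" and G' :: "('b, 'd) monoid_scheme"
  assumes fG: "finite_comm_group G" and fG': "finite_comm_group G'"
    and hom: "\<phi> \<in> hom G G'" and inj: "inj_on \<phi> (carrier G)"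
    and y: "y \<in> carrier G'" "y \<notin> \<phi> ` carrier G" and g: "g \<in> carrier G" "g \<noteq> \<one>\<^bsub>G\<^esub>"
  shows "system_of_sets_of_lengths G \<noteq> system_of_sets_of_lengths G'"
proof
  assume eq: "system_of_sets_of_lengths G = system_of_sets_of_lengths G'"
  interpret A: finite_comm_group G by (rule fG)
  interpret B: finite_comm_group G' by (rule fG')
  interpret h: group_hom G G' \<phi> by (intro group_hom.intro group_hom_axioms.intro A.is_group B.is_group hom)
  let ?f = "image_mset \<phi>"
  have fcl: "set_mset (?f S) \<subseteq> carrier G'" if "set_mset S \<subseteq> carrier G" for S using that h.hom_closed by auto
  have ss: "seq_sum G' (?f S) = \<phi> (seq_sum G S)" if "set_mset S \<subseteq> carrier G" for S
    using that
  proof (induction S)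
    case (add x S)
    then have x: "x \<in> carrier G" "set_mset S \<subseteq> carrier G" by auto
    have "seq_sum G' (?f (add_mset x S)) = \<phi> x \<otimes>\<^bsub>G'\<^esub> \<phi> (seq_sum G S)"
      using B.seq_sum_add_mset[OF h.hom_closed[OF x(1)] fcl[OF x(2)]] add.IH[OF x(2)] by simp
    then show ?case using A.seq_sum_add_mset[OF x] x A.seq_sum_closed[OF x(2)] by simp
  qed simp
  have phi1: "\<phi> x = \<one>\<^bsub>G'\<^esub> \<longleftrightarrow> x = \<one>\<^bsub>G\<^esub>" if "x \<in> carrier G" for x
    using inj_on_eq_iff[OF inj that A.one_closed] by simp
  have zf: "B.zero_sum (?f S) \<longleftrightarrow> A.zero_sum S" if S: "set_mset S \<subseteq> carrier G" for S
    unfolding A.zero_sum_iff_seq_sum B.zero_sum_iff_seq_sum ss[OF S] using S fcl[OF S] phi1[OF A.seq_sum_closed[OF S]] by simp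
  obtain A0 where A0: "A.atom A0" and max: "\<And>A. A.atom A \<Longrightarrow> size A \<le> size A0"
    using ex_has_greatest_nat[of A.atom "A.ord_power g" size "Suc (\<Sum>g\<in>carrier G. A.elt_order g)"] A.atom_ord_power[OF g(1)]
      A.atom_size_le by (metis less_Suc_eq_le)
  have A0G: "set_mset A0 \<subseteq> carrier G" using A.zero_sum_set[OF A.atom_zero_sum[OF A0]] .
  have s2: "size A0 \<ge> 2"
  proof -
    have "\<one>\<^bsub>G\<^esub> \<notin># A.ord_power g" using A.set_ord_power[OF g(1)] g(2) by auto
    then have "2 \<le> size (A.ord_power g)" using A.size_ge_2 A.atom_ord_power[OF g(1)] by blast
    also have "\<dots> \<le> size A0" using max A.atom_ord_power[OF g(1)] by blast
    finally show ?thesis .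
  qed
  obtain a T where T: "A0 = add_mset a T" using s2 by (cases A0) auto
  have aG: "a \<in> carrier G" and TG: "set_mset T \<subseteq> carrier G" using A0G T by auto
  \<comment> \<open>The term \<open>\<phi> a\<close> is replaced by the two terms \<open>y\<close>
    and \<open>y'\<close>, whose product is \<open>\<phi> a\<close> and which both lie outside the
    image.\<close>
  define y' where "y' = \<phi> a \<otimes>\<^bsub>G'\<^esub> inv\<^bsub>G'\<^esub> y"
  have y': "y' \<in> carrier G'" using y(1) aG by (simp add: y'_def)
  have yy': "y \<otimes>\<^bsub>G'\<^esub> y' = \<phi> a"
    using y(1) aG by (simp add: y'_def B.m_comm[of "\<phi> a" "inv\<^bsub>G'\<^esub> y"] B.m_assoc[symmetric])
  have img: "\<phi> x \<otimes>\<^bsub>G'\<^esub> \<phi> z \<in> \<phi> ` carrier G" "inv\<^bsub>G'\<^esub> (\<phi> x) \<in> \<phi> ` carrier G" if "x \<in> carrier G" "z \<in> carrier G" for x z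
  proof -
    have "\<phi> x \<otimes>\<^bsub>G'\<^esub> \<phi> z = \<phi> (x \<otimes>\<^bsub>G\<^esub> z)" using that by simp
    then show "\<phi> x \<otimes>\<^bsub>G'\<^esub> \<phi> z \<in> \<phi> ` carrier G" by (rule image_eqI) (use that in simp)
    have "inv\<^bsub>G'\<^esub> (\<phi> x) = \<phi> (inv\<^bsub>G\<^esub> x)" using that by simp
    then show "inv\<^bsub>G'\<^esub> (\<phi> x) \<in> \<phi> ` carrier G" by (rule image_eqI) (use that in simp)
  qed
  have y'n: "y' \<notin> \<phi> ` carrier G"
  proof
    assume "y' \<in> \<phi> ` carrier G"
    then obtain x where x: "x \<in> carrier G" "y' = \<phi> x" by blast
    have "y = \<phi> a \<otimes>\<^bsub>G'\<^esub> inv\<^bsub>G'\<^esub> y'"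
    proof -
      have "\<phi> a \<otimes>\<^bsub>G'\<^esub> inv\<^bsub>G'\<^esub> y' = (y \<otimes>\<^bsub>G'\<^esub> y') \<otimes>\<^bsub>G'\<^esub> inv\<^bsub>G'\<^esub> y'" by (simp only: yy')
      also have "\<dots> = y" using y(1) y' by (simp add: B.m_assoc)
      finally show ?thesis by (rule sym)
    qed
    also have "\<dots> = \<phi> (a \<otimes>\<^bsub>G\<^esub> inv\<^bsub>G\<^esub> x)" using x aG by simp
    finally have "y \<in> \<phi> ` carrier G" by (rule image_eqI) (use aG x(1) in simp)
    then show False using y(2) by blast
  qed
  define W where "W = {#y, y'#} + ?f T"
  have WG: "set_mset W \<subseteq> carrier G'" using y(1) y' fcl[OF TG] by (simp add: W_def)
  have sum2: "seq_sum G' ({#y, y'#} + ?f S) = \<phi> (seq_sum G (add_mset a S))" if S: "set_mset S \<subseteq> carrier G" for S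
  proof -
    have "seq_sum G' ({#y, y'#} + ?f S) = y \<otimes>\<^bsub>G'\<^esub> (y' \<otimes>\<^bsub>G'\<^esub> \<phi> (seq_sum G S))"
      using B.seq_sum_add_mset[of y "add_mset y' (?f S)"] B.seq_sum_add_mset[of y' "?f S"] y(1) y' fcl[OF S] ss[OF S] by simp
    also have "\<dots> = (y \<otimes>\<^bsub>G'\<^esub> y') \<otimes>\<^bsub>G'\<^esub> \<phi> (seq_sum G S)"
      using y(1) y' A.seq_sum_closed[OF S] by (simp add: B.m_assoc)
    also have "\<dots> = \<phi> (a \<otimes>\<^bsub>G\<^esub> seq_sum G S)" unfolding yy' using aG A.seq_sum_closed[OF S] by simp
    also have "a \<otimes>\<^bsub>G\<^esub> seq_sum G S = seq_sum G (add_mset a S)" using A.seq_sum_add_mset[OF aG S] by simp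
    finally show ?thesis .
  qed
  have sum1: "seq_sum G' (add_mset w (?f S)) \<noteq> \<one>\<^bsub>G'\<^esub>"
    if S: "set_mset S \<subseteq> carrier G" and w: "w \<in> carrier G'" "w \<notin> \<phi> ` carrier G" for S w
  proof
    assume "seq_sum G' (add_mset w (?f S)) = \<one>\<^bsub>G'\<^esub>"
    then have "w \<otimes>\<^bsub>G'\<^esub> \<phi> (seq_sum G S) = \<one>\<^bsub>G'\<^esub>" using B.seq_sum_add_mset[OF w(1) fcl[OF S]] ss[OF S] by simp
    then have "inv\<^bsub>G'\<^esub> (\<phi> (seq_sum G S)) = w" using w(1) A.seq_sum_closed[OF S] by (intro B.inv_equality) auto
    then show False using img(2)[OF A.seq_sum_closed[OF S] A.one_closed] w(2) by simp
  qed
  have "B.atom W" unfolding B.atom_def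
  proof (intro conjI allI impI)
    have "seq_sum G' W = \<one>\<^bsub>G'\<^esub>"
      using sum2[OF TG] A.atom_zero_sum[OF A0] unfolding W_def T[symmetric] A.zero_sum_iff_seq_sum by simp
    then show "B.zero_sum W" using WG unfolding B.zero_sum_iff_seq_sum by simp
    show "W \<noteq> {#}" by (simp add: W_def)
    fix U assume U: "B.zero_sum U" "U \<subseteq># W"
    \<comment> \<open>A zero-sum part \<open>U\<close> of \<open>W\<close> contains none, one or
      both of the two new terms. With none or both it comes from a zero-sum part of
      \<open>A0\<close>; with exactly one its sum cannot be neutral, because the remaining terms lie
      in the image.\<close>
    define U1 where "U1 = filter_mset (\<lambda>u. u \<notin> \<phi> ` carrier G) U"
    define U2 where "U2 = filter_mset (\<lambda>u. u \<in> \<phi> ` carrier G) U"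
    have UU: "U = U1 + U2" unfolding U1_def U2_def using multiset_partition[of U "\<lambda>u. u \<notin> \<phi> ` carrier G"] by simp
    have fW1: "filter_mset (\<lambda>u. u \<notin> \<phi> ` carrier G) W = {#y, y'#}"
    proof -
      have "filter_mset (\<lambda>u. u \<notin> \<phi> ` carrier G) (?f T) = filter_mset (\<lambda>_. False) (?f T)"
        using TG by (intro filter_mset_cong refl) auto
      then show ?thesis using y(2) y'n by (simp add: W_def)
    qed
    have fW2: "filter_mset (\<lambda>u. u \<in> \<phi> ` carrier G) W = ?f T"
    proof -
      have "filter_mset (\<lambda>u. u \<in> \<phi> ` carrier G) (?f T) = filter_mset (\<lambda>_. True) (?f T)"
        using TG by (intro filter_mset_cong refl) auto
      then show ?thesis using y(2) y'n by (simp add: W_def)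
    qed
    have U1: "U1 \<subseteq># {#y, y'#}" unfolding U1_def fW1[symmetric] using U(2) by (rule multiset_filter_mono)
    have U2: "U2 \<subseteq># ?f T" unfolding U2_def fW2[symmetric] using U(2) by (rule multiset_filter_mono)
    define T2 where "T2 = image_mset (inv_into (carrier G) \<phi>) U2"
    have "image_mset (inv_into (carrier G) \<phi>) (?f T) = T"
    proof -
      have "image_mset (\<lambda>x. inv_into (carrier G) \<phi> (\<phi> x)) T = image_mset (\<lambda>x. x) T"
        using TG inj by (intro image_mset_cong) (auto simp: inv_into_f_f)
      then show ?thesis by (simp add: image_mset.compositionality comp_def)
    qed
    then have T2T: "T2 \<subseteq># T" unfolding T2_def using image_mset_subseteq_mono[OF U2] by metis
    have fT2: "?f T2 = U2"
    proof -
      have "image_mset (\<lambda>x. \<phi> (inv_into (carrier G) \<phi> x)) U2 = image_mset (\<lambda>x. x) U2"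
        unfolding U2_def by (intro image_mset_cong) (auto simp: f_inv_into_f)
      then show ?thesis by (simp add: T2_def image_mset.compositionality comp_def)
    qed
    have T2G: "set_mset T2 \<subseteq> carrier G" using set_mset_mono[OF T2T] TG by blast
    have zU: "seq_sum G' (U1 + ?f T2) = \<one>\<^bsub>G'\<^esub>" using U(1) unfolding fT2 UU[symmetric] B.zero_sum_iff_seq_sum by simp
    have "size U1 \<le> 2" using size_mset_mono[OF U1] by simp
    then consider "size U1 = 0" | "size U1 = 1" | "size U1 = 2" by linarith
    then show "U = {#} \<or> U = W"
    proof cases
      case 1
      then have "U1 = {#}" by simp
      then have "B.zero_sum (?f T2)" using U(1) fT2 UU by simp
      then have "A.zero_sum T2" using zf[OF T2G] by simp
      moreover have "T2 \<subseteq># A0" 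
      proof (rule subset_mset.order_trans[OF T2T])
        show "T \<subseteq># A0" unfolding T by (simp add: subset_mset.less_imp_le)
      qed
      ultimately have "T2 = {#} \<or> T2 = A0" by (rule A.atom_subset[OF A0])
      moreover have "T2 \<noteq> A0" using size_mset_mono[OF T2T] T by auto
      ultimately show ?thesis using fT2 UU \<open>U1 = {#}\<close> by simp
    next
      case 2
      then obtain w where w: "U1 = {#w#}" using size_1_singleton_mset by blast
      then have "w \<in># {#y, y'#}" using U1 by simp
      then have "w \<in> carrier G'" "w \<notin> \<phi> ` carrier G" using y y' y'n by auto
      then show ?thesis using sum1[OF T2G] zU w by simp
    next
      case 3
      then have "size ({#y, y'#} - U1) = 0" using size_Diff_submset[OF U1] by simp
      then have "{#y, y'#} - U1 = {#}" by simp
      then have "{#y, y'#} \<subseteq># U1" by (simp only: Diff_eq_empty_iff_mset)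
      then have U1e: "U1 = {#y, y'#}" using U1 by (rule subset_mset.antisym[rotated])
      then have "\<phi> (seq_sum G (add_mset a T2)) = \<one>\<^bsub>G'\<^esub>" using zU sum2[OF T2G] by simp
      moreover have aT2: "set_mset (add_mset a T2) \<subseteq> carrier G" using T2G aG by simp
      ultimately have "A.zero_sum (add_mset a T2)" unfolding A.zero_sum_iff_seq_sum using phi1[OF A.seq_sum_closed[OF aT2]] by simp
      moreover have "add_mset a T2 \<subseteq># A0" unfolding T using T2T by simp
      ultimately have "add_mset a T2 = {#} \<or> add_mset a T2 = A0" by (rule A.atom_subset[OF A0])
      then have "add_mset a T2 = A0" by simp
      then have "T2 = T" using T by simp
      then have "U = W" using UU U1e fT2 by (simp add: W_def)
      then show ?thesis ..
    qed
  qed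
  moreover have sW: "size W = size A0 + 1" by (simp add: W_def T)
  ultimately obtain S where S: "B.zero_sum S" "2 \<in> B.lengths S" "size A0 + 1 \<in> B.lengths S"
    using B.atom_times_inverse[of W] s2 by auto
  have "B.lengths S \<in> system_of_sets_of_lengths G'"
    unfolding system_of_sets_of_lengths_def B.lengths_eq using S(1) B.zero_sum_iff by blast
  then have "B.lengths S \<in> system_of_sets_of_lengths G" by (simp only: eq)
  then obtain S' where S': "A.lengths S' = B.lengths S" unfolding system_of_sets_of_lengths_def A.lengths_eq by auto
  \<comment> \<open>This contradicts \<open>size A0 \<ge> 2\<close>, which holds because
    \<open>G\<close> has an element other than the neutral one.\<close>
  have "size A0 + 1 \<le> max 2 (size A0)"
    by (rule A.length_two_bound[of "size A0" S']) (use max S S' in auto)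
  then show False using s2 by simp
qed

section \<open>Orders, ranks and powers of the largest cyclic factor\<close>

lemma card_carrier_cyclic_sum:
  assumes "\<forall>n\<in>set ns. 0 < n" shows "card (carrier (cyclic_sum ns)) = prod_list ns"
proof -
  have "card (carrier (cyclic_sum ns)) = (\<Prod>i<length ns. card {0..<int (ns ! i)})"
    unfolding carrier_cyclic_sum[OF assms] by (simp only: card_PiE finite_lessThan)
  also have "\<dots> = prod_list ns" by (simp add: prod.list_conv_set_nth lessThan_atLeast0)
  finally show ?thesis .
qed

lemma prod_list_replicate_eq: "prod_list (replicate k n) = (n :: nat) ^ k"
  by (induction k) auto

lemma prod_list_le_power: "(\<forall>x\<in>set xs. x \<le> (n :: nat)) \<Longrightarrow> prod_list xs \<le> n ^ length xs"
  by (induction xs) (auto intro: mult_le_mono)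

context finite_comm_group begin

lemma card_carrier_le: "card (carrier G) \<le> group_exponent G ^ group_rank G"
proof -
  have "card (carrier G) = card (carrier (cyclic_sum (invariant_factors G)))"
    using coord_iso bij_betw_same_card unfolding iso_def by blast
  also have "\<dots> = prod_list (invariant_factors G)" by (rule card_carrier_cyclic_sum[OF factors_pos])
  also have "\<dots> \<le> group_exponent G ^ group_rank G" unfolding group_rank_def
  proof (rule prod_list_le_power, rule ballI)
    fix x assume "x \<in> set (invariant_factors G)"
    then have "x dvd group_exponent G" unfolding group_exponent_def using sorted_wrt_dvd_last[OF factors(2)] by blast
    then show "x \<le> group_exponent G" using n_pos by (rule dvd_imp_le)
  qed
  finally show ?thesis .
qed

lemma exponent_power_subgroup_card:
  assumes "subgroup H G" "G\<lparr>carrier := H\<rparr> \<cong> cyclic_power (group_exponent G) k"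
  shows "card H = group_exponent G ^ k"
proof -
  have "card (carrier (G\<lparr>carrier := H\<rparr>)) = card (carrier (cyclic_power (group_exponent G) k))"
    using assms(2) unfolding is_iso_def iso_def using bij_betw_same_card by blast
  also have "\<dots> = prod_list (replicate k (group_exponent G))"
    unfolding cyclic_power_def by (rule card_carrier_cyclic_sum) (use n_pos in simp)
  finally show ?thesis by (simp add: prod_list_replicate_eq)
qed

text \<open>Comparison of orders: with exponent \<open>n\<close> and rank \<open>r\<close>, the
  subgroup has \<open>n ^ k\<close> elements, and \<open>G\<close> has at most \<open>n ^ r\<close>
  because every invariant factor divides \<open>n\<close>. For \<open>k = r\<close> the subgroup is
  therefore everything.\<close>

lemma exponent_power_le_rank:
  assumes "has_subgroup_iso G (cyclic_power (group_exponent G) k)" "group_exponent G \<ge> 2"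
  shows "k \<le> group_rank G"
    "k = group_rank G \<Longrightarrow> G \<cong> cyclic_power (group_exponent G) k"
proof -
  obtain H where H: "subgroup H G" "G\<lparr>carrier := H\<rparr> \<cong> cyclic_power (group_exponent G) k"
    using assms(1) unfolding has_subgroup_iso_def by blast
  have c: "card H = group_exponent G ^ k" by (rule exponent_power_subgroup_card[OF H])
  have HG: "H \<subseteq> carrier G" using subgroup.subset[OF H(1)] .
  have "card H \<le> card (carrier G)" by (rule card_mono[OF finite_carrier HG])
  then have le: "group_exponent G ^ k \<le> group_exponent G ^ group_rank G" using c card_carrier_le by simp
  show "k \<le> group_rank G" by (rule power_le_imp_le_exp[OF _ le]) (use assms(2) in simp)
  assume k: "k = group_rank G"
  have "card (carrier G) \<le> card H" using c card_carrier_le k by simp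
  then have "H = carrier G" using card_seteq[OF finite_carrier HG] by simp
  then show "G \<cong> cyclic_power (group_exponent G) k" using H(2) by simp
qed

text \<open>The first invariant factor \<open>q\<close> divides every invariant factor
  \<open>n_i\<close>, so raising the generators to the powers \<open>n_i div q\<close> gives
  independent elements of the common order \<open>q\<close>, of which \<open>M + 1\<close> are
  taken.\<close>

lemma rank_progressions:
  assumes "1 \<le> M" "M + 1 \<le> group_rank G" shows "long_progression G M"
proof -
  let ?ns = "invariant_factors G"
  have "has_subgroup_iso G (cyclic_sum ?ns)"
    unfolding has_subgroup_iso_def using factors(3) subgroup_self by (intro exI[of _ "carrier G"]) simp
  then obtain e where e: "independent G e ?ns" using independent_of_has_subgroup_iso factors_pos by blast
  define s where "s = M + 1"
  have len: "s \<le> length ?ns" "s \<ge> 1" using assms(2) by (simp_all add: group_rank_def s_def)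
  have e': "independent G e (take s ?ns)" by (rule independent_take[OF e len(1)])
  moreover have lt: "length (take s ?ns) = s" using len(1) by simp
  ultimately have "\<forall>z. lin G e s z = \<one> \<longleftrightarrow> (\<forall>i<s. int (?ns ! i) dvd z i)"
    unfolding independent_def lt by simp
  note el = this[rule_format]
  define q where "q = ?ns ! 0"
  have "?ns ! 0 \<in> set ?ns" by (rule nth_mem) (use len in linarith)
  then have "1 < ?ns ! 0" using factors(1) by blast
  then have q2: "q \<ge> 2" by (simp add: q_def)
  have qd: "q dvd ?ns ! i" if "i < length ?ns" for i
    using sorted_wrt_nth_less[OF factors(2), of 0 i] that by (cases i) (auto simp: q_def)
  have eG: "\<And>i. i < length ?ns \<Longrightarrow> e i \<in> carrier G" using e by (simp add: independent_def)
  define f where "f i = e i [^] (int (?ns ! i div q))" for i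
  have lf: "lin G f s x = lin G e s (\<lambda>i. int (?ns ! i div q) * x i)" if "s \<le> length ?ns" for s x
    using that by (induction s) (auto simp: f_def int_pow_pow eG)
  have "independent G f (replicate s q)" unfolding independent_def
  proof (intro conjI allI impI)
    show "f i \<in> carrier G" if "i < length (replicate s q)" for i using that eG len by (simp add: f_def)
    fix x
    have "lin G f s x = \<one> \<longleftrightarrow> (\<forall>i<s. int (?ns ! i) dvd int (?ns ! i div q) * x i)"
      unfolding lf[OF len(1)] by (rule el)
    also have "\<dots> \<longleftrightarrow> (\<forall>i<s. int q dvd x i)"
    proof -
      have "int (?ns ! i) dvd int (?ns ! i div q) * x i \<longleftrightarrow> int q dvd x i" if i: "i < s" for i
      proof -
        have il: "i < length ?ns" using i len by simp
        obtain c where c: "?ns ! i = q * c" using qd[OF il] by (rule dvdE)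
        have "?ns ! i > 0" using factors_pos nth_mem[OF il] by blast
        then have c0: "c > 0" using c by (auto intro: gr0I)
        have "?ns ! i div q = c" using c q2 by simp
        then have "int (?ns ! i) dvd int (?ns ! i div q) * x i \<longleftrightarrow> int c * int q dvd int c * x i"
          using c by (simp add: mult.commute)
        also have "\<dots> \<longleftrightarrow> int q dvd x i" using c0 by simp
        finally show ?thesis .
      qed
      then show ?thesis by simp
    qed
    finally show "(lin G f (length (replicate s q)) x = \<one>) =
      (\<forall>i<length (replicate s q). int (replicate s q ! i) dvd x i)" by simp
  qed
  then show ?thesis unfolding s_def by (rule long_progression_rank[OF _ q2 assms(1)])
qed

lemma exponent_progressions:
  assumes "max_exponent_power G k" "1 \<le> M" "M + 2 \<le> group_exponent G" "group_exponent G \<le> M + k + 1"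
  shows "long_progression G M"
proof -
  let ?n = "group_exponent G"
  have "has_subgroup_iso G (cyclic_sum (replicate k ?n))" using assms(1) unfolding max_exponent_power_def cyclic_power_def by blast
  then obtain e where e: "independent G e (replicate k ?n)" using independent_of_has_subgroup_iso[of "replicate k ?n"] n_pos by auto
  \<comment> \<open>The two bounds on \<open>M\<close> say exactly that \<open>1 \<le> s\<close> and
    \<open>s \<le> k\<close>.\<close>
  define s where "s = ?n - M - 1"
  have s: "1 \<le> s" "s \<le> k" "?n = M + s + 1" using assms(3,4) by (auto simp: s_def)
  have "independent G e (take s (replicate k ?n))" by (rule independent_take[OF e]) (use s in simp)
  then have "independent G e (replicate s ?n)" using s(2) by (simp add: min_def)
  then show ?thesis using long_progression_exponent s assms(2) by blast
qed

lemma progressions_upper: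
  assumes "max_exponent_power G k" "long_progression G M" "1 \<le> M" "group_rank G \<le> M" "group_exponent G \<le> 2 * M + 1"
  shows "M + 2 \<le> group_exponent G" "group_exponent G \<le> M + k + 1"
proof -
  let ?n = "group_exponent G"
  have u: "M + 2 \<le> ?n" "has_subgroup_iso G (cyclic_power ?n (?n - M - 1))"
    using long_progression_upper[OF assms(2-5)] by auto
  then show "M + 2 \<le> ?n" by simp
  have "1 \<le> ?n - M - 1" using u(1) by simp
  then have "?n - M - 1 \<le> k" using assms(1) u(2) unfolding max_exponent_power_def by blast
  then show "?n \<le> M + k + 1" by simp
qed

end

section \<open>Comparison of the two groups\<close>

theorem theorem1p2:
  fixes G :: "('a, 'c) monoid_scheme" and G' :: "('b, 'd) monoid_scheme"
    and k k' :: nat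
  assumes "comm_group G" and "finite (carrier G)"
    and "comm_group G'" and "finite (carrier G')"
    and "max_exponent_power G k" and "max_exponent_power G' k'"
    and "int (group_rank G) + int k \<le> int (group_exponent G) - 2"
    and "\<not> G \<cong> cyclic_power (2 * group_rank G + 2) (group_rank G)"
    and "system_of_sets_of_lengths G = system_of_sets_of_lengths G'"
  shows "group_exponent G = group_exponent G' \<and> k = k' \<and>
    (group_rank G \<ge> group_exponent G div 2 + 1 \<longrightarrow> group_rank G = group_rank G') \<and>
    (G \<cong> cyclic_power (group_exponent G) (group_rank G) \<longrightarrow> G \<cong> G')"
proof -
  have fG: "finite_comm_group G" and fG': "finite_comm_group G'"
    using assms(1-4) by (simp_all add: finite_comm_group_def finite_comm_group_axioms_def)
  interpret A: finite_comm_group G by (rule fG)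
  interpret B: finite_comm_group G' by (rule fG')
  let ?n = "group_exponent G" and ?r = "group_rank G" and ?n' = "group_exponent G'" and ?r' = "group_rank G'"
  define P where "P = long_progression G"
  have P': "P = long_progression G'" unfolding P_def long_progression_def assms(9) ..
  have rk: "?r + k + 2 \<le> ?n" using assms(7) by linarith
  have k1: "1 \<le> k" "1 \<le> k'" using assms(5,6) by (auto simp: max_exponent_power_def)
  have sub: "has_subgroup_iso G (cyclic_power ?n k)" using assms(5) by (simp add: max_exponent_power_def)
  have n2: "?n \<ge> 2" using rk by linarith
  have kr: "k \<le> ?r" by (rule A.exponent_power_le_rank(1)[OF sub n2])
  \<comment> \<open>As \<open>k \<le> ?r\<close>, the bound \<open>?r + k + 2 \<le> ?n\<close> gives
    this except for \<open>k = ?r\<close> and \<open>?n = 2 * ?r + 2\<close>, which is the excluded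
    group. It is equivalent to \<open>?n \<le> 2 * M0 + 1\<close> for the number
    \<open>M0 = ?n - k - 2\<close> below.\<close>
  have exc: "2 * k + 3 \<le> ?n"
  proof (rule ccontr)
    assume "\<not> ?thesis"
    then have "k = ?r" "?n = 2 * ?r + 2" using rk kr by linarith+
    then show False using A.exponent_power_le_rank(2)[OF sub n2] assms(8) by metis
  qed
  have lowr: "P M" if "1 \<le> M" "M + 1 \<le> ?r" for M using A.rank_progressions that unfolding P_def by blast
  have lowr': "P M" if "1 \<le> M" "M + 1 \<le> ?r'" for M using B.rank_progressions that unfolding P' by blast
  have lowk: "P M" if "1 \<le> M" "M + 2 \<le> ?n" "?n \<le> M + k + 1" for M
    using A.exponent_progressions[OF assms(5)] that unfolding P_def by blast
  have lowk': "P M" if "1 \<le> M" "M + 2 \<le> ?n'" "?n' \<le> M + k' + 1" for M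
    using B.exponent_progressions[OF assms(6)] that unfolding P' by blast
  have up: "M + 2 \<le> ?n \<and> ?n \<le> M + k + 1" if "P M" "1 \<le> M" "?r \<le> M" "?n \<le> 2 * M + 1" for M
    using A.progressions_upper[OF assms(5)] that unfolding P_def by blast
  have up': "M + 2 \<le> ?n' \<and> ?n' \<le> M + k' + 1" if "P M" "1 \<le> M" "?r' \<le> M" "?n' \<le> 2 * M + 1" for M
    using B.progressions_upper[OF assms(6)] that unfolding P' by blast
  \<comment> \<open>The number just below the interval from \<open>?n - k - 1\<close> to
    \<open>?n - 2\<close>. The hypothesis on rank plus \<open>k\<close> is precisely
    \<open>?r \<le> M0\<close>, so the converse applies to \<open>M0\<close> and excludes
    it.\<close>
  define M0 where "M0 = ?n - k - 2"
  have M0: "M0 + k + 2 = ?n" "1 \<le> M0" "?r \<le> M0" using rk k1 kr by (auto simp: M0_def)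
  have gap: "\<not> P M0"
  proof
    assume "P M0"
    then have "?n \<le> M0 + k + 1" using up[of M0] M0 exc by linarith
    then show False using M0 by linarith
  qed
  have big: "\<not> P M" if "M + 1 \<ge> ?n" for M
  proof
    assume "P M"
    moreover have "1 \<le> M" "?r \<le> M" "?n \<le> 2 * M + 1" using that rk k1 by linarith+
    ultimately show False using up[of M] that by linarith
  qed
  \<comment> \<open>If \<open>?n < ?n'\<close>, then \<open>?n' - 2\<close> has long progressions by
    \<open>lowk'\<close> but is at least \<open>?n - 1\<close>, which \<open>big\<close>
    excludes.\<close>
  have n'le: "?n' \<le> ?n"
  proof (rule ccontr)
    assume "\<not> ?thesis"
    then have "P (?n' - 2)" using n2 k1 by (intro lowk') auto
    then show False using big[of "?n' - 2"] \<open>\<not> ?n' \<le> ?n\<close> by simp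
  qed
  have nn: "?n' = ?n"
  proof (rule ccontr)
    assume "?n' \<noteq> ?n"
    then have lt: "?n' < ?n" using n'le by simp
    have "P (?n - 2)" by (rule lowk) (use rk k1 in linarith)+
    moreover have "1 \<le> ?n - 2" "?n' \<le> 2 * (?n - 2) + 1" using rk k1 lt kr by linarith+
    \<comment> \<open>The converse for \<open>G'\<close> at \<open>?n - 2\<close> can fail only
      through a large rank. But then the numbers from 1 to \<open>?r' - 1\<close> include
      \<open>M0\<close>, against \<open>gap\<close>.\<close>
    ultimately have "\<not> ?r' \<le> ?n - 2" using up'[of "?n - 2"] lt by linarith
    then have "P M0" using M0 k1 by (intro lowr') linarith+
    then show False using gap by blast
  qed
  have k_eq: "k' = k"
  proof (rule ccontr)
    assume "k' \<noteq> k"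
    then consider "k < k'" | "k' < k" by linarith
    then show False
    proof cases
      case 1
      have "P M0" by (rule lowk') (use 1 M0 nn in linarith)+
      then show False using gap by blast
    next
      case 2
      \<comment> \<open>This is the lower end \<open>?n - k - 1\<close> of the interval for
        \<open>G\<close>; for \<open>k' < k\<close> it lies below the interval for
        \<open>G'\<close>.\<close>
      let ?M = "M0 + 1"
      have PM: "P ?M" by (rule lowk) (use M0 k1 in linarith)+
      show False
      proof (cases "?r' \<le> ?M")
        case True
        have "2 * M0 + 2 * k + 4 = 2 * ?n" using M0(1) by simp
        then have "1 \<le> ?M" "?n' \<le> 2 * ?M + 1" using nn exc by simp_all
        then have "?n' \<le> ?M + k' + 1" using up'[OF PM _ True] by blast
        then show False using 2 M0 nn by linarith
      next
        case False
        then have "P M0" using M0 by (intro lowr') linarith+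
        then show False using gap by blast
      qed
    qed
  qed
  \<comment> \<open>The bound on \<open>?r\<close> amounts to
    \<open>?n \<le> 2 * (?r - 1) + 1\<close>, the range of the converse at \<open>?r - 1\<close>.
    Whichever rank is larger produces a number, \<open>?r\<close> or \<open>?r - 1\<close>, that is
    at least the smaller rank but below \<open>?n - k - 1\<close>, so the converse for the group of
    smaller rank rules it out.\<close>
  have one: "?r = ?r'" if r: "?r \<ge> ?n div 2 + 1"
  proof (rule ccontr)
    assume "?r \<noteq> ?r'"
    then consider "?r < ?r'" | "?r' < ?r" by linarith
    then show False
    proof cases
      case 1
      have "P ?r" by (rule lowr') (use 1 k1 kr in linarith)+
      then have "?n \<le> ?r + k + 1" using up[of ?r] r k1 kr by linarith
      then show False using rk by linarith
    next
      case 2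
      let ?M = "?r - 1"
      have r2: "?r \<ge> 2" using r n2 by linarith
      have "P ?M" by (rule lowr) (use r2 in linarith)+
      moreover have "1 \<le> ?M" "?r' \<le> ?M" "?n' \<le> 2 * ?M + 1" using r2 2 r nn by linarith+
      ultimately have "?n' \<le> ?M + k' + 1" using up'[of ?M] by blast
      then show False using rk nn k_eq r2 by linarith
    qed
  qed
  have two: "G \<cong> G'" if iso: "G \<cong> cyclic_power ?n ?r"
  proof -
    have "has_subgroup_iso G (cyclic_power ?n ?r)"
      unfolding has_subgroup_iso_def using iso A.subgroup_self by (intro exI[of _ "carrier G"]) simp
    then have "?r \<le> k" using assms(5) k1 kr unfolding max_exponent_power_def by auto
    then have "k' = ?r" using kr k_eq by simp
    then have "has_subgroup_iso G' (cyclic_power ?n ?r)" using assms(6) nn unfolding max_exponent_power_def by simp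
    then obtain H where H: "subgroup H G'" "G'\<lparr>carrier := H\<rparr> \<cong> cyclic_power ?n ?r" unfolding has_subgroup_iso_def by blast
    have gH: "group (G'\<lparr>carrier := H\<rparr>)" using H(1) B.subgroup_imp_group by blast
    have "cyclic_power ?n ?r \<cong> G'\<lparr>carrier := H\<rparr>" using group.iso_sym[OF gH H(2)] .
    then have GH: "G \<cong> G'\<lparr>carrier := H\<rparr>" using iso iso_trans by blast
    then obtain \<phi> where phi: "\<phi> \<in> iso G (G'\<lparr>carrier := H\<rparr>)" unfolding is_iso_def by blast
    have HG: "H \<subseteq> carrier G'" using subgroup.subset[OF H(1)] .
    have im: "\<phi> ` carrier G = H" and inj: "inj_on \<phi> (carrier G)" using phi by (auto simp: iso_def bij_betw_def)
    have hom: "\<phi> \<in> hom G G'" using phi HG unfolding iso_def hom_def by auto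
    have "H = carrier G'"
    proof (rule ccontr)
      assume "H \<noteq> carrier G'"
      then obtain y where y: "y \<in> carrier G'" "y \<notin> \<phi> ` carrier G" using HG im by blast
      have "\<exists>g\<in>carrier G. g \<noteq> \<one>\<^bsub>G\<^esub>"
      proof (rule ccontr)
        assume "\<not> ?thesis"
        then have "carrier G \<subseteq> {\<one>\<^bsub>G\<^esub>}" by blast
        then have "card (carrier G) \<le> 1" using card_mono[of "{\<one>\<^bsub>G\<^esub>}" "carrier G"] by simp
        moreover have "card (carrier G) = ?n ^ ?r"
          using A.exponent_power_subgroup_card[OF A.subgroup_self, of ?r] iso by simp
        moreover have "2 ^ 1 \<le> ?n ^ ?r"
        proof -
          have "?n ^ 1 \<le> ?n ^ ?r" using k1 kr n2 by (intro power_increasing) auto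
          then show ?thesis using n2 by simp
        qed
        ultimately show False by simp
      qed
      then obtain g where "g \<in> carrier G" "g \<noteq> \<one>\<^bsub>G\<^esub>" by blast
      then show False using system_of_sets_of_lengths_neq[OF fG fG' hom inj y] assms(9) by blast
    qed
    then show ?thesis using GH by simp
  qed
  show ?thesis using nn k_eq one two by simp
qed

end
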